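(* The following identities of algebras of operators on $\mathcal A_q^+$ hold: $$\mathcal D(\partial_L,M_Z)={\mathcal W}eyl_q(n,n),$$ and $\mathcal D(\partial_K,M_Z)$ is the algebra generated by all the operators $V^{SE}_{ij}\mathcal D^o_{ij}$ and $V^{SE}_{ij}M^o_{ij}$, $1\le i,j\le n$. In particular, $(H^o_{ij})^{\pm2}\in\mathcal D(\partial_K,M_Z)$ for $(i,j)\ne(1,1)$, while for $(i,j)=(1,1)$ only $(H^o_{11})^{-2}\in\mathcal D(\partial_K,M_Z)$ (and $(H^o_{11})^{2}\notin\mathcal D(\partial_K,M_Z)$).
   Context: Let $n\ge1$ and let $q\in\mathbb C\setminus\{0\}$ not be a root of unity. $\mathcal A_q^+$ is the algebra over $\mathbb C$ generated by $Z_{ij}$, $1\le i,j\le n$, with relations $Z_{ij}Z_{ik}=q^{-1}Z_{ik}Z_{ij}$ for $j<k$; $Z_{ij}Z_{kj}=q^{-1}Z_{kj}Z_{ij}$ for $i<k$; $Z_{ij}Z_{st}=Z_{st}Z_{ij}$ for $i<s$, $t<j$; $Z_{ij}Z_{st}=Z_{st}Z_{ij}-(q-q^{-1})Z_{it}Z_{sj}$ for $i<s$, $j<t$. $\mathcal A_q^-$ is generated by $W_{ij}$ with identical relations. Bases: $Z^{\mathbf a}=Z_{11}^{a_{11}}Z_{21}^{a_{21}}\cdots Z_{n1}^{a_{n1}}Z_{12}^{a_{12}}\cdots Z_{nn}^{a_{nn}}$ and $W^{\mathbf a}$ (same ordering), $\mathbf a\in\mathbb N_0^{n^2}$. With $[a]=(q^a-q^{-a})/(q-q^{-1})$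 and $e_{ij}$ the unit multi-index, define on $\mathcal A_q^+$: $M^o_{ij}Z^{\mathbf a}=Z^{\mathbf a+e_{ij}}$, $D^o_{ij}Z^{\mathbf a}=[a_{ij}]Z^{\mathbf a-e_{ij}}$, $H^o_{ij}Z^{\mathbf a}=q^{a_{ij}}Z^{\mathbf a}$, and $\mathcal D^o_{ij}=(H^o_{ij})^{-1}D^o_{ij}$. ${\mathcal W}eyl_q(n,n)$ is the algebra generated by all $M^o_{ij},D^o_{ij}$. $V^{SE}_{ij}=\prod_{k>i}H^o_{kj}\prod_{s>j}H^o_{is}$. Pairings between $\mathcal A_q^-$ and $\mathcal A_q^+$ (with $|\mathbf a|=\sum a_{ij}$): $(W^{\mathbf b},Z^{\mathbf a})_L=\delta_{\mathbf a,\mathbf b}\left(\frac{-1}{q-q^{-1}}\right)^{|\mathbf a|}\prod[a_{ij}]!$ and $(W^{\mathbf b},Z^{\mathbf a})_K=\delta_{\mathbf a,\mathbf b}\left(\frac{-1}{q-q^{-1}}\right)^{|\mathbf a|}\prod\{\{a_{ij}\}\}!$, where $\{\{a\}\}=1+q^{-2}+\cdots+q^{-(2a-2)}$. Let $M_a$ denote right multiplication $u\mapsto ua$. For $X\in\{L,K\}$, $\widehat{M_{W_{ij}}}^X$ is the operator on $\mathcal A_q^+$ with $(wW_{ij},u)_X=(w,\widehat{M_{W_{ij}}}^Xu)_X$ for all $w\in\mathcal A_q^-$, $u\in\mathcal A_q^+$. $\mathcal D(\partial_X,M_Z)$ is the algebra of operators on $\mathcal A_q^+$ generated by all $\widehat{M_{W_{ij}}}^X$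 and all $M_{Z_{ij}}$. *)

theory Defs
  imports
    Complex_Main
    "HOL-Library.Poly_Mapping"
    "HOL-Algebra.QuotRing"
    "HOL-Algebra.Generated_Rings"
begin

text \<open>
  A wrapper around lists, so that finitely supported functions on words
  carry the convolution product of the monoid algebra.
\<close>

datatype 'a free_word = Word (letters: "'a list")

instantiation free_word :: (type) monoid_add
begin

definition zero_free_word :: "'a free_word" where
  "0 = Word []"

definition plus_free_word :: "'a free_word \<Rightarrow> 'a free_word \<Rightarrow> 'a free_word" where
  "v + w = Word (letters v @ letters w)"

instance
  by standard (simp_all add: zero_free_word_def plus_free_word_def)

end

type_synonym ncpoly = "(nat \<times> nat) free_word \<Rightarrow>\<^sub>0 complex"

definition scalar :: "complex \<Rightarrow> ncpoly" where
  "scalar c = Poly_Mapping.single 0 c"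

definition letter :: "nat \<Rightarrow> nat \<Rightarrow> ncpoly" where
  "letter i j = Poly_Mapping.single (Word [(i, j)]) 1"

definition free_alg :: "nat \<Rightarrow> ncpoly ring" where
  "free_alg n =
    \<lparr>carrier = {x. \<forall>w \<in> Poly_Mapping.keys x. set (letters w) \<subseteq> {1..n} \<times> {1..n}},
     mult = (*), one = 1, zero = 0, add = (+)\<rparr>"

lemma letters_zero [simp]: "letters (0 :: 'a free_word) = []"
  by (simp add: zero_free_word_def)

lemma letters_plus [simp]: "letters (v + w) = letters v @ letters w"
  by (simp add: plus_free_word_def)

lemma free_alg_simps [simp]:
  "x \<otimes>\<^bsub>free_alg n\<^esub> y = x * y"
  "x \<oplus>\<^bsub>free_alg n\<^esub> y = x + y"
  "\<one>\<^bsub>free_alg n\<^esub> = 1"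
  "\<zero>\<^bsub>free_alg n\<^esub> = 0"
  by (simp_all add: free_alg_def)

lemma free_alg_carrier:
  "x \<in> carrier (free_alg n) \<longleftrightarrow>
     (\<forall>w \<in> Poly_Mapping.keys x. set (letters w) \<subseteq> {1..n} \<times> {1..n})"
  by (simp add: free_alg_def)

lemma free_alg_closed:
  assumes "x \<in> carrier (free_alg n)" "y \<in> carrier (free_alg n)"
  shows "x + y \<in> carrier (free_alg n)" "x - y \<in> carrier (free_alg n)"
    "x * y \<in> carrier (free_alg n)"
proof -
  show "x + y \<in> carrier (free_alg n)"
    using assms Poly_Mapping.keys_add[of x y] unfolding free_alg_carrier by blast
  show "x - y \<in> carrier (free_alg n)"
    using assms Poly_Mapping.keys_diff[of x y] unfolding free_alg_carrier by blast
  show "x * y \<in> carrier (free_alg n)"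
    unfolding free_alg_carrier
  proof
    fix w assume "w \<in> Poly_Mapping.keys (x * y)"
    then obtain u v where "w = u + v" "u \<in> Poly_Mapping.keys x" "v \<in> Poly_Mapping.keys y"
      using Poly_Mapping.keys_mult[of x y] by blast
    then show "set (letters w) \<subseteq> {1..n} \<times> {1..n}"
      using assms unfolding free_alg_carrier by (metis letters_plus set_append Un_least)
  qed
qed

lemma free_alg_ring: "ring (free_alg n)"
proof (rule ringI)
  have zero: "0 \<in> carrier (free_alg n)" and one: "1 \<in> carrier (free_alg n)"
    by (simp_all add: free_alg_carrier)
  show "abelian_group (free_alg n)"
  proof (rule abelian_groupI)
    fix x assume "x \<in> carrier (free_alg n)"
    then show "\<exists>y\<in>carrier (free_alg n). y \<oplus>\<^bsub>free_alg n\<^esub> x = \<zero>\<^bsub>free_alg n\<^esub>"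
      using free_alg_closed(2)[OF zero, of x] by (intro bexI[of _ "0 - x"]) simp_all
  qed (simp_all add: free_alg_closed zero add.assoc add.commute)
  show "Group.monoid (free_alg n)"
    by (rule Group.monoidI) (simp_all add: free_alg_closed one mult.assoc)
qed (simp_all add: distrib_left distrib_right)

lemma scalar_in_free_alg: "scalar c \<in> carrier (free_alg n)"
  by (simp add: free_alg_def scalar_def)

lemma letter_in_free_alg:
  "i \<in> {1..n} \<Longrightarrow> j \<in> {1..n} \<Longrightarrow> letter i j \<in> carrier (free_alg n)"
  by (simp add: free_alg_def letter_def)

definition relators :: "nat \<Rightarrow> complex \<Rightarrow> ncpoly set" where
  "relators n q =
     {letter i j * letter i k - scalar (inverse q) * letter i k * letter i j | i j k.
        i \<in> {1..n} \<and> j \<in> {1..n} \<and> k \<in> {1..n} \<and> j < k}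
   \<union> {letter i j * letter k j - scalar (inverse q) * letter k j * letter i j | i j k.
        i \<in> {1..n} \<and> j \<in> {1..n} \<and> k \<in> {1..n} \<and> i < k}
   \<union> {letter i j * letter s t - letter s t * letter i j | i j s t.
        i \<in> {1..n} \<and> j \<in> {1..n} \<and> s \<in> {1..n} \<and> t \<in> {1..n} \<and> i < s \<and> t < j}
   \<union> {letter i j * letter s t
        - (letter s t * letter i j - scalar (q - inverse q) * letter i t * letter s j) | i j s t.
        i \<in> {1..n} \<and> j \<in> {1..n} \<and> s \<in> {1..n} \<and> t \<in> {1..n} \<and> i < s \<and> j < t}"

definition rel_ideal :: "nat \<Rightarrow> complex \<Rightarrow> ncpoly set" where
  "rel_ideal n q = Idl\<^bsub>free_alg n\<^esub> (relators n q)"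

text \<open>
  The algebras \<open>A\<^sub>q\<^sup>+\<close> (generators \<open>Z\<^sub>i\<^sub>j\<close>) and \<open>A\<^sub>q\<^sup>-\<close> (generators \<open>W\<^sub>i\<^sub>j\<close>) have the same
  presentation. Both are represented by \<open>Aq n q\<close>; accordingly \<open>gen n q i j\<close> is \<open>Z\<^sub>i\<^sub>j\<close> or
  \<open>W\<^sub>i\<^sub>j\<close>, and \<open>mon n q a\<close> below is \<open>Z\<^sup>a\<close> or \<open>W\<^sup>a\<close>.
\<close>

definition Aq :: "nat \<Rightarrow> complex \<Rightarrow> ncpoly set ring" where
  "Aq n q = free_alg n Quot rel_ideal n q"

definition gen :: "nat \<Rightarrow> complex \<Rightarrow> nat \<Rightarrow> nat \<Rightarrow> ncpoly set" where
  "gen n q i j = rel_ideal n q +>\<^bsub>free_alg n\<^esub> letter i j"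

definition smul :: "nat \<Rightarrow> complex \<Rightarrow> complex \<Rightarrow> ncpoly set \<Rightarrow> ncpoly set" where
  "smul n q c u = (rel_ideal n q +>\<^bsub>free_alg n\<^esub> scalar c) \<otimes>\<^bsub>Aq n q\<^esub> u"

lemma relators_subset: "relators n q \<subseteq> carrier (free_alg n)"
  unfolding relators_def
  by (intro Un_least subsetI; clarify)
     (intro free_alg_closed scalar_in_free_alg letter_in_free_alg; assumption)+

lemma Aq_ring: "ring (Aq n q)"
proof -
  interpret F: ring "free_alg n" by (rule free_alg_ring)
  interpret I: ideal "rel_ideal n q" "free_alg n"
    unfolding rel_ideal_def by (rule F.genideal_ideal[OF relators_subset])
  show ?thesis
    unfolding Aq_def by (rule I.quotient_is_ring)
qed

type_synonym mindex = "nat \<times> nat \<Rightarrow>\<^sub>0 nat"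

definition mindices :: "nat \<Rightarrow> mindex set" where
  "mindices n = {a. Poly_Mapping.keys a \<subseteq> {1..n} \<times> {1..n}}"

abbreviation unit_index :: "nat \<Rightarrow> nat \<Rightarrow> mindex" where
  "unit_index i j \<equiv> Poly_Mapping.single (i, j) 1"

text \<open>The ordered product runs through the matrix column by column.\<close>

definition mon :: "nat \<Rightarrow> complex \<Rightarrow> mindex \<Rightarrow> ncpoly set" where
  "mon n q a =
     foldr (\<lambda>(i, j) u. (gen n q i j [^]\<^bsub>Aq n q\<^esub> Poly_Mapping.lookup a (i, j)) \<otimes>\<^bsub>Aq n q\<^esub> u)
       [(i, j). j \<leftarrow> [1..<Suc n], i \<leftarrow> [1..<Suc n]] \<one>\<^bsub>Aq n q\<^esub>"

text \<open>
  The description determines \<open>f\<close> because the elements \<open>mon n q a\<close>, \<open>a \<in> mindices n\<close>, form a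
  basis. Only values at indices in \<open>mindices n\<close> enter the two extensions below.
\<close>

definition coord :: "nat \<Rightarrow> complex \<Rightarrow> ncpoly set \<Rightarrow> (mindex \<Rightarrow>\<^sub>0 complex)" where
  "coord n q u =
     (THE f. Poly_Mapping.keys f \<subseteq> mindices n \<and>
        u = (\<Oplus>\<^bsub>Aq n q\<^esub> a \<in> Poly_Mapping.keys f. smul n q (Poly_Mapping.lookup f a) (mon n q a)))"

definition lin_ext ::
    "nat \<Rightarrow> complex \<Rightarrow> (mindex \<Rightarrow> ncpoly set) \<Rightarrow> ncpoly set \<Rightarrow> ncpoly set" where
  "lin_ext n q g =
     (\<lambda>u \<in> carrier (Aq n q). \<Oplus>\<^bsub>Aq n q\<^esub> a \<in> Poly_Mapping.keys (coord n q u).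
        smul n q (Poly_Mapping.lookup (coord n q u) a) (g a))"

definition bilin_ext ::
    "nat \<Rightarrow> complex \<Rightarrow> (mindex \<Rightarrow> mindex \<Rightarrow> complex) \<Rightarrow> ncpoly set \<Rightarrow> ncpoly set \<Rightarrow> complex" where
  "bilin_ext n q g w u =
     (\<Sum>b \<in> Poly_Mapping.keys (coord n q w). \<Sum>a \<in> Poly_Mapping.keys (coord n q u).
        Poly_Mapping.lookup (coord n q w) b * Poly_Mapping.lookup (coord n q u) a * g b a)"

text \<open>
  The algebra of all complex-linear operators on \<open>Aq n q\<close>; operators are
  extensional functions on the carrier and the product is composition.
\<close>

definition lin_ops :: "nat \<Rightarrow> complex \<Rightarrow> (ncpoly set \<Rightarrow> ncpoly set) ring" where
  "lin_ops n q =
    \<lparr>carrier = {T \<in> carrier (Aq n q) \<rightarrow>\<^sub>E carrier (Aq n q).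
        (\<forall>u \<in> carrier (Aq n q). \<forall>v \<in> carrier (Aq n q).
           T (u \<oplus>\<^bsub>Aq n q\<^esub> v) = T u \<oplus>\<^bsub>Aq n q\<^esub> T v) \<and>
        (\<forall>c. \<forall>u \<in> carrier (Aq n q). T (smul n q c u) = smul n q c (T u))},
     mult = compose (carrier (Aq n q)),
     one = (\<lambda>u \<in> carrier (Aq n q). u),
     zero = (\<lambda>u \<in> carrier (Aq n q). \<zero>\<^bsub>Aq n q\<^esub>),
     add = (\<lambda>S T. \<lambda>u \<in> carrier (Aq n q). S u \<oplus>\<^bsub>Aq n q\<^esub> T u)\<rparr>"

text \<open>
  The (unital) complex algebra generated by a set of operators is the subring
  generated by these operators and the scalar operators.
\<close>

definition op_algebra ::
    "nat \<Rightarrow> complex \<Rightarrow> (ncpoly set \<Rightarrow> ncpoly set) set \<Rightarrow> (ncpoly set \<Rightarrow> ncpoly set) set" where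
  "op_algebra n q S =
     generate_ring (lin_ops n q) (range (\<lambda>c. \<lambda>u \<in> carrier (Aq n q). smul n q c u) \<union> S)"

text \<open>
  The symmetric \<open>q\<close>-number \<open>[m]\<close> and its factorial are \<open>qint\<close> and \<open>qfact\<close>; the one-sided version
  \<open>{{m}} = 1 + q\<^sup>-\<^sup>2 + \<dots>\<close> with \<open>m\<close> summands and its factorial are \<open>cint\<close> and \<open>cfact\<close>.
\<close>

definition qint :: "complex \<Rightarrow> nat \<Rightarrow> complex" where
  "qint q m = (q ^ m - inverse q ^ m) / (q - inverse q)"

definition Mo :: "nat \<Rightarrow> complex \<Rightarrow> nat \<Rightarrow> nat \<Rightarrow> ncpoly set \<Rightarrow> ncpoly set" where
  "Mo n q i j = lin_ext n q (\<lambda>a. mon n q (a + unit_index i j))"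

text \<open>If \<open>a\<^sub>i\<^sub>j = 0\<close>, the truncated difference is harmless, as the factor \<open>[a\<^sub>i\<^sub>j]\<close> vanishes.\<close>

definition Do :: "nat \<Rightarrow> complex \<Rightarrow> nat \<Rightarrow> nat \<Rightarrow> ncpoly set \<Rightarrow> ncpoly set" where
  "Do n q i j = lin_ext n q
     (\<lambda>a. smul n q (qint q (Poly_Mapping.lookup a (i, j))) (mon n q (a - unit_index i j)))"

definition Ho :: "nat \<Rightarrow> complex \<Rightarrow> nat \<Rightarrow> nat \<Rightarrow> ncpoly set \<Rightarrow> ncpoly set" where
  "Ho n q i j = lin_ext n q (\<lambda>a. smul n q (q ^ Poly_Mapping.lookup a (i, j)) (mon n q a))"

definition calDo :: "nat \<Rightarrow> complex \<Rightarrow> nat \<Rightarrow> nat \<Rightarrow> ncpoly set \<Rightarrow> ncpoly set" where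
  "calDo n q i j = inv\<^bsub>lin_ops n q\<^esub> (Ho n q i j) \<otimes>\<^bsub>lin_ops n q\<^esub> Do n q i j"

definition Weyl :: "nat \<Rightarrow> complex \<Rightarrow> (ncpoly set \<Rightarrow> ncpoly set) set" where
  "Weyl n q = op_algebra n q
     ({Mo n q i j | i j. i \<in> {1..n} \<and> j \<in> {1..n}} \<union> {Do n q i j | i j. i \<in> {1..n} \<and> j \<in> {1..n}})"

definition VSE :: "nat \<Rightarrow> complex \<Rightarrow> nat \<Rightarrow> nat \<Rightarrow> ncpoly set \<Rightarrow> ncpoly set" where
  "VSE n q i j =
     foldr (\<otimes>\<^bsub>lin_ops n q\<^esub>)
       ([Ho n q k j. k \<leftarrow> [Suc i..<Suc n]] @ [Ho n q i s. s \<leftarrow> [Suc j..<Suc n]])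
       \<one>\<^bsub>lin_ops n q\<^esub>"

definition mindex_size :: "nat \<Rightarrow> mindex \<Rightarrow> nat" where
  "mindex_size n a = (\<Sum>i\<in>{1..n}. \<Sum>j\<in>{1..n}. Poly_Mapping.lookup a (i, j))"

definition qfact :: "complex \<Rightarrow> nat \<Rightarrow> complex" where
  "qfact q m = (\<Prod>k = 1..m. qint q k)"

definition cint :: "complex \<Rightarrow> nat \<Rightarrow> complex" where
  "cint q m = (\<Sum>k<m. inverse q ^ (2 * k))"

definition cfact :: "complex \<Rightarrow> nat \<Rightarrow> complex" where
  "cfact q m = (\<Prod>k = 1..m. cint q k)"

definition pairing_L :: "nat \<Rightarrow> complex \<Rightarrow> ncpoly set \<Rightarrow> ncpoly set \<Rightarrow> complex" where
  "pairing_L n q = bilin_ext n q (\<lambda>b a. if a = b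
     then (-1 / (q - inverse q)) ^ mindex_size n a *
          (\<Prod>i\<in>{1..n}. \<Prod>j\<in>{1..n}. qfact q (Poly_Mapping.lookup a (i, j)))
     else 0)"

definition pairing_K :: "nat \<Rightarrow> complex \<Rightarrow> ncpoly set \<Rightarrow> ncpoly set \<Rightarrow> complex" where
  "pairing_K n q = bilin_ext n q (\<lambda>b a. if a = b
     then (-1 / (q - inverse q)) ^ mindex_size n a *
          (\<Prod>i\<in>{1..n}. \<Prod>j\<in>{1..n}. cfact q (Poly_Mapping.lookup a (i, j)))
     else 0)"

definition right_mult :: "nat \<Rightarrow> complex \<Rightarrow> ncpoly set \<Rightarrow> ncpoly set \<Rightarrow> ncpoly set" where
  "right_mult n q x = (\<lambda>u \<in> carrier (Aq n q). u \<otimes>\<^bsub>Aq n q\<^esub> x)"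

text \<open>
  For the two pairings \<open>B\<close> above, the description determines \<open>T\<close> because \<open>B\<close> is
  nondegenerate when \<open>q\<close> is not a root of unity.
\<close>

definition adjoint ::
    "nat \<Rightarrow> complex \<Rightarrow> (ncpoly set \<Rightarrow> ncpoly set \<Rightarrow> complex) \<Rightarrow>
     (ncpoly set \<Rightarrow> ncpoly set) \<Rightarrow> ncpoly set \<Rightarrow> ncpoly set" where
  "adjoint n q B S =
     (THE T. T \<in> carrier (lin_ops n q) \<and>
        (\<forall>w \<in> carrier (Aq n q). \<forall>u \<in> carrier (Aq n q). B (S w) u = B w (T u)))"

definition D_alg ::
    "nat \<Rightarrow> complex \<Rightarrow> (ncpoly set \<Rightarrow> ncpoly set \<Rightarrow> complex) \<Rightarrow> (ncpoly set \<Rightarrow> ncpoly set) set" where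
  "D_alg n q B = op_algebra n q
     ({adjoint n q B (right_mult n q (gen n q i j)) | i j. i \<in> {1..n} \<and> j \<in> {1..n}} \<union>
      {right_mult n q (gen n q i j) | i j. i \<in> {1..n} \<and> j \<in> {1..n}})"

end

theory Submission
  imports Defs "HOL-Library.Function_Algebras" "HOL-Library.Multiset" "HOL-Computational_Algebra.Polynomial"
begin

text \<open>
  Right multiplication by \<open>Z\<^sub>i\<^sub>j\<close> is computed in the monomial basis by moving \<open>Z\<^sub>i\<^sub>j\<close> to the left through
  the columns \<open>n, n - 1, \<dots>\<close>. In column \<open>t > j\<close> the factor either passes unchanged, at the cost of
  \<open>H\<^sub>i\<^sub>t\<close>, or turns some \<open>Z\<^sub>s\<^sub>t\<close>, \<open>s > i\<close>, into \<open>Z\<^sub>i\<^sub>t\<close> and continues as \<open>Z\<^sub>s\<^sub>j\<close>. So right multiplication is an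
  entry of a product of one matrix of operators per column. Each of these matrices satisfies the
  quantum matrix relations, and products of such matrices with commuting entries do so again;
  hence the algebra acts on exponents, which makes the ordered monomials linearly independent.

  Up to \<open>H\<^sup>\<plusminus>\<^sup>2\<close>, every term of this expansion is a product of operators \<open>V\<^sup>S\<^sup>E M\<^sup>o\<close> and \<open>V\<^sup>S\<^sup>E \<D>\<^sup>o\<close>.
  The expansion is triangular, with leading term \<open>V\<^sup>S\<^sup>E\<^sub>i\<^sub>j M\<^sup>o\<^sub>i\<^sub>j\<close>, and can be inverted by descending
  induction on columns and rows. Adjoints exchange raising and lowering operators up to a
  scalar, so it suffices to treat the raising ones.
\<close>

subsection \<open>Linear operators on functions of exponents\<close>

text \<open>Coordinates and adjoints are given by definite descriptions, which say nothing until the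
  monomials are known to be a basis and adjoints are known to exist. Hence the action on exponents
  is built from explicit coefficients, without reference to the algebra, and compared with it only
  afterwards. The relations would be unwieldy for an operator that involves all columns; split by
  columns, they become identities between powers of \<open>q\<close> within one column. Adjoints of
  right multiplications are not computed: these operators lie in an algebra whose generators have
  visible adjoints. The cell (1,1) is exceptional because it lies neither below nor to the right of
  any cell, so that no V^SE_ij contains H_11. Negative squares arise from raising and lowering at
  the cell itself, positive ones from the factor V^SE of the neighbour above or to the left.\<close>

type_synonym expo = "nat \<times> nat \<Rightarrow> int"

text \<open>All functions of exponents are allowed, so no support condition accompanies the
  operators; as a type of class \<open>ring_1\<close> they admit the usual algebra of sums and
  products.\<close>

typedef linop = "{f :: (expo \<Rightarrow> complex) \<Rightarrow> (expo \<Rightarrow> complex).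
    (\<forall>x y. f (x + y) = f x + f y) \<and> (\<forall>c x. f (\<lambda>a. c * x a) = (\<lambda>a. c * f x a))}"
  morphisms app Linop
  by (rule exI[of _ "\<lambda>x. x"]) simp

setup_lifting type_definition_linop

lemma app_add: "app S (x + y) = app S x + app S y"
  and app_scale: "app S (\<lambda>a. c * x a) = (\<lambda>a. c * app S x a)"
  using app[of S] by blast+

lemma linop_eqI: "(\<And>x. app S x = app T x) \<Longrightarrow> S = T"
  by (metis app_inject ext)

instantiation linop :: ring_1
begin

lift_definition zero_linop :: linop is "\<lambda>x a. 0" by (simp add: fun_eq_iff)
lift_definition one_linop :: linop is "\<lambda>x. x" by simp
lift_definition plus_linop :: "linop \<Rightarrow> linop \<Rightarrow> linop" is "\<lambda>f g x. f x + g x"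
  by (auto simp: fun_eq_iff algebra_simps)
lift_definition uminus_linop :: "linop \<Rightarrow> linop" is "\<lambda>f x. - f x"
  by (auto simp: fun_eq_iff algebra_simps)
lift_definition minus_linop :: "linop \<Rightarrow> linop \<Rightarrow> linop" is "\<lambda>f g x. f x - g x"
  by (auto simp: fun_eq_iff algebra_simps)
lift_definition times_linop :: "linop \<Rightarrow> linop \<Rightarrow> linop" is "\<lambda>f g x. f (g x)"
  by simp

instance
proof
  fix a b c :: linop
  show "a + b + c = a + (b + c)" by transfer (simp add: fun_eq_iff)
  show "a + b = b + a" by transfer (simp add: fun_eq_iff)
  show "0 + a = a" by transfer (simp add: fun_eq_iff)
  show "- a + a = 0" by transfer (simp add: fun_eq_iff)
  show "a - b = a + - b" by transfer (simp add: fun_eq_iff)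
  show "a * b * c = a * (b * c)" by transfer simp
  show "(a + b) * c = a * c + b * c" by transfer simp
  show "a * (b + c) = a * b + a * c" by transfer simp
  show "1 * a = a" by transfer simp
  show "a * 1 = a" by transfer simp
  show "(0::linop) \<noteq> 1" by transfer (metis zero_neq_one)
qed

end

lemma app_simps [simp]:
  "app 0 x = 0" "app 1 x = x" "app (S + T) x = app S x + app T x"
  "app (- S) x = - app S x" "app (S - T) x = app S x - app T x" "app (S * T) x = app S (app T x)"
  by (transfer; simp add: fun_eq_iff)+

lemma app_zero [simp]: "app S 0 = 0"
  using app_add[of S 0 0] by simp

lemma app_sum: "app (sum f A) x = (\<Sum>i\<in>A. app (f i) x)"
  by (induction A rule: infinite_finite_induct) auto

text \<open>
  The operator \<open>shift_op d c\<close> sends the basis element with exponent \<open>e\<close> to \<open>c e\<close> times the one with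
  exponent \<open>e + d\<close>. Negative exponents are admitted, so that every shift is invertible and
  lowering operators need no truncation.
\<close>

lift_definition shift_op :: "expo \<Rightarrow> (expo \<Rightarrow> complex) \<Rightarrow> linop" is
  "\<lambda>d c x a. c (a - d) * x (a - d)"
  by (auto simp: fun_eq_iff algebra_simps)

abbreviation diag_op :: "(expo \<Rightarrow> complex) \<Rightarrow> linop" where
  "diag_op \<equiv> shift_op 0"

abbreviation scalar_op :: "complex \<Rightarrow> linop" where
  "scalar_op k \<equiv> shift_op 0 (\<lambda>_. k)"

lemma app_shift_op: "app (shift_op d c) x = (\<lambda>a. c (a - d) * x (a - d))"
  by transfer simp

lemma shift_op_mult: "shift_op d c * shift_op d' c' = shift_op (d + d') (\<lambda>a. c (a + d') * c' a)"
proof (rule linop_eqI, rule ext)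
  fix x :: "expo \<Rightarrow> complex" and a :: expo
  have e: "a - d - d' = a - (d + d')" "a - (d + d') + d' = a - d"
    by (simp_all add: algebra_simps)
  show "app (shift_op d c * shift_op d' c') x a = app (shift_op (d + d') (\<lambda>a. c (a + d') * c' a)) x a"
    unfolding app_simps app_shift_op e by (simp only: mult.assoc)
qed

lemma shift_op_add: "shift_op d c + shift_op d c' = shift_op d (\<lambda>a. c a + c' a)"
  by (rule linop_eqI) (simp add: app_shift_op fun_eq_iff algebra_simps)

lemma shift_op_minus: "shift_op d c - shift_op d c' = shift_op d (\<lambda>a. c a - c' a)"
  by (rule linop_eqI) (simp add: app_shift_op fun_eq_iff algebra_simps)

lemma shift_op_0: "shift_op d (\<lambda>a. 0) = 0"
  by (rule linop_eqI) (simp add: app_shift_op fun_eq_iff)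

lemma scalar_op_1: "scalar_op 1 = 1"
  by (rule linop_eqI) (simp add: app_shift_op fun_eq_iff)

lemma scalar_op_add: "scalar_op (k + l) = scalar_op k + scalar_op l"
  by (simp add: shift_op_add)

lemma scalar_op_mult: "scalar_op (k * l) = scalar_op k * scalar_op l"
  by (simp add: shift_op_mult)

lemma app_scalar_op: "app (scalar_op k) x = (\<lambda>a. k * x a)"
  by (simp add: app_shift_op)

lemma scalar_op_comm: "scalar_op k * S = S * scalar_op k"
  by (rule linop_eqI) (simp add: app_scalar_op app_scale)

definition delta :: "expo \<Rightarrow> expo \<Rightarrow> complex" where
  "delta e = (\<lambda>a. if a = e then 1 else 0)"

lemma app_shift_op_delta: "app (shift_op d c) (delta e) = (\<lambda>a. c e * delta (e + d) a)"
proof (rule ext)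
  fix a
  have "a - d = e \<longleftrightarrow> a = e + d" by (metis add_diff_cancel diff_add_cancel)
  then show "app (shift_op d c) (delta e) a = c e * delta (e + d) a"
    by (auto simp: app_shift_op delta_def)
qed

subsection \<open>Quantum matrices of operators\<close>

text \<open>
  These are the components of \<open>R T\<^sub>1 T\<^sub>2 = T\<^sub>2 T\<^sub>1 R\<close> for the \<open>R\<close>-matrix of type \<open>A\<close>. Compared with the
  relations of the algebra, all products are reversed, since right multiplications compose in
  the opposite order.
\<close>

definition frt :: "complex \<Rightarrow> nat set \<Rightarrow> (nat \<Rightarrow> nat \<Rightarrow> linop) \<Rightarrow> bool" where
  "frt q I T \<longleftrightarrow> (\<forall>i\<in>I. \<forall>k\<in>I. \<forall>j\<in>I. \<forall>m\<in>I.
     scalar_op (if i = k then q else 1) * (T i j * T k m) + scalar_op (if k < i then q - inverse q else 0) * (T k j * T i m) =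
     scalar_op (if j = m then q else 1) * (T k m * T i j) + scalar_op (if j < m then q - inverse q else 0) * (T k j * T i m))"

lemma frtD:
  assumes "frt q I T" "i \<in> I" "k \<in> I" "j \<in> I" "m \<in> I"
  shows "scalar_op (if i = k then q else 1) * (T i j * T k m) + scalar_op (if k < i then q - inverse q else 0) * (T k j * T i m) =
     scalar_op (if j = m then q else 1) * (T k m * T i j) + scalar_op (if j < m then q - inverse q else 0) * (T k j * T i m)"
  using assms unfolding frt_def by blast

lemma scalar_op_left: "S * (scalar_op k * T) = scalar_op k * (S * T)"
  by (metis mult.assoc scalar_op_comm)

text \<open>This is the coproduct of quantum matrices: the R-matrix moves past the product of the
  \<open>P\<close> entries by the relations of \<open>P\<close>, then past the \<open>Q\<close>
  entries by those of \<open>Q\<close>. Commutation of entries serves to sort the mixed products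
  into this form.\<close>

lemma frt_prod:
  assumes P: "frt q I P" and Q: "frt q I Q"
    and c: "\<And>i r s j. i \<in> I \<Longrightarrow> r \<in> I \<Longrightarrow> s \<in> I \<Longrightarrow> j \<in> I \<Longrightarrow> Q s j * P i r = P i r * Q s j"
  shows "frt q I (\<lambda>i j. \<Sum>r\<in>I. P i r * Q r j)"
  unfolding frt_def
proof (intro ballI)
  fix i k j m assume I: "i \<in> I" "k \<in> I" "j \<in> I" "m \<in> I"
  let ?T = "\<lambda>i j. \<Sum>r\<in>I. P i r * Q r j"
  let ?w = "\<lambda>a b. scalar_op (if a = b then q else 1)"
  let ?l = "\<lambda>a b::nat. scalar_op (if a < b then q - inverse q else 0)"
  have T: "?T x y * ?T u v = (\<Sum>r\<in>I. \<Sum>s\<in>I. P x r * P u s * (Q r y * Q s v))"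
    if "x \<in> I" "y \<in> I" "u \<in> I" "v \<in> I" for x y u v
    unfolding sum_product
  proof (intro sum.cong refl)
    fix r s assume "r \<in> I" "s \<in> I"
    have "P x r * Q r y * (P u s * Q s v) = P x r * (Q r y * P u s) * Q s v"
      by (simp add: mult.assoc)
    also have "\<dots> = P x r * P u s * (Q r y * Q s v)"
      using c[of u s r y] that \<open>r \<in> I\<close> \<open>s \<in> I\<close> by (simp add: mult.assoc)
    finally show "P x r * Q r y * (P u s * Q s v) = P x r * P u s * (Q r y * Q s v)" .
  qed
  have T': "?T u v * ?T x y = (\<Sum>r\<in>I. \<Sum>s\<in>I. P u s * P x r * (Q s v * Q r y))"
    if "x \<in> I" "y \<in> I" "u \<in> I" "v \<in> I" for x y u v
    unfolding T[OF that(3,4,1,2)] by (rule sum.swap)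
  have L: "?w i k * (?T i j * ?T k m) + ?l k i * (?T k j * ?T i m)
    = (\<Sum>r\<in>I. \<Sum>s\<in>I. (?w r s * (P k s * P i r) + ?l r s * (P k r * P i s)) * (Q r j * Q s m))"
    unfolding T[OF I(1,3,2,4)] T[OF I(2,3,1,4)]
    unfolding sum_distrib_left sum.distrib[symmetric]
  proof (intro sum.cong refl)
    fix r s assume "r \<in> I" "s \<in> I"
    show "?w i k * (P i r * P k s * (Q r j * Q s m)) + ?l k i * (P k r * P i s * (Q r j * Q s m))
      = (?w r s * (P k s * P i r) + ?l r s * (P k r * P i s)) * (Q r j * Q s m)"
      unfolding frtD[OF P I(1,2) \<open>r \<in> I\<close> \<open>s \<in> I\<close>, symmetric] by (simp only: mult.assoc distrib_right)
  qed
  have R: "?w j m * (?T k m * ?T i j) + ?l j m * (?T k j * ?T i m)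
    = (\<Sum>r\<in>I. \<Sum>s\<in>I. P k s * P i r * (?w r s * (Q r j * Q s m) + ?l s r * (Q s j * Q r m)))"
    unfolding T'[OF I(1,3,2,4)] T'[OF I(1,4,2,3)]
    unfolding sum_distrib_left sum.distrib[symmetric]
  proof (intro sum.cong refl)
    fix r s assume "r \<in> I" "s \<in> I"
    show "?w j m * (P k s * P i r * (Q s m * Q r j)) + ?l j m * (P k s * P i r * (Q s j * Q r m))
      = P k s * P i r * (?w r s * (Q r j * Q s m) + ?l s r * (Q s j * Q r m))"
      unfolding frtD[OF Q \<open>r \<in> I\<close> \<open>s \<in> I\<close> I(3,4)] by (simp only: distrib_left scalar_op_left)
  qed
  \<comment> \<open>The correction terms of the two sides contain the same products with the
    summation indices exchanged.\<close>
  have S: "(\<Sum>r\<in>I. \<Sum>s\<in>I. P k s * P i r * (?l s r * (Q s j * Q r m)))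
     = (\<Sum>r\<in>I. \<Sum>s\<in>I. ?l r s * (P k r * P i s) * (Q r j * Q s m))"
    by (subst sum.swap) (simp only: scalar_op_left mult.assoc)
  show "?w i k * (?T i j * ?T k m) + ?l k i * (?T k j * ?T i m)
      = ?w j m * (?T k m * ?T i j) + ?l j m * (?T k j * ?T i m)"
    unfolding L R distrib_left distrib_right sum.distrib S by (simp only: scalar_op_left mult.assoc)
qed

lemma frtI:
  fixes T :: "nat \<Rightarrow> nat \<Rightarrow> linop"
  assumes q: "q \<noteq> 0"
    and row: "\<And>i j m. \<lbrakk>i \<in> I; j \<in> I; m \<in> I; j < m\<rbrakk> \<Longrightarrow> T i j * T i m = scalar_op q * (T i m * T i j)"
    and col: "\<And>i k j. \<lbrakk>i \<in> I; j \<in> I; k \<in> I; i < k\<rbrakk> \<Longrightarrow> T i j * T k j = scalar_op q * (T k j * T i j)"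
    and anti: "\<And>i k j m. \<lbrakk>i \<in> I; j \<in> I; k \<in> I; m \<in> I; i < k; m < j\<rbrakk> \<Longrightarrow> T i j * T k m = T k m * T i j"
    and diag: "\<And>i k j m. \<lbrakk>i \<in> I; j \<in> I; k \<in> I; m \<in> I; i < k; j < m\<rbrakk> \<Longrightarrow>
       T i j * T k m = T k m * T i j + scalar_op (q - inverse q) * (T k j * T i m)"
  shows "frt q I T"
  unfolding frt_def
proof (intro ballI)
  fix i k j m assume I: "i \<in> I" "k \<in> I" "j \<in> I" "m \<in> I"
  \<comment> \<open>With two equal row or column indices, the correction term is a multiple of one
    of the main products; splitting q as q^-1 + (q - q^-1) absorbs it.\<close>
  have scalar_op: "scalar_op q * S = scalar_op (inverse q) * S + scalar_op (q - inverse q) * S"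
    "scalar_op (inverse q) * (scalar_op q * S) = S" for S
    using q by (simp_all add: distrib_right[symmetric] shift_op_add mult.assoc[symmetric] shift_op_mult scalar_op_1)
  consider "i = k" "j = m" | "i = k" "j < m" | "i = k" "m < j" | "i < k" "j = m" | "k < i" "j = m"
    | "i < k" "j < m" | "i < k" "m < j" | "k < i" "j < m" | "k < i" "m < j"
    by linarith
  then show "scalar_op (if i = k then q else 1) * (T i j * T k m) + scalar_op (if k < i then q - inverse q else 0) * (T k j * T i m) =
     scalar_op (if j = m then q else 1) * (T k m * T i j) + scalar_op (if j < m then q - inverse q else 0) * (T k j * T i m)"
  proof cases
    case 1 then show ?thesis by (simp add: shift_op_0)
  next
    case 2 
    then show ?thesis using scalar_op(1)[of "T i j * T i m"] scalar_op(2)[of "T i m * T i j"] row[of i j m] I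
      by (simp add: shift_op_0 scalar_op_1)
  next
    case 3 then show ?thesis using row[of i m j] I by (simp add: shift_op_0 scalar_op_1)
  next
    case 4 then show ?thesis using col[of i j k] I by (simp add: shift_op_0 scalar_op_1)
  next
    case 5 
    then show ?thesis using scalar_op(1)[of "T k j * T i j"] scalar_op(2)[of "T i j * T k j"] col[of k j i] I
      by (simp add: shift_op_0 scalar_op_1)
  next
    case 6 then show ?thesis using diag[of i j k m] I by (simp add: shift_op_0 scalar_op_1)
  next
    case 7 then show ?thesis using anti[of i j k m] I by (simp add: shift_op_0 scalar_op_1)
  next
    case 8 then show ?thesis using anti[of k m i j] I by (simp add: shift_op_0 scalar_op_1)
  next
    case 9 then show ?thesis using diag[of k m i j] anti[of k j i m] I by (simp add: shift_op_0 scalar_op_1)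
  qed
qed

text \<open>Right multiplication by a product x y applies x first and then y, so these reversed
  relations are the images of the four kinds of relators.\<close>

lemma frt_relations:
  assumes F: "frt q I T" and q: "q \<noteq> 0"
  shows frt_row: "\<lbrakk>i \<in> I; j \<in> I; m \<in> I; j < m\<rbrakk> \<Longrightarrow> T i m * T i j = scalar_op (inverse q) * (T i j * T i m)"
    and frt_col: "\<lbrakk>i \<in> I; j \<in> I; k \<in> I; i < k\<rbrakk> \<Longrightarrow> T k j * T i j = scalar_op (inverse q) * (T i j * T k j)"
    and frt_anti: "\<lbrakk>i \<in> I; j \<in> I; k \<in> I; m \<in> I; i < k; m < j\<rbrakk> \<Longrightarrow> T k m * T i j = T i j * T k m"
    and frt_diag: "\<lbrakk>i \<in> I; j \<in> I; k \<in> I; m \<in> I; i < k; j < m\<rbrakk> \<Longrightarrow>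
       T k m * T i j = T i j * T k m - scalar_op (q - inverse q) * (T k j * T i m)"
proof -
  have scalar_op: "scalar_op (inverse q) * (scalar_op q * S) = S" for S
    using q by (simp_all add: mult.assoc[symmetric] shift_op_mult scalar_op_1)
  show "T i m * T i j = scalar_op (inverse q) * (T i j * T i m)" if "i \<in> I" "j \<in> I" "m \<in> I" "j < m"
    using frtD[OF F that(1) that(1) that(3) that(2)] scalar_op[of "T i m * T i j"] that
    by (simp add: shift_op_0 scalar_op_1)
  show "T k j * T i j = scalar_op (inverse q) * (T i j * T k j)" if "i \<in> I" "j \<in> I" "k \<in> I" "i < k"
    using frtD[OF F that(1) that(3) that(2) that(2)] scalar_op[of "T k j * T i j"] that
    by (simp add: shift_op_0 scalar_op_1)
  show "T k m * T i j = T i j * T k m" if "i \<in> I" "j \<in> I" "k \<in> I" "m \<in> I" "i < k" "m < j"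
    using frtD[OF F that(1) that(3) that(2) that(4)] that by (simp add: shift_op_0 scalar_op_1)
  show "T k m * T i j = T i j * T k m - scalar_op (q - inverse q) * (T k j * T i m)"
    if "i \<in> I" "j \<in> I" "k \<in> I" "m \<in> I" "i < k" "j < m"
    using frtD[OF F that(1) that(3) that(2) that(4)] that by (simp add: shift_op_0 scalar_op_1)
qed

subsection \<open>The operators of right multiplication\<close>

lemma shift_op_comm:
  assumes "\<And>a. c (a + d') = c a" "\<And>a. c' (a + d) = c' a"
  shows "shift_op d c * shift_op d' c' = shift_op d' c' * shift_op d c"
  unfolding shift_op_mult assms by (simp add: add.commute mult.commute)

definition unit_expo :: "nat \<times> nat \<Rightarrow> expo" where
  "unit_expo p = (\<lambda>x. if x = p then 1 else 0)"

definition row_unit :: "nat \<Rightarrow> nat \<Rightarrow> nat \<Rightarrow> expo" where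
  "row_unit n t s = (if s \<le> n then unit_expo (s, t) else 0)"

text \<open>Moving Z_ij, with i < s and j < t, to the left through Z_st^a gives one term Z_sj Z_it
  Z_st^(a-1) for each of the a factors, with weights (q - q^-1) q^(2m), 0 \<le> m < a. The geometric
  sum is q^-1 (q^(2a) - 1), and it vanishes at a = 0. The default 1 belongs to the absorbed
  factor.\<close>

definition lower_coeff :: "nat \<Rightarrow> complex \<Rightarrow> nat \<Rightarrow> nat \<Rightarrow> expo \<Rightarrow> complex" where
  "lower_coeff n q t s a = (if s \<le> n then inverse q * (q powi a (s, t) * q powi a (s, t) - 1) else 1)"

text \<open>The power of \<open>q\<close> is the cost of moving the new Z_it up past the entries of
  column \<open>t\<close> in the rows strictly between \<open>i\<close> and \<open>s\<close>. For
  \<open>s < i\<close> the factor commutes with Z_st and nothing turns, so the matrix is upper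
  triangular.\<close>

definition col_coeff :: "nat \<Rightarrow> complex \<Rightarrow> nat \<Rightarrow> nat \<Rightarrow> nat \<Rightarrow> expo \<Rightarrow> complex" where
  "col_coeff n q t i s a =
     (if i = s then if i \<le> n then q powi a (i, t) else 0
      else if i < s then q powi (\<Sum>k\<in>{i<..<s}. a (k, t)) * lower_coeff n q t s a else 0)"

text \<open>
  For \<open>s \<le> n\<close> the operator \<open>col_op n q t i s\<close> describes the passage through column \<open>t\<close> of a factor that
  enters in row \<open>i\<close> and leaves in row \<open>s\<close>; the index \<open>s = Suc n\<close> stands for a factor of column \<open>t\<close>
  itself, which is absorbed. Row \<open>Suc n\<close> vanishes and makes the matrix square.
\<close>

definition col_op :: "nat \<Rightarrow> complex \<Rightarrow> nat \<Rightarrow> nat \<Rightarrow> nat \<Rightarrow> linop" where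
  "col_op n q t i s = shift_op (row_unit n t i - row_unit n t s) (col_coeff n q t i s)"

lemma sum_split: "i < k \<Longrightarrow> k < s \<Longrightarrow>
    (\<Sum>k\<in>{i<..<s}. f k) = (\<Sum>k\<in>{i<..<k}. f k) + f k + (\<Sum>k\<in>{k<..<s}. f k :: int)" for i k s :: nat
proof -
  assume "i < k" "k < s"
  then have e: "{i<..<s} = insert k ({i<..<k} \<union> {k<..<s})" by auto
  show ?thesis unfolding e by (subst sum.insert) (auto simp: sum.union_disjoint)
qed

lemma shift_at: "s \<le> n \<Longrightarrow> (a + (row_unit n t p - row_unit n t r)) (s, t) =
    a (s, t) + (if s = p then 1 else 0) - (if s = r then 1 else 0)"
  by (auto simp: row_unit_def unit_expo_def)

lemma shift_sum:
  assumes "s \<le> Suc n"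
  shows "(\<Sum>k\<in>{i<..<s}. (a + (row_unit n t p - row_unit n t r)) (k, t)) =
    (\<Sum>k\<in>{i<..<s}. a (k, t)) + (if i < p \<and> p < s then 1 else 0) - (if i < r \<and> r < s then 1 else 0)"
proof -
  have "(\<Sum>k\<in>{i<..<s}. (a + (row_unit n t p - row_unit n t r)) (k, t)) =
      (\<Sum>k\<in>{i<..<s}. a (k, t) + (if k = p then 1 else 0) - (if k = r then 1 else 0))"
    using assms by (intro sum.cong refl shift_at) auto
  then show ?thesis by (simp add: sum.distrib sum_subtractf)
qed

text \<open>Shifted exponents have to stay folded for the rewrite rules below.\<close>

declare plus_fun_apply [simp del]

definition col_coeff_at :: "nat \<Rightarrow> complex \<Rightarrow> nat \<Rightarrow> nat \<Rightarrow> nat \<Rightarrow> expo \<Rightarrow> nat \<Rightarrow> nat \<Rightarrow> complex" where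
  "col_coeff_at n q t i s a p r = col_coeff n q t i s (a + (row_unit n t p - row_unit n t r))"

lemma col_coeff_shift:
  assumes "i \<noteq> s" "s \<le> Suc n" "q \<noteq> 0"
  shows "col_coeff_at n q t i s a p r =
    (if i < s then q powi (\<Sum>k\<in>{i<..<s}. a (k, t)) * (if i < p \<and> p < s then q else 1)
        * (if i < r \<and> r < s then inverse q else 1) *
       (if s \<le> n then inverse q * ((q powi a (s, t) * (if s = p then q else 1) * (if s = r then inverse q else 1))^2 - 1) else 1)
     else 0)"
  using assms
  unfolding col_coeff_at_def col_coeff_def lower_coeff_def shift_sum[OF assms(2)]
  by (auto simp: shift_at power_int_add power_int_diff power2_eq_square divide_inverse)

lemma col_coeff_shift_diag:
  assumes "q \<noteq> 0"
  shows "col_coeff_at n q t i i a p r =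
    (if i \<le> n then q powi a (i, t) * (if i = p then q else 1) * (if i = r then inverse q else 1) else 0)"
  using assms by (auto simp: col_coeff_at_def col_coeff_def shift_at power_int_add power_int_diff divide_inverse)

lemma col_coeff_eq:
  assumes "i \<noteq> s"
  shows "col_coeff n q t i s a =
    (if i < s then q powi (\<Sum>k\<in>{i<..<s}. a (k, t)) *
       (if s \<le> n then inverse q * ((q powi a (s, t))^2 - 1) else 1) else 0)"
  using assms by (auto simp: col_coeff_def lower_coeff_def power2_eq_square)

lemma col_coeff_eq_diag: "col_coeff n q t i i a = (if i \<le> n then q powi a (i, t) else 0)"
  by (simp add: col_coeff_def)

lemmas col_coeff_rules = col_coeff_shift col_coeff_shift_diag col_coeff_eq col_coeff_eq_diag

text \<open>In each relation all products shift the exponent by the same vector, so the relation is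
  an identity between coefficients at a fixed exponent. Only the relation with a correction term,
  \<open>i < k\<close> and \<open>j < m\<close>, requires a cost sum to be split.\<close>

lemma col_op_frt:
  assumes q: "q \<noteq> 0"
  shows "frt q {1..Suc n} (col_op n q t)"
proof (rule frtI[OF q], goal_cases)
  case (1 i j m)
  have "col_coeff_at n q t i j a i m * col_coeff n q t i m a
      = q * (col_coeff_at n q t i m a i j * col_coeff n q t i j a)" for a
    using 1 q by (cases i j rule: linorder_cases) (simp_all add: col_coeff_rules)
  then show ?case
    unfolding col_op_def shift_op_mult col_coeff_at_def[symmetric] by (simp add: add.commute)
next
  case (2 i k j)
  have "col_coeff_at n q t i j a k j * col_coeff n q t k j a
      = q * (col_coeff_at n q t k j a i j * col_coeff n q t i j a)" for a
    using 2 q by (cases k j rule: linorder_cases) (simp_all add: col_coeff_rules field_simps)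
  then show ?case
    unfolding col_op_def shift_op_mult col_coeff_at_def[symmetric] by (simp add: add.commute)
next
  case (3 i k j m)
  have "col_coeff_at n q t i j a k m * col_coeff n q t k m a
      = col_coeff_at n q t k m a i j * col_coeff n q t i j a" for a
    using 3 q by (cases k m rule: linorder_cases) (simp_all add: col_coeff_rules)
  then show ?case
    unfolding col_op_def shift_op_mult col_coeff_at_def[symmetric] by (simp add: add.commute)
next
  case (4 i k j m)
  have "col_coeff_at n q t i j a k m * col_coeff n q t k m a
      = col_coeff_at n q t k m a i j * col_coeff n q t i j a
       + (q - inverse q) * (col_coeff_at n q t k j a i m * col_coeff n q t i m a)" for a
  proof (cases i j rule: linorder_cases)
    case less
    show ?thesis
    proof (cases k j rule: linorder_cases)
      case less
      \<comment> \<open>Row \<open>k\<close> lies inside both intervals; isolating it exposes the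
        exponent at \<open>(k, t)\<close> and the cost sums of the entries that start in row
        \<open>k\<close>.\<close>
      have "(\<Sum>k\<in>{i<..<j}. a (k, t)) = (\<Sum>k\<in>{i<..<k}. a (k, t)) + a (k, t) + (\<Sum>k\<in>{k<..<j}. a (k, t))"
        "(\<Sum>k\<in>{i<..<m}. a (k, t)) = (\<Sum>k\<in>{i<..<k}. a (k, t)) + a (k, t) + (\<Sum>k\<in>{k<..<m}. a (k, t))"
        using less 4 by (auto intro!: sum_split)
      then show ?thesis
        using less \<open>i < j\<close> 4 q by (auto simp: col_coeff_rules power_int_add field_simps power2_eq_square)
    next
      case equal
      have "(\<Sum>k\<in>{i<..<m}. a (k, t)) = (\<Sum>k\<in>{i<..<k}. a (k, t)) + a (k, t) + (\<Sum>k\<in>{k<..<m}. a (k, t))"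
        using equal 4 by (auto intro!: sum_split)
      then show ?thesis
        using equal \<open>i < j\<close> 4 q by (auto simp: col_coeff_rules power_int_add field_simps power2_eq_square)
    next
      case greater
      then show ?thesis
        using \<open>i < j\<close> 4 q by (cases k m rule: linorder_cases) (auto simp: col_coeff_rules)
    qed
  next
    case equal
    then show ?thesis using 4 q by (cases k m rule: linorder_cases) (auto simp: col_coeff_rules)
  next
    case greater
    then show ?thesis using 4 q by (auto simp: col_coeff_rules)
  qed
  moreover have d: "row_unit n t k - row_unit n t m + (row_unit n t i - row_unit n t j) = row_unit n t i - row_unit n t j + (row_unit n t k - row_unit n t m)"
    "row_unit n t k - row_unit n t j + (row_unit n t i - row_unit n t m) = row_unit n t i - row_unit n t j + (row_unit n t k - row_unit n t m)"
    by (simp_all add: algebra_simps)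
  ultimately show ?case
    unfolding col_op_def shift_op_mult col_coeff_at_def[symmetric] d by (simp add: shift_op_add)
qed

declare plus_fun_apply [simp]

text \<open>The coefficients of a column matrix read only the exponents of their own column.\<close>

lemma col_op_comm:
  assumes "t \<noteq> t'"
  shows "col_op n q t i s * col_op n q t' i' s' = col_op n q t' i' s' * col_op n q t i s"
proof -
  have *: "(a + (row_unit n t' p - row_unit n t' r)) (k, t) = a (k, t)" if "t \<noteq> t'" for a p r k t t'
    using that by (auto simp: row_unit_def unit_expo_def)
  have "col_coeff n q t i s (a + (row_unit n t' p - row_unit n t' r)) = col_coeff n q t i s a" if "t \<noteq> t'" for a p r i s t t'
    unfolding col_coeff_def lower_coeff_def *[OF that] by simp
  then show ?thesis
    unfolding col_op_def using assms by (intro shift_op_comm) auto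
qed

text \<open>
  \<open>right_op n q t i j\<close> is right multiplication by \<open>Z\<^sub>i\<^sub>j\<close> inside the first \<open>t\<close> columns.
\<close>

primrec right_op :: "nat \<Rightarrow> complex \<Rightarrow> nat \<Rightarrow> nat \<Rightarrow> nat \<Rightarrow> linop" where
  "right_op n q 0 = (\<lambda>i j. 0)"
| "right_op n q (Suc t) = (\<lambda>i j. \<Sum>s\<in>{1..Suc n}. col_op n q (Suc t) i s *
     (if s = Suc n then if j = Suc t then 1 else 0 else right_op n q t s j))"

lemma col_op_right_op_comm: "t < t' \<Longrightarrow> right_op n q t s j * col_op n q t' i r = col_op n q t' i r * right_op n q t s j"
proof (induction t arbitrary: s j)
  case (Suc t)
  have "col_op n q (Suc t) s u * X * col_op n q t' i r = col_op n q t' i r * (col_op n q (Suc t) s u * X)"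
    if "X * col_op n q t' i r = col_op n q t' i r * X" for X u
    using that col_op_comm[of "Suc t" t' n q s u i r] Suc.prems by (metis mult.assoc nat_neq_iff)
  then have "col_op n q (Suc t) s u * (if u = Suc n then if j = Suc t then 1 else 0 else right_op n q t u j) * col_op n q t' i r
      = col_op n q t' i r * (col_op n q (Suc t) s u * (if u = Suc n then if j = Suc t then 1 else 0 else right_op n q t u j))" for u
    using Suc.IH[of u j] Suc.prems by simp
  then show ?case
    by (simp only: right_op.simps sum_distrib_left sum_distrib_right)
qed simp

lemma right_op_zero: "t < j \<Longrightarrow> right_op n q t i j = 0"
  by (induction t arbitrary: i j) auto

text \<open>The new row, a unit vector at \<open>Suc t\<close>, represents the factor that column
  \<open>Suc t\<close> absorbs. Because \<open>T\<close> vanishes in the columns beyond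
  \<open>t\<close>, a relation that involves this row is either trivial or has the same multiple of
  the same entry of \<open>T\<close> on both sides.\<close>

lemma frt_extend:
  assumes T: "frt q {1..Suc n} T" and z: "\<And>i j. i \<in> {1..Suc n} \<Longrightarrow> t < j \<Longrightarrow> T i j = 0"
  shows "frt q {1..Suc n} (\<lambda>s j. if s = Suc n then if j = Suc t then 1 else 0 else T s j)" (is "frt _ _ ?S")
  unfolding frt_def
proof (intro ballI)
  fix i k j m assume I: "i \<in> {1..Suc n}" "k \<in> {1..Suc n}" "j \<in> {1..Suc n}" "m \<in> {1..Suc n}"
  have z': "T i (Suc t) = 0" "T k (Suc t) = 0" "j > Suc t \<Longrightarrow> T i j = 0" "j > Suc t \<Longrightarrow> T k j = 0"
     "m > Suc t \<Longrightarrow> T i m = 0" "m > Suc t \<Longrightarrow> T k m = 0"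
    using z I by auto
  show "scalar_op (if i = k then q else 1) * (?S i j * ?S k m) + scalar_op (if k < i then q - inverse q else 0) * (?S k j * ?S i m) =
     scalar_op (if j = m then q else 1) * (?S k m * ?S i j) + scalar_op (if j < m then q - inverse q else 0) * (?S k j * ?S i m)"
  proof (cases "i = Suc n \<or> k = Suc n")
    case True
    then show ?thesis using I z' by (auto simp: shift_op_0 scalar_op_1)
  next
    case False
    then show ?thesis using frtD[OF T I] by simp
  qed
qed

lemma right_op_frt:
  assumes "q \<noteq> 0"
  shows "frt q {1..Suc n} (right_op n q t)"
proof (induction t)
  case 0
  show ?case by (simp add: frt_def)
next
  case (Suc t)
  show ?case
    unfolding right_op.simps
  proof (rule frt_prod[OF col_op_frt[OF assms] frt_extend[OF Suc.IH]])
    show "right_op n q t i j = 0" if "t < j" for i j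
      using that by (rule right_op_zero)
  qed (use col_op_right_op_comm in auto)
qed

lemma col_op_lower: "s < i \<Longrightarrow> col_op n q t i s = 0"
  by (simp add: col_op_def col_coeff_def[abs_def] shift_op_0)

text \<open>In its own column the factor can only be absorbed, because the earlier columns have no
  entry for it.\<close>

lemma right_op_first:
  assumes "i \<le> n" "1 \<le> j"
  shows "right_op n q j i j = shift_op (unit_expo (i, j)) (\<lambda>a. q powi (\<Sum>k\<in>{i<..n}. a (k, j)))"
proof -
  obtain t where j: "j = Suc t" using assms by (cases j) auto
  have "right_op n q j i j = (\<Sum>s\<in>{1..Suc n}. if s = Suc n then col_op n q j i s else 0)"
    unfolding j right_op.simps by (intro sum.cong refl) (simp add: right_op_zero)
  also have "\<dots> = col_op n q j i (Suc n)" by simp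
  also have "{i<..<Suc n} = {i<..n}" by auto
  then have "col_op n q j i (Suc n) = shift_op (unit_expo (i, j)) (\<lambda>a. q powi (\<Sum>k\<in>{i<..n}. a (k, j)))"
    using assms by (simp add: col_op_def col_coeff_def[abs_def] lower_coeff_def row_unit_def)
  finally show ?thesis .
qed

lemma right_op_step:
  assumes "1 \<le> i" "i \<le> n" "j \<le> t"
  shows "right_op n q (Suc t) i j = col_op n q (Suc t) i i * right_op n q t i j
     + (\<Sum>s\<in>{i<..n}. col_op n q (Suc t) i s * right_op n q t s j)"
proof -
  have e: "{1..Suc n} = {1..<i} \<union> insert i ({i<..n} \<union> {Suc n})"
    using assms by auto
  have "right_op n q (Suc t) i j = (\<Sum>s\<in>{1..Suc n}. col_op n q (Suc t) i s *
     (if s = Suc n then if j = Suc t then 1 else 0 else right_op n q t s j))"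
    by simp
  also have "\<dots> = (\<Sum>s\<in>insert i {i<..n}. col_op n q (Suc t) i s *
     (if s = Suc n then if j = Suc t then 1 else 0 else right_op n q t s j))"
    using assms by (intro sum.mono_neutral_right) (auto simp: col_op_lower)
  also have "\<dots> = (\<Sum>s\<in>insert i {i<..n}. col_op n q (Suc t) i s * right_op n q t s j)"
    using assms by (intro sum.cong) auto
  finally show ?thesis by simp
qed

lemma col_op_delta:
  assumes "i \<le> n" "s \<le> n" "e (i, t) = 0" "e (s, t) = 0"
  shows "app (col_op n q t i s) (delta e) = (if i = s then delta e else 0)"
  using assms by (auto simp: col_op_def app_shift_op_delta col_coeff_def lower_coeff_def fun_eq_iff)

text \<open>If no factor of the monomial comes after Z_ij in the column order, nothing has to be
  moved and no power of \<open>q\<close> arises.\<close>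

lemma right_op_delta:
  assumes ij: "1 \<le> i" "i \<le> n" "1 \<le> j" "j \<le> t"
    and south: "\<And>k. i < k \<Longrightarrow> k \<le> n \<Longrightarrow> e (k, j) = 0"
    and east: "\<And>k s. j < s \<Longrightarrow> k \<le> n \<Longrightarrow> e (k, s) = 0"
  shows "app (right_op n q t i j) (delta e) = delta (e + unit_expo (i, j))"
  using \<open>j \<le> t\<close>
proof (induction rule: dec_induct)
  case base
  have "(\<Sum>k\<in>{i<..n}. e (k, j)) = 0" using south by auto
  then show ?case using ij by (simp add: right_op_first app_shift_op_delta plus_fun_def)
next
  case (step t)
  \<comment> \<open>Commuting the column matrix to the right lets it act first, on an exponent whose
    column \<open>Suc t\<close> is empty; there turning has coefficient 0 and passing has
    coefficient 1.\<close>
  have "app (col_op n q (Suc t) i s * right_op n q t s j) (delta e) = 0" if "s \<in> {i<..n}" for s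
    using that ij step east by (simp add: col_op_right_op_comm[symmetric] col_op_delta)
  moreover have "app (col_op n q (Suc t) i i * right_op n q t i j) (delta e) = app (right_op n q t i j) (delta e)"
    using ij step east by (simp add: col_op_right_op_comm[symmetric] col_op_delta del: app_simps(6)) (simp add: col_op_delta)
  ultimately show ?case
    using step ij by (simp del: right_op.simps app_simps(6) add: right_op_step app_sum)
qed

subsection \<open>The monomial basis\<close>

abbreviation word :: "(nat \<times> nat) list \<Rightarrow> ncpoly" where
  "word ls \<equiv> Poly_Mapping.single (Word ls) 1"

lemma word_append: "word (u @ v) = word u * word v"
  by (simp add: mult_single plus_free_word_def)

lemma word_Nil: "word [] = 1"
  by (simp add: zero_free_word_def[symmetric])

lemma scalar_mult: "scalar c * scalar d = scalar (c * d)"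
  and scalar_add: "scalar c + scalar d = scalar (c + d)"
  and scalar_1: "scalar 1 = 1"
  and scalar_0: "scalar 0 = 0"
  and scalar_word: "scalar c * Poly_Mapping.single w d = Poly_Mapping.single w (c * d)"
  and word_scalar: "Poly_Mapping.single w d * scalar c = Poly_Mapping.single w (c * d)"
  by (simp_all add: scalar_def mult_single single_add mult.commute)

lemma poly_sum_monomials: "x = (\<Sum>w\<in>Poly_Mapping.keys x. Poly_Mapping.single w (Poly_Mapping.lookup x w))"
  by (rule poly_mapping_eqI) (auto simp: lookup_sum lookup_single when_def in_keys_iff)

lemma scalar_comm: "x * scalar c = scalar c * x"
proof -
  have "(\<Sum>w\<in>Poly_Mapping.keys x. Poly_Mapping.single w (Poly_Mapping.lookup x w)) * scalar c
     = scalar c * (\<Sum>w\<in>Poly_Mapping.keys x. Poly_Mapping.single w (Poly_Mapping.lookup x w))"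
    by (simp only: sum_distrib_right sum_distrib_left word_scalar scalar_word)
  then show ?thesis
    by (simp only: poly_sum_monomials[symmetric])
qed

section \<open>Action of the free algebra on exponents\<close>

primrec word_op :: "nat \<Rightarrow> complex \<Rightarrow> (nat \<times> nat) list \<Rightarrow> linop" where
  "word_op n q [] = 1"
| "word_op n q (l # ls) = word_op n q ls * right_op n q n (fst l) (snd l)"

lemma word_op_append: "word_op n q (u @ v) = word_op n q v * word_op n q u"
  by (induction u) (simp_all add: mult.assoc)

definition free_action :: "nat \<Rightarrow> complex \<Rightarrow> ncpoly \<Rightarrow> linop" where
  "free_action n q x = (\<Sum>w\<in>Poly_Mapping.keys x. scalar_op (Poly_Mapping.lookup x w) * word_op n q (letters w))"

lemma free_action_superset:
  assumes "finite S" "Poly_Mapping.keys x \<subseteq> S"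
  shows "free_action n q x = (\<Sum>w\<in>S. scalar_op (Poly_Mapping.lookup x w) * word_op n q (letters w))"
  unfolding free_action_def using assms
  by (intro sum.mono_neutral_left) (auto simp: in_keys_iff shift_op_0)

lemma free_action_single: "free_action n q (Poly_Mapping.single w c) = scalar_op c * word_op n q (letters w)"
  by (subst free_action_superset[of "{w}"]) auto

lemma free_action_0 [simp]: "free_action n q 0 = 0"
  by (simp add: free_action_def)

lemma free_action_add: "free_action n q (x + y) = free_action n q x + free_action n q y"
proof -
  let ?S = "Poly_Mapping.keys x \<union> Poly_Mapping.keys y"
  have "free_action n q (x + y) = (\<Sum>w\<in>?S. scalar_op (Poly_Mapping.lookup (x + y) w) * word_op n q (letters w))"
    by (intro free_action_superset Poly_Mapping.keys_add) auto
  also have "\<dots> = free_action n q x + free_action n q y"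
    by (subst (1 2) free_action_superset[of ?S]) (auto simp: lookup_add scalar_op_add distrib_right sum.distrib)
  finally show ?thesis .
qed

lemma free_action_sum: "free_action n q (sum f S) = (\<Sum>s\<in>S. free_action n q (f s))"
  by (induction S rule: infinite_finite_induct) (auto simp: free_action_add)

lemma scalar_op_pull: "scalar_op b * S * (scalar_op a * T) = scalar_op (a * b) * (S * T)"
proof -
  have "scalar_op b * S * (scalar_op a * T) = scalar_op b * (S * scalar_op a) * T"
    by (simp only: mult.assoc)
  also have "\<dots> = scalar_op b * scalar_op a * S * T"
    unfolding scalar_op_comm[of a S, symmetric] by (simp only: mult.assoc)
  finally show ?thesis
    by (simp only: scalar_op_mult[symmetric] mult.assoc mult.commute[of b a])
qed

lemma free_action_mult: "free_action n q (x * y) = free_action n q y * free_action n q x"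
proof -
  let ?m = "\<lambda>x w. Poly_Mapping.single w (Poly_Mapping.lookup x w) :: ncpoly"
  have "x * y = (\<Sum>w\<in>Poly_Mapping.keys x. \<Sum>v\<in>Poly_Mapping.keys y. ?m x w * ?m y v)"
    by (simp only: sum_product[symmetric] poly_sum_monomials[symmetric])
  then have "free_action n q (x * y) = (\<Sum>w\<in>Poly_Mapping.keys x. \<Sum>v\<in>Poly_Mapping.keys y. free_action n q (?m x w * ?m y v))"
    by (simp only: free_action_sum)
  also have "\<dots> = (\<Sum>w\<in>Poly_Mapping.keys x. \<Sum>v\<in>Poly_Mapping.keys y. free_action n q (?m y v) * free_action n q (?m x w))"
    by (intro sum.cong refl) (simp only: mult_single free_action_single letters_plus word_op_append scalar_op_pull)
  also have "\<dots> = free_action n q y * free_action n q x"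
    by (subst sum.swap, simp only: free_action_single) (simp only: free_action_def sum_product)
  finally show ?thesis .
qed

lemma free_action_scalar: "free_action n q (scalar c) = scalar_op c"
  by (simp add: scalar_def free_action_single)

lemma free_action_letter: "free_action n q (letter i j) = right_op n q n i j"
  by (simp add: letter_def free_action_single scalar_op_1)

lemma free_action_uminus: "free_action n q (- x) = - free_action n q x"
  using free_action_add[of n q x "- x"] by (simp add: eq_neg_iff_add_eq_0 add.commute)

lemma free_action_minus: "free_action n q (x - y) = free_action n q x - free_action n q y"
  using free_action_add[of n q x "- y"] by (simp add: free_action_uminus)

lemma free_action_relators:
  assumes "q \<noteq> 0" "r \<in> relators n q"
  shows "free_action n q r = 0"
proof -
  note F = frt_relations[OF right_op_frt[OF \<open>q \<noteq> 0\<close>, of n n] \<open>q \<noteq> 0\<close>]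
  have "S * (T * scalar_op c) = scalar_op c * (S * T)" for S T c
    by (metis mult.assoc scalar_op_comm)
  note R = free_action_minus free_action_mult free_action_scalar free_action_letter this
  consider (row) i j k where "r = letter i j * letter i k - scalar (inverse q) * letter i k * letter i j"
      "i \<in> {1..n}" "j \<in> {1..n}" "k \<in> {1..n}" "j < k"
    | (col) i j k where "r = letter i j * letter k j - scalar (inverse q) * letter k j * letter i j"
      "i \<in> {1..n}" "j \<in> {1..n}" "k \<in> {1..n}" "i < k"
    | (anti) i j s t where "r = letter i j * letter s t - letter s t * letter i j"
      "i \<in> {1..n}" "j \<in> {1..n}" "s \<in> {1..n}" "t \<in> {1..n}" "i < s" "t < j"
    | (diag) i j s t where "r = letter i j * letter s t
        - (letter s t * letter i j - scalar (q - inverse q) * letter i t * letter s j)"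
      "i \<in> {1..n}" "j \<in> {1..n}" "s \<in> {1..n}" "t \<in> {1..n}" "i < s" "j < t"
    using assms(2) unfolding relators_def by blast
  then show ?thesis
  proof cases
    case row
    show ?thesis unfolding row(1) R using row F(1)[of i j k] by simp
  next
    case col
    show ?thesis unfolding col(1) R using col F(2)[of i j k] by simp
  next
    case anti
    show ?thesis unfolding anti(1) R using anti F(3)[of i j s t] by simp
  next
    case diag
    show ?thesis unfolding diag(1) R using diag F(4)[of i j s t] by simp
  qed
qed

section \<open>The quotient algebra and its expansion in exponents\<close>

locale quantum_matrices =
  fixes n :: nat and q :: complex
  assumes q0: "q \<noteq> 0"
begin

abbreviation "Fr \<equiv> free_alg n"
abbreviation "A \<equiv> Aq n q"

definition proj :: "ncpoly \<Rightarrow> ncpoly set" where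
  "proj x = rel_ideal n q +>\<^bsub>Fr\<^esub> x"

sublocale F: ring Fr
  by (rule free_alg_ring)

sublocale I: ideal "rel_ideal n q" Fr
  unfolding rel_ideal_def by (rule F.genideal_ideal[OF relators_subset])

sublocale A: ring A
  by (rule Aq_ring)

lemma free_uminus: "y \<in> carrier Fr \<Longrightarrow> \<ominus>\<^bsub>Fr\<^esub> y = - y"
proof -
  assume y: "y \<in> carrier Fr"
  have "0 \<in> carrier Fr" using F.zero_closed by simp
  then have "0 - y \<in> carrier Fr" using y by (intro free_alg_closed)
  then show ?thesis using y by (intro F.minus_equality) auto
qed

lemma free_minus: "y \<in> carrier Fr \<Longrightarrow> x \<ominus>\<^bsub>Fr\<^esub> y = x - y"
  by (simp add: a_minus_def free_uminus)

lemma proj_eq: "x \<in> carrier Fr \<Longrightarrow> y \<in> carrier Fr \<Longrightarrow> proj x = proj y \<longleftrightarrow> x - y \<in> rel_ideal n q"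
  unfolding proj_def
  by (metis I.a_repr_independence' I.a_repr_independenceD I.a_rcos_module_minus free_minus F.ring_axioms)

lemma proj_hom: "proj \<in> ring_hom Fr A"
  using I.rcos_ring_hom unfolding proj_def[abs_def] Aq_def by simp

lemma proj_closed: "x \<in> carrier Fr \<Longrightarrow> proj x \<in> carrier A"
  by (rule ring_hom_closed[OF proj_hom])

lemma proj_simps:
  assumes "x \<in> carrier Fr" "y \<in> carrier Fr"
  shows "proj x \<oplus>\<^bsub>A\<^esub> proj y = proj (x + y)" "proj x \<otimes>\<^bsub>A\<^esub> proj y = proj (x * y)"
  using assms ring_hom_add[OF proj_hom] ring_hom_mult[OF proj_hom] by auto

lemma proj_one: "\<one>\<^bsub>A\<^esub> = proj 1"
  using ring_hom_one[OF proj_hom] by simp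

lemma proj_zero: "\<zero>\<^bsub>A\<^esub> = proj 0"
  using ring_hom_zero[OF proj_hom F.ring_axioms A.ring_axioms] by simp

lemma A_cases:
  assumes "u \<in> carrier A"
  obtains x where "x \<in> carrier Fr" "u = proj x"
  using assms unfolding Aq_def FactRing_simps proj_def by auto

lemma smul_proj: "x \<in> carrier Fr \<Longrightarrow> smul n q c (proj x) = proj (scalar c * x)"
  by (simp add: smul_def proj_def[symmetric] proj_simps scalar_in_free_alg)

lemma gen_proj: "gen n q i j = proj (letter i j)"
  by (simp add: gen_def proj_def)

lemma smul_closed [simp]: "u \<in> carrier A \<Longrightarrow> smul n q c u \<in> carrier A"
  by (erule A_cases) (simp add: smul_proj proj_closed free_alg_closed scalar_in_free_alg)

lemma gen_closed: "i \<in> {1..n} \<Longrightarrow> j \<in> {1..n} \<Longrightarrow> gen n q i j \<in> carrier A"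
  unfolding gen_proj by (intro proj_closed letter_in_free_alg)

text \<open>The elements acting by zero form a two-sided ideal that contains the relators.\<close>

lemma rel_ideal_kernel: "x \<in> rel_ideal n q \<Longrightarrow> free_action n q x = 0"
proof -
  let ?J = "{x \<in> carrier Fr. free_action n q x = 0}"
  have "subgroup ?J (add_monoid Fr)"
  proof (rule F.add.subgroupI)
    have "0 \<in> carrier Fr" using F.zero_closed by simp
    then show "?J \<noteq> {}" by (auto intro!: exI[of _ 0])
    show "\<ominus>\<^bsub>Fr\<^esub> a \<in> ?J" if "a \<in> ?J" for a
      using that F.a_inv_closed[of a] by (simp add: free_uminus free_action_uminus)
  qed (auto simp: free_alg_closed free_action_add)
  then have "ideal ?J Fr"
    by (rule idealI[OF F.ring_axioms]) (auto simp: free_alg_closed free_action_mult)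
  then have "rel_ideal n q \<subseteq> ?J"
    unfolding rel_ideal_def using relators_subset free_action_relators[OF q0]
    by (intro F.genideal_minimal) auto
  then show "x \<in> rel_ideal n q \<Longrightarrow> free_action n q x = 0" by auto
qed

text \<open>The image of 1 under the action of \<open>u\<close>. The choice of a representative is
  harmless because the ideal acts by zero. Ordered monomials are sent to basis vectors, so this
  yields coordinates before a basis is available.\<close>

definition expand :: "ncpoly set \<Rightarrow> expo \<Rightarrow> complex" where
  "expand u = app (free_action n q (SOME x. x \<in> carrier Fr \<and> u = proj x)) (delta 0)"

lemma expand_proj: "x \<in> carrier Fr \<Longrightarrow> expand (proj x) = app (free_action n q x) (delta 0)"
proof -
  assume x: "x \<in> carrier Fr"
  define y where "y = (SOME y. y \<in> carrier Fr \<and> proj x = proj y)"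
  have y: "y \<in> carrier Fr \<and> proj x = proj y"
    unfolding y_def by (rule someI[of _ x]) (simp add: x)
  then have "free_action n q (x - y) = 0"
    using x by (intro rel_ideal_kernel) (simp add: proj_eq[symmetric])
  then show ?thesis
    unfolding expand_def y_def[symmetric] by (simp add: free_action_minus)
qed

lemma expand_add: "u \<in> carrier A \<Longrightarrow> v \<in> carrier A \<Longrightarrow> expand (u \<oplus>\<^bsub>A\<^esub> v) = expand u + expand v"
  by (elim A_cases) (simp add: proj_simps expand_proj free_alg_closed free_action_add)

lemma expand_smul: "u \<in> carrier A \<Longrightarrow> expand (smul n q c u) = (\<lambda>a. c * expand u a)"
  by (elim A_cases)
     (simp add: smul_proj expand_proj free_alg_closed scalar_in_free_alg free_action_mult free_action_scalar scalar_op_comm[symmetric] app_scalar_op)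

lemma expand_gen:
  "u \<in> carrier A \<Longrightarrow> i \<in> {1..n} \<Longrightarrow> j \<in> {1..n} \<Longrightarrow> expand (u \<otimes>\<^bsub>A\<^esub> gen n q i j) = app (right_op n q n i j) (expand u)"
  by (elim A_cases)
     (simp add: gen_proj proj_simps expand_proj letter_in_free_alg free_alg_closed free_action_mult free_action_letter)

end

section \<open>Column order of the cells and sorted words\<close>

definition cells :: "nat \<Rightarrow> (nat \<times> nat) list" where
  "cells n = [(i, j). j \<leftarrow> [1..<Suc n], i \<leftarrow> [1..<Suc n]]"

text \<open>The column-major rank; the base \<open>Suc n\<close> prevents rows up to
  \<open>n\<close> from carrying over into the next column.\<close>

definition cell_key :: "nat \<Rightarrow> nat \<times> nat \<Rightarrow> nat" where
  "cell_key n p = snd p * Suc n + fst p"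

lemma cell_key_less_col: "snd p < snd p' \<Longrightarrow> fst p \<le> n \<Longrightarrow> cell_key n p < cell_key n p'"
proof -
  assume "snd p < snd p'" "fst p \<le> n"
  then have "Suc (snd p) * Suc n \<le> snd p' * Suc n" by (intro mult_le_mono1) simp
  then show ?thesis using \<open>fst p \<le> n\<close> by (simp add: cell_key_def)
qed

lemma cell_key_less_iff:
  assumes "fst p \<le> n" "fst p' \<le> n"
  shows "cell_key n p < cell_key n p' \<longleftrightarrow> snd p < snd p' \<or> snd p = snd p' \<and> fst p < fst p'"
proof (cases "snd p" "snd p'" rule: linorder_cases)
  case less
  then show ?thesis using cell_key_less_col[of p p' n] assms by simp
next
  case equal
  then show ?thesis by (simp add: cell_key_def)
next
  case greater
  then show ?thesis using cell_key_less_col[of p' p n] assms by simp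
qed

lemma cell_key_inj: "inj_on (cell_key n) {p. fst p \<le> n}"
proof (rule inj_onI)
  fix p p' assume p: "p \<in> {p. fst p \<le> n}" "p' \<in> {p. fst p \<le> n}" and "cell_key n p = cell_key n p'"
  then have "\<not> cell_key n p < cell_key n p'" "\<not> cell_key n p' < cell_key n p" by simp_all
  then have "snd p = snd p'" "fst p = fst p'" using p cell_key_less_iff[of p n p'] cell_key_less_iff[of p' n p] by auto
  then show "p = p'" by (simp add: prod_eq_iff)
qed

lemma set_cells: "set (cells n) = {1..n} \<times> {1..n}"
  by (auto simp: cells_def image_iff simp del: upt_Suc)

lemma sorted_cells: "sorted_wrt (<) (map (cell_key n) (cells n))"
proof -
  have "sorted_wrt (<) (map (cell_key n) [(i, j). j \<leftarrow> [1..<Suc m], i \<leftarrow> [1..<Suc n]])" for m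
  proof (induction m)
    case (Suc m)
    have e: "[(i, j). j \<leftarrow> [1..<Suc (Suc m)], i \<leftarrow> [1..<Suc n]] =
      [(i, j). j \<leftarrow> [1..<Suc m], i \<leftarrow> [1..<Suc n]] @ map (\<lambda>i. (i, Suc m)) [1..<Suc n]"
      by simp
    have "sorted_wrt (<) (map (cell_key n) (map (\<lambda>i. (i, Suc m)) [1..<Suc n]))"
      unfolding map_map sorted_wrt_map
      by (rule sorted_wrt_mono_rel[OF _ sorted_wrt_upt]) (simp add: cell_key_def)
    moreover have "cell_key n x < cell_key n y"
      if "x \<in> set [(i, j). j \<leftarrow> [1..<Suc m], i \<leftarrow> [1..<Suc n]]" "y \<in> set (map (\<lambda>i. (i, Suc m)) [1..<Suc n])" for x y
      using that by (auto intro!: cell_key_less_col simp del: upt_Suc)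
    ultimately show ?case
      using Suc.IH unfolding e map_append sorted_wrt_append by (simp only: set_map) blast
  qed simp
  then show ?thesis by (simp add: cells_def)
qed

lemma distinct_cells: "distinct (cells n)"
  using strict_sorted_iff[of "map (cell_key n) (cells n)"] sorted_cells[of n] distinct_map by blast

definition spell :: "nat \<Rightarrow> mindex \<Rightarrow> (nat \<times> nat) list" where
  "spell n a = concat (map (\<lambda>p. replicate (Poly_Mapping.lookup a p) p) (cells n))"

definition content :: "(nat \<times> nat) list \<Rightarrow> mindex" where
  "content ls = (\<Sum>p\<leftarrow>ls. Poly_Mapping.single p 1)"

lemma lookup_content: "Poly_Mapping.lookup (content ls) p = count_list ls p"
  unfolding content_def by (induction ls) (simp_all add: lookup_add lookup_single when_def)

lemma content_snoc: "content (ls @ [p]) = content ls + Poly_Mapping.single p 1"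
  by (simp add: content_def)

lemma set_spell: "set (spell n a) \<subseteq> {1..n} \<times> {1..n}"
  unfolding spell_def set_cells[symmetric] by auto

lemma sorted_spell: "sorted (map (cell_key n) (spell n a))"
proof -
  have "sorted_wrt (<) (map (cell_key n) L) \<Longrightarrow>
      sorted (map (cell_key n) (concat (map (\<lambda>p. replicate (Poly_Mapping.lookup a p) p) L)))" for L
    by (induction L) (auto simp: sorted_append map_replicate intro: less_imp_le)
  then show ?thesis using sorted_cells by (simp add: spell_def)
qed

lemma count_list_spell:
  "count_list (spell n a) p = (if p \<in> {1..n} \<times> {1..n} then Poly_Mapping.lookup a p else 0)"
proof -
  have r: "count_list (replicate k x) p = (if x = p then k else 0)" for k and x :: "nat \<times> nat"
    by (induction k) auto
  have "distinct L \<Longrightarrow> count_list (concat (map (\<lambda>p. replicate (Poly_Mapping.lookup a p) p) L)) p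
     = (if p \<in> set L then Poly_Mapping.lookup a p else 0)" for L
    by (induction L) (auto simp: r)
  then show ?thesis
    using distinct_cells[of n] set_cells[of n] by (simp add: spell_def)
qed

lemma mindices_iff:
  "a \<in> mindices n \<longleftrightarrow> (\<forall>p. p \<notin> {1..n} \<times> {1..n} \<longrightarrow> Poly_Mapping.lookup a p = 0)"
proof -
  have "a \<in> mindices n \<longleftrightarrow> Poly_Mapping.keys a \<subseteq> {1..n} \<times> {1..n}"
    by (simp only: mindices_def mem_Collect_eq)
  also have "\<dots> \<longleftrightarrow> (\<forall>p. p \<in> Poly_Mapping.keys a \<longrightarrow> p \<in> {1..n} \<times> {1..n})"
    by (rule subset_iff)
  also have "\<dots> \<longleftrightarrow> (\<forall>p. p \<notin> {1..n} \<times> {1..n} \<longrightarrow> p \<notin> Poly_Mapping.keys a)"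
    by (intro iff_allI) argo
  finally show ?thesis
    by (simp only: in_keys_iff not_not)
qed

lemma content_spell: "a \<in> mindices n \<Longrightarrow> content (spell n a) = a"
  unfolding mindices_iff by (rule poly_mapping_eqI) (metis lookup_content count_list_spell)

lemma content_in_mindices: "set ls \<subseteq> {1..n} \<times> {1..n} \<Longrightarrow> content ls \<in> mindices n"
  unfolding mindices_iff lookup_content count_list_0_iff by blast

text \<open>Both words have the same letters with multiplicity, and both are sorted by a key that is
  injective on the cells.\<close>

lemma spell_content:
  assumes "set ls \<subseteq> {1..n} \<times> {1..n}" "sorted (map (cell_key n) ls)"
  shows "spell n (content ls) = ls"
proof -
  have "count_list (spell n (content ls)) p = count_list ls p" for p
    using assms(1) by (auto simp: count_list_spell lookup_content count_list_0_iff)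
  then have "mset (spell n (content ls)) = mset ls"
    by (intro multiset_eqI) (simp add: count_mset count_list_eq_length_filter eq_commute)
  then have "mset (map (cell_key n) (spell n (content ls))) = mset (map (cell_key n) ls)"
    by simp
  then have "map (cell_key n) (spell n (content ls)) = map (cell_key n) ls"
    using sorted_spell assms(2) by (metis properties_for_sort)
  moreover have "inj_on (cell_key n) (set (spell n (content ls)) \<union> set ls)"
    using set_spell[of n "content ls"] assms(1) by (intro inj_on_subset[OF cell_key_inj]) auto
  ultimately show ?thesis
    by (rule map_inj_on)
qed

lemma unsorted_split:
  "\<not> sorted (map f ls) \<Longrightarrow> \<exists>u x y v. ls = u @ x # y # v \<and> f y < (f x :: nat)"
proof (induction ls)
  case (Cons a ls)
  show ?case
  proof (cases "sorted (map f ls)")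
    case False
    then show ?thesis using Cons.IH by (metis append_Cons)
  next
    case True
    then obtain b v where "ls = b # v" "f b < f a"
      using Cons.prems by (cases ls) (auto simp: not_le)
    then show ?thesis by (metis append_Nil)
  qed
qed simp

lemma sum_fun_apply: "(\<Sum>a\<in>S. f a) e = (\<Sum>a\<in>S. f a e)" for f :: "'a \<Rightarrow> expo \<Rightarrow> complex"
  by (induction S rule: infinite_finite_induct) auto

definition embed :: "mindex \<Rightarrow> expo" where
  "embed a = (\<lambda>p. int (Poly_Mapping.lookup a p))"

lemma embed_0 [simp]: "embed 0 = 0"
  by (simp add: embed_def fun_eq_iff)

lemma embed_add: "embed (a + Poly_Mapping.single p 1) = embed a + unit_expo p"
  by (auto simp: embed_def fun_eq_iff lookup_add lookup_single unit_expo_def when_def)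

lemma embed_inj: "embed a = embed b \<longleftrightarrow> a = b"
  by (auto simp: embed_def fun_eq_iff intro: poly_mapping_eqI)

text \<open>A sorted word grows by letters that come weakly last, so the cells below the new letter
  and all later columns are still empty and \<open>right_op_delta\<close> applies.\<close>

lemma word_op_sorted:
  assumes "sorted (map (cell_key n) ls)" "set ls \<subseteq> {1..n} \<times> {1..n}"
  shows "app (word_op n q ls) (delta 0) = delta (embed (content ls))"
  using assms
proof (induction ls rule: rev_induct)
  case Nil
  then show ?case by (simp add: content_def)
next
  case (snoc p ls)
  obtain i j where p: "p = (i, j)" by (cases p)
  have ij: "1 \<le> i" "i \<le> n" "1 \<le> j" "j \<le> n" using snoc.prems p by auto
  have z: "embed (content ls) x = 0" if "cell_key n p < cell_key n x" for x
    using snoc.prems(1) that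
    by (fastforce simp: embed_def lookup_content count_list_0_iff sorted_append)
  have "app (right_op n q n i j) (delta (embed (content ls))) = delta (embed (content ls) + unit_expo (i, j))"
    using ij by (intro right_op_delta z) (auto simp: p cell_key_less_iff)
  then show ?case
    using snoc by (simp add: word_op_append content_snoc embed_add p sorted_append plus_fun_def zero_fun_def del: One_nat_def)
qed

lemma scalar_left: "x * (scalar c * y) = scalar c * (x * y)"
  by (metis mult.assoc scalar_comm)

lemma free_action_word: "free_action n q (word ls) = word_op n q ls"
  by (simp add: free_action_single scalar_op_1)

context quantum_matrices
begin

lemma word_in_free: "set ls \<subseteq> {1..n} \<times> {1..n} \<Longrightarrow> word ls \<in> carrier Fr"
  by (simp add: free_alg_carrier)

lemma mon_proj: "mon n q a = proj (word (spell n a))"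
proof -
  have pw: "gen n q i j [^]\<^bsub>A\<^esub> k = proj (word (replicate k (i, j)))" if "i \<in> {1..n}" "j \<in> {1..n}" for i j and k :: nat
  proof (induction k)
    case 0
    then show ?case by (simp add: proj_one word_Nil)
  next
    case (Suc k)
    have "word (replicate (Suc k) (i, j)) = word (replicate k (i, j)) * letter i j"
      by (simp add: word_append[symmetric] letter_def replicate_append_same flip: replicate_Suc)
    moreover have "set (replicate k (i, j)) \<subseteq> {1..n} \<times> {1..n}" using that by auto
    ultimately show ?case
      using Suc that by (simp only: A.nat_pow_Suc gen_proj proj_simps letter_in_free_alg word_in_free)
  qed
  have "set L \<subseteq> {1..n} \<times> {1..n} \<Longrightarrow>
     foldr (\<lambda>(i, j) u. (gen n q i j [^]\<^bsub>A\<^esub> Poly_Mapping.lookup a (i, j)) \<otimes>\<^bsub>A\<^esub> u) L \<one>\<^bsub>A\<^esub>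
     = proj (word (concat (map (\<lambda>p. replicate (Poly_Mapping.lookup a p) p) L)))" for L
  proof (induction L)
    case Nil
    then show ?case by (simp add: proj_one word_Nil)
  next
    case (Cons p L)
    obtain i j where p: "p = (i, j)" by (cases p)
    have "set (concat (map (\<lambda>p. replicate (Poly_Mapping.lookup a p) p) L)) \<subseteq> {1..n} \<times> {1..n}"
      using Cons.prems by auto
    moreover have "set (replicate (Poly_Mapping.lookup a (i, j)) (i, j)) \<subseteq> {1..n} \<times> {1..n}"
      using Cons.prems p by auto
    ultimately show ?case
      using Cons by (simp add: p pw proj_simps word_in_free word_append)
  qed
  from this[of "cells n"] show ?thesis
    unfolding mon_def cells_def[symmetric] spell_def by (simp add: set_cells)
qed

lemma mon_closed [simp]: "mon n q a \<in> carrier A"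
  unfolding mon_proj by (intro proj_closed word_in_free set_spell)

lemma expand_mon: "a \<in> mindices n \<Longrightarrow> expand (mon n q a) = delta (embed a)"
  unfolding mon_proj expand_proj[OF word_in_free[OF set_spell]] free_action_word word_op_sorted[OF sorted_spell set_spell]
  by (simp only: content_spell)

section \<open>Spanning and independence of the ordered monomials\<close>

definition lin_comb :: "(mindex \<Rightarrow>\<^sub>0 complex) \<Rightarrow> ncpoly" where
  "lin_comb f = (\<Sum>a\<in>Poly_Mapping.keys f. scalar (Poly_Mapping.lookup f a) * word (spell n a))"

lemma sum_free: "(\<And>a. a \<in> S \<Longrightarrow> g a \<in> carrier Fr) \<Longrightarrow> sum g S \<in> carrier Fr"
proof (induction S rule: infinite_finite_induct)
  case (insert x S)
  then show ?case by (simp add: free_alg_closed)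
qed (use F.zero_closed in simp_all)

lemma finsum_proj:
  assumes "finite S" "\<And>a. a \<in> S \<Longrightarrow> g a \<in> carrier Fr"
  shows "(\<Oplus>\<^bsub>A\<^esub>a\<in>S. proj (g a)) = proj (sum g S)"
  using assms
proof (induction S rule: finite_induct)
  case (insert x S)
  then show ?case
    by (subst A.finsum_insert) (auto simp: proj_closed proj_simps sum_free)
qed (simp add: proj_zero)

lemma term_free: "scalar c * word (spell n a) \<in> carrier Fr"
  by (intro free_alg_closed scalar_in_free_alg word_in_free set_spell)

lemma lin_comb_free: "lin_comb f \<in> carrier Fr"
  unfolding lin_comb_def by (intro sum_free term_free)

lemma finsum_mon:
  "(\<Oplus>\<^bsub>A\<^esub>a\<in>Poly_Mapping.keys f. smul n q (Poly_Mapping.lookup f a) (mon n q a)) = proj (lin_comb f)"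
  unfolding lin_comb_def
  by (subst finsum_proj[symmetric]) (simp_all only: term_free mon_proj smul_proj[OF word_in_free[OF set_spell]] finite_keys)

lemma lin_comb_superset:
  assumes "finite S" "Poly_Mapping.keys f \<subseteq> S"
  shows "lin_comb f = (\<Sum>a\<in>S. scalar (Poly_Mapping.lookup f a) * word (spell n a))"
  unfolding lin_comb_def using assms
  by (intro sum.mono_neutral_left) (auto simp: in_keys_iff scalar_0)

lemma lin_comb_add: "lin_comb (f + g) = lin_comb f + lin_comb g"
proof -
  let ?S = "Poly_Mapping.keys f \<union> Poly_Mapping.keys g"
  have "lin_comb (f + g) = (\<Sum>a\<in>?S. scalar (Poly_Mapping.lookup (f + g) a) * word (spell n a))"
    by (intro lin_comb_superset Poly_Mapping.keys_add) auto
  also have "\<dots> = lin_comb f + lin_comb g"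
    by (subst (1 2) lin_comb_superset[of ?S]) (auto simp: lookup_add scalar_add[symmetric] distrib_right sum.distrib)
  finally show ?thesis .
qed

lemma lookup_scale: "Poly_Mapping.lookup (Poly_Mapping.map ((*) c) f) a = c * Poly_Mapping.lookup f a" for c :: complex
  by (simp add: Poly_Mapping.map.rep_eq when_def)

lemma keys_scale: "Poly_Mapping.keys (Poly_Mapping.map ((*) c) f) \<subseteq> Poly_Mapping.keys f" for c :: complex
  by (rule subsetI) (simp add: in_keys_iff lookup_scale)

lemma lin_comb_scale: "lin_comb (Poly_Mapping.map ((*) c) f) = scalar c * lin_comb f"
proof -
  have "lin_comb (Poly_Mapping.map ((*) c) f) =
      (\<Sum>a\<in>Poly_Mapping.keys f. scalar (c * Poly_Mapping.lookup f a) * word (spell n a))"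
    by (subst lin_comb_superset[OF _ keys_scale]) (simp_all add: lookup_scale)
  then show ?thesis
    by (simp add: lin_comb_def sum_distrib_left scalar_mult[symmetric] mult.assoc)
qed

definition spanned :: "ncpoly \<Rightarrow> bool" where
  "spanned x \<longleftrightarrow> (\<exists>f. Poly_Mapping.keys f \<subseteq> mindices n \<and> proj x = proj (lin_comb f))"

lemma spanned_add:
  assumes "x \<in> carrier Fr" "y \<in> carrier Fr" "spanned x" "spanned y"
  shows "spanned (x + y)"
proof -
  obtain f g where fg: "Poly_Mapping.keys f \<subseteq> mindices n" "proj x = proj (lin_comb f)"
    "Poly_Mapping.keys g \<subseteq> mindices n" "proj y = proj (lin_comb g)"
    using assms unfolding spanned_def by blast
  have "proj (x + y) = proj (lin_comb (f + g))"
    using assms fg by (simp add: proj_simps[symmetric] lin_comb_add lin_comb_free)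
  moreover have "Poly_Mapping.keys (f + g) \<subseteq> mindices n"
    using Poly_Mapping.keys_add[of f g] fg by blast
  ultimately show ?thesis unfolding spanned_def by blast
qed

lemma spanned_scale:
  assumes "x \<in> carrier Fr" "spanned x"
  shows "spanned (scalar c * x)"
proof -
  obtain f where f: "Poly_Mapping.keys f \<subseteq> mindices n" "proj x = proj (lin_comb f)"
    using assms unfolding spanned_def by blast
  have "proj (scalar c * x) = proj (lin_comb (Poly_Mapping.map ((*) c) f))"
    using assms f by (simp add: smul_proj[symmetric] lin_comb_scale lin_comb_free)
  moreover have "Poly_Mapping.keys (Poly_Mapping.map ((*) c) f) \<subseteq> mindices n"
    using f(1) keys_scale by (rule subset_trans[rotated])
  ultimately show ?thesis unfolding spanned_def by blast
qed

text \<open>Each relator is solved for the product in the wrong order. The extra word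
  \<open>[x', y']\<close> need not be sorted: for termination it is enough that its first key is
  smaller than that of \<open>x\<close>.\<close>

lemma straighten:
  assumes x: "x \<in> {1..n} \<times> {1..n}" and y: "y \<in> {1..n} \<times> {1..n}" and k: "cell_key n y < cell_key n x"
  shows "\<exists>c d x' y'. x' \<in> {1..n} \<times> {1..n} \<and> y' \<in> {1..n} \<times> {1..n} \<and> cell_key n x' < cell_key n x \<and>
    word [x, y] - (scalar c * word [y, x] + scalar d * word [x', y']) \<in> rel_ideal n q"
proof -
  obtain i j s t where xy: "x = (i, j)" "y = (s, t)" by (cases x, cases y)
  have r: "i \<in> {1..n}" "j \<in> {1..n}" "s \<in> {1..n}" "t \<in> {1..n}" using x y xy by auto
  have w: "word [(a, b), (c, d)] = letter a b * letter c d" for a b c d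
    using word_append[of "[(a, b)]" "[(c, d)]"] by (simp add: letter_def)
  have R: "relators n q \<subseteq> rel_ideal n q"
    unfolding rel_ideal_def by (rule F.genideal_self[OF relators_subset])
  \<comment> \<open>The row and column relators contain the wrong order with coefficient -q^-1; the
    factor -q normalises it.\<close>
  have flip: "u - scalar q * v \<in> rel_ideal n q"
    if "v - scalar (inverse q) * u \<in> relators n q" for u v
  proof -
    have "scalar (- q) * (v - scalar (inverse q) * u) \<in> rel_ideal n q"
      using I.I_l_closed[of "v - scalar (inverse q) * u" "scalar (- q)"] that R scalar_in_free_alg by auto
    moreover have "scalar (- q) * (v - scalar (inverse q) * u) = u - scalar q * v"
    proof -
      have "scalar (- q) = - scalar q" by (simp add: scalar_def single_uminus)
      moreover have "scalar q * (scalar (inverse q) * u) = u"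
        using q0 by (simp add: mult.assoc[symmetric] scalar_mult scalar_1)
      ultimately show ?thesis by (simp add: right_diff_distrib)
    qed
    ultimately show ?thesis by simp
  qed
  have "t < j \<or> t = j \<and> s < i"
    using k r by (auto simp: xy cell_key_less_iff)
  then consider (c1) "t = j" "s < i" | (c2) "t < j" "i = s" | (c3) "t < j" "i < s" | (c4) "t < j" "s < i"
    by linarith
  then show ?thesis
  proof cases
    case c1
    have "letter s j * letter i j - scalar (inverse q) * letter i j * letter s j \<in> relators n q"
      unfolding relators_def using r c1 by blast
    \<comment> \<open>No extra word arises here; \<open>[y, y]\<close> with coefficient 0 fills its
      place, and its first key is that of \<open>y\<close>.\<close>
    then have "word [x, y] - (scalar q * word [y, x] + scalar 0 * word [y, y]) \<in> rel_ideal n q"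
      using flip[of "letter s j * letter i j" "letter i j * letter s j"] c1
      by (simp add: xy w scalar_0 mult.assoc)
    then show ?thesis using k y by blast
  next
    case c2
    have "letter i t * letter i j - scalar (inverse q) * letter i j * letter i t \<in> relators n q"
      unfolding relators_def using r c2 by blast
    then have "word [x, y] - (scalar q * word [y, x] + scalar 0 * word [y, y]) \<in> rel_ideal n q"
      using flip[of "letter i t * letter i j" "letter i j * letter i t"] c2
      by (simp add: xy w scalar_0 mult.assoc)
    then show ?thesis using k y by blast
  next
    case c3
    have "letter i j * letter s t - letter s t * letter i j \<in> relators n q"
      unfolding relators_def using r c3 by blast
    then have "word [x, y] - (scalar 1 * word [y, x] + scalar 0 * word [y, y]) \<in> rel_ideal n q"
      using R by (auto simp: xy w scalar_0 scalar_1)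
    then show ?thesis using k y by blast
  next
    case c4
    let ?r = "letter s t * letter i j - (letter i j * letter s t - scalar (q - inverse q) * letter s j * letter i t)"
    have "?r \<in> relators n q"
      unfolding relators_def using r c4 by blast
    then have "?r \<in> rel_ideal n q" using R by blast
    then have "scalar (- 1) * ?r \<in> rel_ideal n q"
      using I.I_l_closed[of ?r "scalar (- 1)"] scalar_in_free_alg by auto
    moreover have "scalar (- 1) = - 1" by (simp add: scalar_def single_uminus)
    ultimately have "word [x, y] - (scalar 1 * word [y, x] + scalar (q - inverse q) * word [(s, j), (i, t)]) \<in> rel_ideal n q"
      by (simp add: xy w scalar_1 mult.assoc algebra_simps)
    \<comment> \<open>The extra word starts in the column of \<open>x\<close>, but in the earlier
      row \<open>s < i\<close>.\<close>
    moreover have "cell_key n (s, j) < cell_key n x" using c4 by (simp add: xy cell_key_def)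
    ultimately show ?thesis using r by blast
  qed
qed

text \<open>Each straightening step decreases the list of keys in the lexicographic order.\<close>

lemma spanned_word: "set ls \<subseteq> {1..n} \<times> {1..n} \<Longrightarrow> spanned (word ls)"
proof (induction "map (cell_key n) ls" arbitrary: ls rule: wf_induct_rule[OF wf_lenlex[OF wf_less_than]])
  case less: 1
  show ?case
  proof (cases "sorted (map (cell_key n) ls)")
    case True
    have "proj (word ls) = proj (lin_comb (Poly_Mapping.single (content ls) 1))"
      using spell_content[OF less.prems True] by (simp add: lin_comb_def scalar_1)
    then show ?thesis
      using content_in_mindices[OF less.prems] unfolding spanned_def by (intro exI[of _ "Poly_Mapping.single (content ls) 1"]) auto
  next
    case False
    then obtain u x y v where ls: "ls = u @ x # y # v" and k: "cell_key n y < cell_key n x"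
      using unsorted_split by blast
    have uv: "set u \<subseteq> {1..n} \<times> {1..n}" "set v \<subseteq> {1..n} \<times> {1..n}" "x \<in> {1..n} \<times> {1..n}" "y \<in> {1..n} \<times> {1..n}"
      using less.prems ls by auto
    obtain c d x' y' where st: "x' \<in> {1..n} \<times> {1..n}" "y' \<in> {1..n} \<times> {1..n}" "cell_key n x' < cell_key n x"
      "word [x, y] - (scalar c * word [y, x] + scalar d * word [x', y']) \<in> rel_ideal n q" (is "?r \<in> _")
      using straighten[OF uv(3,4) k] by blast
    let ?l1 = "u @ [y, x] @ v" and ?l2 = "u @ [x', y'] @ v"
    have sl: "set ?l1 \<subseteq> {1..n} \<times> {1..n}" "set ?l2 \<subseteq> {1..n} \<times> {1..n}"
      using uv st(1,2) by (simp_all only: set_append list.set Un_subset_iff insert_subset empty_subsetI conj_absorb simp_thms)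
    have "(map (cell_key n) ?l1, map (cell_key n) ls) \<in> lenlex less_than" "(map (cell_key n) ?l2, map (cell_key n) ls) \<in> lenlex less_than"
      using k st(3) by (simp_all add: ls lenlex_conv lex_append_leftI)
    then have s1: "spanned (word ?l1)" "spanned (word ?l2)"
      using less.hyps sl by blast+
    have c: "word ?l1 \<in> carrier Fr" "word ?l2 \<in> carrier Fr" "word ls \<in> carrier Fr"
      using less.prems sl by (simp_all only: word_in_free)
    have "word u * ?r * word v \<in> rel_ideal n q"
      using I.I_l_closed[OF st(4) word_in_free[OF uv(1)]] I.I_r_closed[OF _ word_in_free[OF uv(2)]] by simp
    moreover have "word u * ?r * word v = word ls - (scalar c * word ?l1 + scalar d * word ?l2)"
    proof -
      have "word ls = word u * word [x, y] * word v"
        unfolding ls by (simp only: word_append[symmetric] append.simps append_assoc)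
      moreover have "scalar e * word (u @ w @ v) = word u * (scalar e * word w) * word v" for e w
        by (simp only: word_append mult.assoc scalar_left)
      ultimately show ?thesis by (simp only: left_diff_distrib right_diff_distrib distrib_left distrib_right)
    qed
    ultimately have "word ls - (scalar c * word ?l1 + scalar d * word ?l2) \<in> rel_ideal n q" by (simp only:)
    then have "proj (word ls) = proj (scalar c * word ?l1 + scalar d * word ?l2)"
      using c by (simp add: proj_eq free_alg_closed scalar_in_free_alg)
    moreover have "spanned (scalar c * word ?l1 + scalar d * word ?l2)"
      by (intro spanned_add spanned_scale free_alg_closed scalar_in_free_alg c s1)
    ultimately show ?thesis unfolding spanned_def by simp
  qed
qed

lemma spanned_free: "x \<in> carrier Fr \<Longrightarrow> spanned x"
proof -
  assume x: "x \<in> carrier Fr"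
  let ?m = "\<lambda>w. Poly_Mapping.single w (Poly_Mapping.lookup x w)"
  have "S \<subseteq> Poly_Mapping.keys x \<Longrightarrow> spanned (sum ?m S) \<and> sum ?m S \<in> carrier Fr" if "finite S" for S
    using that
  proof (induction S rule: finite_induct)
    case empty
    have "spanned 0" unfolding spanned_def by (intro exI[of _ 0]) (simp add: lin_comb_def)
    then show ?case using F.zero_closed by simp
  next
    case (insert w S)
    have w: "set (letters w) \<subseteq> {1..n} \<times> {1..n}" using insert.prems x by (simp add: free_alg_carrier)
    have e: "?m w = scalar (Poly_Mapping.lookup x w) * word (letters w)"
      by (simp add: scalar_word)
    have "spanned (?m w)" "?m w \<in> carrier Fr"
      unfolding e by (intro spanned_scale word_in_free spanned_word free_alg_closed scalar_in_free_alg w)+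
    then show ?case using insert by (auto intro!: spanned_add free_alg_closed)
  qed
  from this[of "Poly_Mapping.keys x"] show ?thesis
    using poly_sum_monomials[of x] by simp
qed

lemma expand_lin_comb: 
  assumes "Poly_Mapping.keys f \<subseteq> mindices n" 
  shows "expand (proj (lin_comb f)) = (\<lambda>e. \<Sum>a\<in>Poly_Mapping.keys f. Poly_Mapping.lookup f a * delta (embed a) e)"
proof -
  have "app (free_action n q (word (spell n a))) (delta 0) = delta (embed a)" if "a \<in> mindices n" for a
    using expand_mon[OF that] by (simp only: mon_proj expand_proj[OF word_in_free[OF set_spell]])
  then have "app (free_action n q (lin_comb f)) (delta 0) = (\<Sum>a\<in>Poly_Mapping.keys f. (\<lambda>e. Poly_Mapping.lookup f a * delta (embed a) e))"
    unfolding lin_comb_def free_action_sum app_sum using assms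
    by (intro sum.cong refl) (auto simp: free_action_mult free_action_scalar scalar_op_comm[symmetric] app_scalar_op)
  then show ?thesis
    by (simp add: expand_proj lin_comb_free fun_eq_iff sum_fun_apply)
qed

text \<open>Distinct monomials expand to distinct basis vectors, so coefficients can be read off;
  this is the linear independence that makes \<open>coord\<close> well defined.\<close>

lemma expand_lin_comb_embed:
  assumes "Poly_Mapping.keys f \<subseteq> mindices n" 
  shows "expand (proj (lin_comb f)) (embed b) = Poly_Mapping.lookup f b"
proof -
  have "expand (proj (lin_comb f)) (embed b) = (\<Sum>a\<in>Poly_Mapping.keys f. if b = a then Poly_Mapping.lookup f a else 0)"
    unfolding expand_lin_comb[OF assms] by (intro sum.cong refl) (auto simp: delta_def embed_inj)
  then show ?thesis by (auto simp: in_keys_iff)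
qed

lemma coord:
  assumes "u \<in> carrier A"
  shows coord_keys: "Poly_Mapping.keys (coord n q u) \<subseteq> mindices n"
    and coord_lin_comb: "u = proj (lin_comb (coord n q u))"
proof -
  let ?P = "\<lambda>f. Poly_Mapping.keys f \<subseteq> mindices n \<and> u = proj (lin_comb f)"
  obtain x where x: "x \<in> carrier Fr" "u = proj x" using assms by (rule A_cases)
  then obtain f where "?P f" using spanned_free[of x] unfolding spanned_def by auto
  moreover have "g = f" if "?P g" for g
    using that \<open>?P f\<close> by (intro poly_mapping_eqI) (metis expand_lin_comb_embed)
  ultimately have "?P (THE f. ?P f)" by (rule theI)
  then show "Poly_Mapping.keys (coord n q u) \<subseteq> mindices n" "u = proj (lin_comb (coord n q u))"
    unfolding coord_def finsum_mon by auto
qed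

lemma expand_embed: "u \<in> carrier A \<Longrightarrow> expand u (embed b) = Poly_Mapping.lookup (coord n q u) b"
  using expand_lin_comb_embed[OF coord_keys] coord_lin_comb by metis

lemma expand_inj: "u \<in> carrier A \<Longrightarrow> v \<in> carrier A \<Longrightarrow> expand u = expand v \<Longrightarrow> u = v"
  by (metis coord_lin_comb expand_embed poly_mapping_eqI)

lemma A_induct [consumes 1, case_names mon add smul]:
  assumes "u \<in> carrier A"
    and m: "\<And>a. a \<in> mindices n \<Longrightarrow> P (mon n q a)"
    and a: "\<And>u v. u \<in> carrier A \<Longrightarrow> v \<in> carrier A \<Longrightarrow> P u \<Longrightarrow> P v \<Longrightarrow> P (u \<oplus>\<^bsub>A\<^esub> v)"
    and s: "\<And>c u. u \<in> carrier A \<Longrightarrow> P u \<Longrightarrow> P (smul n q c u)"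
  shows "P u"
proof -
  have "P \<zero>\<^bsub>A\<^esub>"
  proof -
    have "0 \<in> mindices n" by (simp add: mindices_def)
    then have "P (smul n q 0 (mon n q 0))" by (intro s m) simp_all
    moreover have "smul n q 0 (mon n q 0) = \<zero>\<^bsub>A\<^esub>"
      by (simp add: mon_proj smul_proj[OF word_in_free[OF set_spell]] scalar_0 proj_zero)
    ultimately show ?thesis by simp
  qed
  have sum: "S \<subseteq> mindices n \<Longrightarrow> P (\<Oplus>\<^bsub>A\<^esub>a\<in>S. smul n q (c a) (mon n q a))" if "finite S" for S c
    using that
  proof (induction S rule: finite_induct)
    case (insert x S)
    then show ?case by (subst A.finsum_insert) (auto intro!: a s m A.finsum_closed)
  qed (use \<open>P \<zero>\<^bsub>A\<^esub>\<close> in simp)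
  from sum[OF finite_keys coord_keys[OF assms(1)], of "Poly_Mapping.lookup (coord n q u)"] show ?thesis
    by (simp only: finsum_mon coord_lin_comb[OF assms(1), symmetric])
qed

end

subsection \<open>Operators on the algebra\<close>

lemma app_sum_arg: "app X (sum f S) = (\<Sum>a\<in>S. app X (f a))"
  by (induction S rule: infinite_finite_induct)
     (simp_all only: sum.infinite sum.empty sum.insert app_zero app_add not_False_eq_True)

context quantum_matrices
begin

abbreviation "L \<equiv> lin_ops n q"

lemma smul_rules:
  assumes "u \<in> carrier A" "v \<in> carrier A"
  shows smul_add: "smul n q c (u \<oplus>\<^bsub>A\<^esub> v) = smul n q c u \<oplus>\<^bsub>A\<^esub> smul n q c v"
    and smul_smul: "smul n q c (smul n q d u) = smul n q (c * d) u"
    and smul_plus: "smul n q (c + d) u = smul n q c u \<oplus>\<^bsub>A\<^esub> smul n q d u"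
    and smul_one: "smul n q 1 u = u"
    and smul_zero: "smul n q 0 u = \<zero>\<^bsub>A\<^esub>"
  by (rule A_cases[OF assms(1)], rule A_cases[OF assms(2)],
      simp add: smul_proj proj_simps free_alg_closed scalar_in_free_alg distrib_left distrib_right
        scalar_mult[symmetric] scalar_add[symmetric] mult.assoc scalar_1 scalar_0 proj_zero)+

lemma L_sel:
  "S \<otimes>\<^bsub>L\<^esub> T = compose (carrier A) S T"
  "S \<oplus>\<^bsub>L\<^esub> T = (\<lambda>u \<in> carrier A. S u \<oplus>\<^bsub>A\<^esub> T u)"
  "\<one>\<^bsub>L\<^esub> = (\<lambda>u \<in> carrier A. u)"
  "\<zero>\<^bsub>L\<^esub> = (\<lambda>u \<in> carrier A. \<zero>\<^bsub>A\<^esub>)"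
  by (simp_all add: lin_ops_def)

lemma L_carrier:
  "T \<in> carrier L \<longleftrightarrow> T \<in> carrier A \<rightarrow>\<^sub>E carrier A \<and>
        (\<forall>u \<in> carrier A. \<forall>v \<in> carrier A. T (u \<oplus>\<^bsub>A\<^esub> v) = T u \<oplus>\<^bsub>A\<^esub> T v) \<and>
        (\<forall>c. \<forall>u \<in> carrier A. T (smul n q c u) = smul n q c (T u))"
  by (simp add: lin_ops_def)

lemma L_closed: "T \<in> carrier L \<Longrightarrow> u \<in> carrier A \<Longrightarrow> T u \<in> carrier A"
  unfolding L_carrier by auto

lemma L_add: "T \<in> carrier L \<Longrightarrow> u \<in> carrier A \<Longrightarrow> v \<in> carrier A \<Longrightarrow> T (u \<oplus>\<^bsub>A\<^esub> v) = T u \<oplus>\<^bsub>A\<^esub> T v"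
  and L_smul: "T \<in> carrier L \<Longrightarrow> u \<in> carrier A \<Longrightarrow> T (smul n q c u) = smul n q c (T u)"
  unfolding L_carrier by auto

lemma L_eqI: "S \<in> carrier L \<Longrightarrow> T \<in> carrier L \<Longrightarrow> (\<And>u. u \<in> carrier A \<Longrightarrow> S u = T u) \<Longrightarrow> S = T"
  unfolding L_carrier by (meson PiE_ext)

lemma L_ops_closed:
  assumes "S \<in> carrier L" "T \<in> carrier L"
  shows "S \<oplus>\<^bsub>L\<^esub> T \<in> carrier L" "S \<otimes>\<^bsub>L\<^esub> T \<in> carrier L"
proof -
  have "S u \<oplus>\<^bsub>A\<^esub> S v \<oplus>\<^bsub>A\<^esub> (T u \<oplus>\<^bsub>A\<^esub> T v) = S u \<oplus>\<^bsub>A\<^esub> T u \<oplus>\<^bsub>A\<^esub> (S v \<oplus>\<^bsub>A\<^esub> T v)"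
    if "u \<in> carrier A" "v \<in> carrier A" for u v
    using that L_closed[OF assms(1)] L_closed[OF assms(2)] A.add.m_ac by simp
  then show "S \<oplus>\<^bsub>L\<^esub> T \<in> carrier L"
    unfolding L_carrier L_sel using assms
    by (auto simp: L_closed L_add L_smul smul_add)
  show "S \<otimes>\<^bsub>L\<^esub> T \<in> carrier L"
    unfolding L_carrier L_sel using assms
    by (auto simp: L_closed L_add L_smul compose_def)
qed

lemma L_zero_one: "\<zero>\<^bsub>L\<^esub> \<in> carrier L" "\<one>\<^bsub>L\<^esub> \<in> carrier L"
proof -
  have "smul n q c \<zero>\<^bsub>A\<^esub> = \<zero>\<^bsub>A\<^esub>" for c
    unfolding smul_def using scalar_in_free_alg[of c n] by (simp add: proj_closed flip: proj_def)
  then show "\<zero>\<^bsub>L\<^esub> \<in> carrier L" "\<one>\<^bsub>L\<^esub> \<in> carrier L"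
    unfolding L_carrier L_sel by auto
qed

definition scalar_map :: "complex \<Rightarrow> ncpoly set \<Rightarrow> ncpoly set" where
  "scalar_map c = (\<lambda>u \<in> carrier A. smul n q c u)"

lemma scalar_map_closed: "scalar_map c \<in> carrier L"
  unfolding L_carrier scalar_map_def by (auto simp: smul_add smul_smul mult.commute)

sublocale L: ring L
proof (rule ringI)
  show "abelian_group L"
  proof (rule abelian_groupI)
    fix T assume T: "T \<in> carrier L"
    have "smul n q (- 1) v \<oplus>\<^bsub>A\<^esub> v = \<zero>\<^bsub>A\<^esub>" if "v \<in> carrier A" for v
      using that smul_plus[OF that that, of "- 1" 1] by (simp add: smul_one smul_zero)
    then have "scalar_map (- 1) \<otimes>\<^bsub>L\<^esub> T \<oplus>\<^bsub>L\<^esub> T = \<zero>\<^bsub>L\<^esub>"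
      using T by (intro L_eqI L_ops_closed scalar_map_closed L_zero_one)
        (auto simp: L_sel compose_def scalar_map_def L_closed)
    then show "\<exists>S\<in>carrier L. S \<oplus>\<^bsub>L\<^esub> T = \<zero>\<^bsub>L\<^esub>"
      using T L_ops_closed scalar_map_closed by blast
  next
    fix R S T assume "R \<in> carrier L" "S \<in> carrier L" "T \<in> carrier L"
    then show "R \<oplus>\<^bsub>L\<^esub> S \<oplus>\<^bsub>L\<^esub> T = R \<oplus>\<^bsub>L\<^esub> (S \<oplus>\<^bsub>L\<^esub> T)"
      by (intro L_eqI L_ops_closed) (auto simp: L_sel L_closed A.a_assoc)
  next
    fix S T assume "S \<in> carrier L" "T \<in> carrier L"
    then show "S \<oplus>\<^bsub>L\<^esub> T = T \<oplus>\<^bsub>L\<^esub> S"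
      by (intro L_eqI L_ops_closed) (auto simp: L_sel L_closed A.a_comm)
  next
    fix T assume "T \<in> carrier L"
    then show "\<zero>\<^bsub>L\<^esub> \<oplus>\<^bsub>L\<^esub> T = T"
      by (intro L_eqI L_ops_closed L_zero_one) (auto simp: L_sel L_closed)
  qed (simp_all add: L_ops_closed L_zero_one)
  show "Group.monoid L"
  proof (rule Group.monoidI)
    fix R S T assume "R \<in> carrier L" "S \<in> carrier L" "T \<in> carrier L"
    then show "R \<otimes>\<^bsub>L\<^esub> S \<otimes>\<^bsub>L\<^esub> T = R \<otimes>\<^bsub>L\<^esub> (S \<otimes>\<^bsub>L\<^esub> T)"
      by (intro L_eqI L_ops_closed) (auto simp: L_sel L_closed compose_def)
  next
    fix T assume "T \<in> carrier L"
    then show "\<one>\<^bsub>L\<^esub> \<otimes>\<^bsub>L\<^esub> T = T" "T \<otimes>\<^bsub>L\<^esub> \<one>\<^bsub>L\<^esub> = T"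
      by (intro L_eqI L_ops_closed L_zero_one; auto simp: L_sel L_closed compose_def)+
  qed (simp_all add: L_ops_closed L_zero_one)
next
  fix R S T assume "R \<in> carrier L" "S \<in> carrier L" "T \<in> carrier L"
  then show "(R \<oplus>\<^bsub>L\<^esub> S) \<otimes>\<^bsub>L\<^esub> T = R \<otimes>\<^bsub>L\<^esub> T \<oplus>\<^bsub>L\<^esub> S \<otimes>\<^bsub>L\<^esub> T"
    "T \<otimes>\<^bsub>L\<^esub> (R \<oplus>\<^bsub>L\<^esub> S) = T \<otimes>\<^bsub>L\<^esub> R \<oplus>\<^bsub>L\<^esub> T \<otimes>\<^bsub>L\<^esub> S"
    by (intro L_eqI L_ops_closed; auto simp: L_sel L_closed L_add compose_def)+
qed

section \<open>Comparison with operators on exponents\<close>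

definition rep :: "linop \<Rightarrow> (ncpoly set \<Rightarrow> ncpoly set) \<Rightarrow> bool" where
  "rep X T \<longleftrightarrow> T \<in> carrier L \<and> (\<forall>u\<in>carrier A. expand (T u) = app X (expand u))"

lemma rep_closed: "rep X T \<Longrightarrow> T \<in> carrier L"
  and rep_expand: "rep X T \<Longrightarrow> u \<in> carrier A \<Longrightarrow> expand (T u) = app X (expand u)"
  by (simp_all add: rep_def)

text \<open>As \<open>expand\<close> is injective, \<open>X\<close> determines its restriction. The
  converse fails, since \<open>X\<close> also acts on exponents that belong to no monomial; hence
  \<open>rep\<close> is a relation.\<close>

lemma rep_unique: "rep X S \<Longrightarrow> rep X T \<Longrightarrow> S = T"
proof (rule L_eqI)
  fix u assume "rep X S" "rep X T" "u \<in> carrier A"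
  then show "S u = T u" by (intro expand_inj) (simp_all add: rep_def L_closed)
qed (simp_all add: rep_def)

text \<open>Linearity of \<open>T\<close> is inherited from \<open>X\<close> through the injective
  map \<open>expand\<close>.\<close>

lemma repI:
  assumes "T \<in> carrier A \<rightarrow>\<^sub>E carrier A" "\<And>u. u \<in> carrier A \<Longrightarrow> expand (T u) = app X (expand u)"
  shows "rep X T"
proof -
  have c: "T u \<in> carrier A" if "u \<in> carrier A" for u
    using assms(1) that by auto
  have add: "T (u \<oplus>\<^bsub>A\<^esub> v) = T u \<oplus>\<^bsub>A\<^esub> T v" if "u \<in> carrier A" "v \<in> carrier A" for u v
    using that by (intro expand_inj) (simp_all add: c assms(2) expand_add app_add)
  have smul: "T (smul n q d u) = smul n q d (T u)" if "u \<in> carrier A" for d u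
    using that by (intro expand_inj) (simp_all add: c assms(2) expand_smul app_scale)
  show ?thesis
    unfolding rep_def L_carrier by (intro conjI ballI allI assms add smul)
qed

lemma rep_add: "rep X S \<Longrightarrow> rep Y T \<Longrightarrow> rep (X + Y) (S \<oplus>\<^bsub>L\<^esub> T)"
  unfolding rep_def by (auto simp: L_sel(2) L_closed expand_add intro: L_ops_closed(1)[unfolded L_sel(2)])

lemma rep_mult: "rep X S \<Longrightarrow> rep Y T \<Longrightarrow> rep (X * Y) (S \<otimes>\<^bsub>L\<^esub> T)"
  unfolding rep_def
  by (auto simp: L_sel(1) L_closed compose_def intro: L_ops_closed(2)[unfolded L_sel(1) compose_def])

lemma rep_one: "rep 1 \<one>\<^bsub>L\<^esub>"
  using L_zero_one by (simp add: rep_def L_sel(3))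

lemma rep_scalar_map: "rep (scalar_op c) (scalar_map c)"
  unfolding rep_def using scalar_map_closed by (simp add: scalar_map_def expand_smul app_scalar_op)

lemma expand_finsum:
  assumes "finite S" "\<And>a. a \<in> S \<Longrightarrow> g a \<in> carrier A"
  shows "expand (\<Oplus>\<^bsub>A\<^esub>a\<in>S. g a) = (\<Sum>a\<in>S. expand (g a))"
  using assms
proof (induction S rule: finite_induct)
  case empty
  have "expand \<zero>\<^bsub>A\<^esub> = expand \<zero>\<^bsub>A\<^esub> + expand \<zero>\<^bsub>A\<^esub>"
    using expand_add[of "\<zero>\<^bsub>A\<^esub>" "\<zero>\<^bsub>A\<^esub>"] by simp
  then show ?case by simp
next
  case (insert x S)
  then show ?case by (subst A.finsum_insert) (auto simp: expand_add A.finsum_closed)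
qed

lemma rep_lin_ext:
  assumes g: "\<And>a. a \<in> mindices n \<Longrightarrow> g a \<in> carrier A"
    and X: "\<And>a. a \<in> mindices n \<Longrightarrow> expand (g a) = app X (delta (embed a))"
  shows "rep X (lin_ext n q g)"
proof (rule repI)
  have k: "a \<in> mindices n" if "u \<in> carrier A" "a \<in> Poly_Mapping.keys (coord n q u)" for a u
    using coord_keys[OF that(1)] that(2) by (rule subsetD)
  show "lin_ext n q g \<in> carrier A \<rightarrow>\<^sub>E carrier A"
    unfolding lin_ext_def by (auto intro!: A.finsum_closed smul_closed g k)
  fix u assume u: "u \<in> carrier A"
  let ?c = "Poly_Mapping.lookup (coord n q u)"
  have "expand u = (\<lambda>e. \<Sum>a\<in>Poly_Mapping.keys (coord n q u). ?c a * delta (embed a) e)"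
    using expand_lin_comb[OF coord_keys[OF u]] coord_lin_comb[OF u] by simp
  also have "\<dots> = (\<Sum>a\<in>Poly_Mapping.keys (coord n q u). (\<lambda>e. ?c a * delta (embed a) e))"
    by (simp add: fun_eq_iff sum_fun_apply)
  finally have e: "app X (expand u) = (\<Sum>a\<in>Poly_Mapping.keys (coord n q u). (\<lambda>e. ?c a * app X (delta (embed a)) e))"
    by (simp only: app_sum_arg app_scale)
  have "expand (lin_ext n q g u) = (\<Sum>a\<in>Poly_Mapping.keys (coord n q u). expand (smul n q (?c a) (g a)))"
    using u by (simp add: lin_ext_def) (intro expand_finsum finite_keys smul_closed g k)
  also have "\<dots> = app X (expand u)"
    unfolding e by (intro sum.cong refl) (simp only: expand_smul[OF g[OF k[OF u]]] X[OF k[OF u]])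
  finally show "expand (lin_ext n q g u) = app X (expand u)" .
qed

section \<open>Coefficients of the generating operators\<close>

lemma mindices_add: "a \<in> mindices n \<Longrightarrow> i \<in> {1..n} \<Longrightarrow> j \<in> {1..n} \<Longrightarrow> a + unit_index i j \<in> mindices n"
  unfolding mindices_iff by (auto simp: lookup_add lookup_single when_def)

lemma mindices_diff: "a \<in> mindices n \<Longrightarrow> a - unit_index i j \<in> mindices n"
  unfolding mindices_iff by (simp add: lookup_minus)

lemma rep_Mo:
  assumes "i \<in> {1..n}" "j \<in> {1..n}"
  shows "rep (shift_op (unit_expo (i, j)) (\<lambda>_. 1)) (Mo n q i j)"
  unfolding Mo_def using assms
  by (intro rep_lin_ext) (simp_all only: mon_closed expand_mon mindices_add embed_add app_shift_op_delta mult_1)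

definition qnum :: "int \<Rightarrow> complex" where
  "qnum m = (q powi m - q powi (- m)) / (q - inverse q)"

lemma qint_qnum: "qint q m = qnum (int m)"
  by (simp add: qint_def qnum_def power_int_minus power_inverse)

lemma embed_at: "embed a p = int (Poly_Mapping.lookup a p)"
  by (simp add: embed_def)

lemma rep_Do:
  "rep (shift_op (- unit_expo (i, j)) (\<lambda>a. qnum (a (i, j)))) (Do n q i j)"
  unfolding Do_def
proof (rule rep_lin_ext)
  fix a assume a: "a \<in> mindices n"
  show "expand (smul n q (qint q (Poly_Mapping.lookup a (i, j))) (mon n q (a - unit_index i j))) =
      app (shift_op (- unit_expo (i, j)) (\<lambda>a. qnum (a (i, j)))) (delta (embed a))"
  proof (cases "Poly_Mapping.lookup a (i, j) = 0")
    case True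
    then show ?thesis by (simp add: expand_smul app_shift_op_delta qint_qnum embed_at qnum_def)
  next
    case False
    have "a - unit_index i j + unit_index i j = a"
      using False by (intro poly_mapping_eqI) (auto simp: lookup_add lookup_minus lookup_single when_def)
    then have "embed (a - unit_index i j) = embed a - unit_expo (i, j)"
      using embed_add[of "a - unit_index i j" "(i, j)"] by (metis add_diff_cancel_right')
    then show ?thesis
      using a by (simp add: expand_smul app_shift_op_delta qint_qnum embed_at expand_mon mindices_diff diff_conv_add_uminus
          del: add_uminus_conv_diff One_nat_def)
  qed
qed (simp add: mindices_diff)

lemma rep_diag:
  "rep (diag_op c) (lin_ext n q (\<lambda>a. smul n q (c (embed a)) (mon n q a)))"
  by (intro rep_lin_ext) (simp_all add: expand_smul expand_mon app_shift_op_delta)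

lemma rep_Ho: "rep (diag_op (\<lambda>a. q powi a (i, j))) (Ho n q i j)"
  unfolding Ho_def using rep_diag[of "\<lambda>a. q powi a (i, j)"] by (simp add: embed_at)

lemma rep_inverse:
  assumes "rep X S" "rep Y T" "X * Y = 1" "Y * X = 1"
  shows "inv\<^bsub>L\<^esub> S = T"
proof -
  have "S \<otimes>\<^bsub>L\<^esub> T = \<one>\<^bsub>L\<^esub>" "T \<otimes>\<^bsub>L\<^esub> S = \<one>\<^bsub>L\<^esub>"
    using rep_mult[OF assms(1,2)] rep_mult[OF assms(2,1)] assms(3,4) rep_one rep_unique by metis+
  then show ?thesis
    using L.inv_unique'[of S T] rep_closed[OF assms(1)] rep_closed[OF assms(2)] by simp
qed

lemma diag_op_mult: "diag_op c * diag_op d = diag_op (\<lambda>a. c a * d a)"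
  by (simp add: shift_op_mult)

lemma rep_inv_diag_op:
  assumes "rep (diag_op c) S" "\<And>a. c a \<noteq> 0"
  shows "rep (diag_op (\<lambda>a. inverse (c a))) (inv\<^bsub>L\<^esub> S)"
proof -
  have "inv\<^bsub>L\<^esub> S = lin_ext n q (\<lambda>a. smul n q (inverse (c (embed a))) (mon n q a))"
    using assms(2) by (intro rep_inverse[OF assms(1) rep_diag]) (simp_all add: diag_op_mult scalar_op_1)
  then show ?thesis using rep_diag by simp
qed

text \<open>The inverse of H acts after D has lowered the exponent to m - 1, whence q^(1-m) [m]. For
  natural m this is {{m}}; the integers are needed because exponents may be negative.\<close>

definition cnum :: "int \<Rightarrow> complex" where
  "cnum m = q powi (1 - m) * qnum m"

lemma rep_calDo: "rep (shift_op (- unit_expo (i, j)) (\<lambda>a. cnum (a (i, j)))) (calDo n q i j)"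
proof -
  have "rep (diag_op (\<lambda>a. inverse (q powi a (i, j))) * shift_op (- unit_expo (i, j)) (\<lambda>a. qnum (a (i, j)))) (calDo n q i j)"
    unfolding calDo_def using q0 by (intro rep_mult rep_inv_diag_op rep_Ho rep_Do) simp
  moreover have "inverse (q powi ((a + - unit_expo (i, j)) (i, j))) = q powi (1 - a (i, j))" for a
    by (simp add: unit_expo_def power_int_minus[symmetric])
  ultimately show ?thesis
    by (simp only: shift_op_mult cnum_def add_0)
qed

definition se_sum :: "nat \<Rightarrow> nat \<Rightarrow> expo \<Rightarrow> int" where
  "se_sum i j a = (\<Sum>k\<in>{i<..n}. a (k, j)) + (\<Sum>s\<in>{j<..n}. a (i, s))"

lemma rep_VSE: "rep (diag_op (\<lambda>a. q powi se_sum i j a)) (VSE n q i j)"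
proof -
  have "rep (diag_op (\<lambda>a. q powi (\<Sum>p\<leftarrow>ps. a p))) (foldr (\<otimes>\<^bsub>L\<^esub>) (map (\<lambda>(k, s). Ho n q k s) ps) \<one>\<^bsub>L\<^esub>)" for ps
  proof (induction ps)
    case Nil
    show ?case by (simp only: list.map foldr.simps id_apply sum_list.Nil power_int_0_right scalar_op_1 rep_one)
  next
    case (Cons p ps)
    obtain k s where p: "p = (k, s)" by (cases p)
    have e: "diag_op (\<lambda>a. q powi (\<Sum>p\<leftarrow>p # ps. a p)) = diag_op (\<lambda>a. q powi a p) * diag_op (\<lambda>a. q powi (\<Sum>p\<leftarrow>ps. a p))"
      using q0 by (simp add: diag_op_mult power_int_add)
    show ?case
      unfolding e unfolding list.map foldr.simps o_apply p prod.case by (intro rep_mult rep_Ho Cons.IH)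
  qed
  note this[of "map (\<lambda>k. (k, j)) [Suc i..<Suc n] @ map (\<lambda>s. (i, s)) [Suc j..<Suc n]"]
  moreover have "(\<Sum>p\<leftarrow>map (\<lambda>k. (k, j)) [Suc i..<Suc n] @ map (\<lambda>s. (i, s)) [Suc j..<Suc n]. a p) = se_sum i j a" for a :: expo
    by (simp add: se_sum_def interv_sum_list_conv_sum_set_nat comp_def atLeastSucLessThan_greaterThanLessThan
        atLeastSucAtMost_greaterThanAtMost atLeastLessThanSuc_atLeastAtMost del: upt_Suc)
  ultimately show ?thesis
    by (simp add: VSE_def comp_def del: upt_Suc)
qed

lemma rep_right_mult:
  assumes "i \<in> {1..n}" "j \<in> {1..n}"
  shows "rep (right_op n q n i j) (right_mult n q (gen n q i j))"
  using assms by (intro repI) (auto simp: right_mult_def gen_closed expand_gen)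

text \<open>The operators on exponents that restrict to a member of \<open>D\<close>. Membership is
  decided on this side because products of explicit shifts are easy to compute in the ring
  \<open>linop\<close>.\<close>

definition pull :: "(ncpoly set \<Rightarrow> ncpoly set) set \<Rightarrow> linop set" where
  "pull D = {X. \<exists>T\<in>D. rep X T}"

lemma pull_iff: "rep X T \<Longrightarrow> X \<in> pull D \<longleftrightarrow> T \<in> D"
  unfolding pull_def using rep_unique by blast

lemma op_algebra_scalar_map: "op_algebra n q G = generate_ring L (range scalar_map \<union> G)"
  unfolding op_algebra_def scalar_map_def ..

lemma op_algebra_incl: "G \<subseteq> op_algebra n q G"
  unfolding op_algebra_scalar_map by (auto intro: generate_ring.incl)

lemma gens_closed: "G \<subseteq> carrier L \<Longrightarrow> range scalar_map \<union> G \<subseteq> carrier L"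
  using scalar_map_closed by auto

lemma op_algebra_least:
  assumes "G \<subseteq> op_algebra n q G'" "G' \<subseteq> carrier L"
  shows "op_algebra n q G \<subseteq> op_algebra n q G'"
  unfolding op_algebra_scalar_map
proof (rule L.generate_ring_min_subring1)
  show "subring (generate_ring L (range scalar_map \<union> G')) L"
    by (rule L.generate_ring_is_subring[OF gens_closed[OF assms(2)]])
  show "range scalar_map \<union> G \<subseteq> generate_ring L (range scalar_map \<union> G')"
    using assms(1) unfolding op_algebra_scalar_map by (auto intro: generate_ring.incl)
  then show "range scalar_map \<union> G \<subseteq> carrier L"
    using L.generate_ring_in_carrier[OF gens_closed[OF assms(2)]] by blast
qed

lemma op_algebra_induct [consumes 2, case_names scalar_map gen add mult]:
  assumes "T \<in> op_algebra n q G" "G \<subseteq> carrier L"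
    and s: "\<And>c. P (scalar_map c)" and g: "\<And>T. T \<in> G \<Longrightarrow> P T"
    and a: "\<And>S T. S \<in> carrier L \<Longrightarrow> T \<in> carrier L \<Longrightarrow> P S \<Longrightarrow> P T \<Longrightarrow> P (S \<oplus>\<^bsub>L\<^esub> T)"
    and m: "\<And>S T. S \<in> carrier L \<Longrightarrow> T \<in> carrier L \<Longrightarrow> P S \<Longrightarrow> P T \<Longrightarrow> P (S \<otimes>\<^bsub>L\<^esub> T)"
  shows "P T"
proof -
  have "T \<in> carrier L \<and> P T"
    using assms(1) unfolding op_algebra_scalar_map
  proof (induction rule: generate_ring.induct)
    case one
    have "scalar_map 1 = \<one>\<^bsub>L\<^esub>" by (rule rep_unique[OF rep_scalar_map]) (simp add: scalar_op_1 rep_one)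
    then show ?case using s[of 1] by simp
  next
    case (incl h)
    then show ?case using assms(2) s g scalar_map_closed by blast
  next
    case (a_inv h)
    \<comment> \<open>Additive inverses are products with the scalar -1, which is why the rule has
      no case for them.\<close>
    have "scalar_map (- 1) \<otimes>\<^bsub>L\<^esub> h \<oplus>\<^bsub>L\<^esub> h = \<zero>\<^bsub>L\<^esub>"
    proof (rule L_eqI)
      fix u assume u: "u \<in> carrier A"
      then show "(scalar_map (- 1) \<otimes>\<^bsub>L\<^esub> h \<oplus>\<^bsub>L\<^esub> h) u = \<zero>\<^bsub>L\<^esub> u"
        using a_inv smul_plus[of "h u" "h u" "- 1" 1]
        by (simp add: L_sel compose_def scalar_map_def L_closed smul_one smul_zero)
    qed (use a_inv in \<open>auto intro!: L_ops_closed scalar_map_closed L_zero_one\<close>)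
    then have "\<ominus>\<^bsub>L\<^esub> h = scalar_map (- 1) \<otimes>\<^bsub>L\<^esub> h"
      using a_inv by (intro L.minus_equality) (auto intro!: L_ops_closed scalar_map_closed)
    then show ?case using a_inv m[OF scalar_map_closed _ s] by (auto intro!: L_ops_closed scalar_map_closed)
  qed (auto intro!: a m L_ops_closed)
  then show ?thesis ..
qed

lemma op_algebra_closed: "G \<subseteq> carrier L \<Longrightarrow> op_algebra n q G \<subseteq> carrier L"
  unfolding op_algebra_scalar_map by (rule L.generate_ring_incl[OF gens_closed])

definition subalg :: "linop set \<Rightarrow> bool" where
  "subalg C \<longleftrightarrow> (\<forall>c. scalar_op c \<in> C) \<and> (\<forall>X\<in>C. \<forall>Y\<in>C. X + Y \<in> C \<and> X * Y \<in> C)"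

lemma subalg_pull: "subalg (pull (op_algebra n q G))"
  unfolding subalg_def pull_def op_algebra_scalar_map
  by (blast intro: rep_scalar_map rep_add rep_mult generate_ring.intros)


subsection \<open>Adjoints\<close>

text \<open>Both pairings are diagonal in the monomial basis and differ only in the weight
  \<open>N\<close>, so adjoints can be treated once for both.\<close>

definition form :: "(mindex \<Rightarrow> complex) \<Rightarrow> ncpoly set \<Rightarrow> ncpoly set \<Rightarrow> complex" where
  "form N = bilin_ext n q (\<lambda>b a. if a = b then N a else 0)"

lemma form_eq:
  assumes "finite S" "Poly_Mapping.keys (coord n q w) \<subseteq> S"
  shows "form N w u = (\<Sum>b\<in>S. Poly_Mapping.lookup (coord n q w) b * Poly_Mapping.lookup (coord n q u) b * N b)"
proof -
  have "form N w u = (\<Sum>b\<in>Poly_Mapping.keys (coord n q w). Poly_Mapping.lookup (coord n q w) b *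
      Poly_Mapping.lookup (coord n q u) b * N b)"
    unfolding form_def bilin_ext_def
  proof (intro sum.cong refl)
    fix b
    have "(\<Sum>a\<in>Poly_Mapping.keys (coord n q u). Poly_Mapping.lookup (coord n q w) b *
        Poly_Mapping.lookup (coord n q u) a * (if a = b then N a else 0)) =
      (\<Sum>a\<in>Poly_Mapping.keys (coord n q u). if a = b then Poly_Mapping.lookup (coord n q w) b *
        Poly_Mapping.lookup (coord n q u) b * N b else 0)"
      by (intro sum.cong) auto
    then show "(\<Sum>a\<in>Poly_Mapping.keys (coord n q u). Poly_Mapping.lookup (coord n q w) b *
        Poly_Mapping.lookup (coord n q u) a * (if a = b then N a else 0)) =
      Poly_Mapping.lookup (coord n q w) b * Poly_Mapping.lookup (coord n q u) b * N b"
      by (simp add: in_keys_iff)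
  qed
  also have "\<dots> = (\<Sum>b\<in>S. Poly_Mapping.lookup (coord n q w) b * Poly_Mapping.lookup (coord n q u) b * N b)"
    using assms by (intro sum.mono_neutral_left) (auto simp: in_keys_iff)
  finally show ?thesis .
qed

lemma form_sym: "form N w u = form N u w"
proof -
  let ?S = "Poly_Mapping.keys (coord n q w) \<union> Poly_Mapping.keys (coord n q u)"
  have "finite ?S" by simp
  then show ?thesis
    by (subst (1 2) form_eq[where S = ?S]) (simp_all add: mult.commute)
qed

lemma coord_add:
  "u \<in> carrier A \<Longrightarrow> v \<in> carrier A \<Longrightarrow>
    Poly_Mapping.lookup (coord n q (u \<oplus>\<^bsub>A\<^esub> v)) b = Poly_Mapping.lookup (coord n q u) b + Poly_Mapping.lookup (coord n q v) b"
  by (simp add: expand_embed[symmetric] expand_add)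

lemma coord_smul:
  "u \<in> carrier A \<Longrightarrow> Poly_Mapping.lookup (coord n q (smul n q c u)) b = c * Poly_Mapping.lookup (coord n q u) b"
  by (simp add: expand_embed[symmetric] expand_smul)

lemma coord_mon:
  "a \<in> mindices n \<Longrightarrow> Poly_Mapping.lookup (coord n q (mon n q a)) b = (if b = a then 1 else 0)"
  by (simp add: expand_embed[symmetric] expand_mon delta_def embed_inj)

lemma form_add:
  assumes "u \<in> carrier A" "v \<in> carrier A"
  shows "form N w (u \<oplus>\<^bsub>A\<^esub> v) = form N w u + form N w v"
    "form N (u \<oplus>\<^bsub>A\<^esub> v) w = form N u w + form N v w"
proof -
  show *: "form N w (u \<oplus>\<^bsub>A\<^esub> v) = form N w u + form N w v" for w
    using assms by (simp add: form_eq[OF finite_keys order_refl] coord_add sum.distrib[symmetric] algebra_simps)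
  show "form N (u \<oplus>\<^bsub>A\<^esub> v) w = form N u w + form N v w"
    using *[of w] by (simp only: form_sym[of N _ w])
qed

lemma form_smul:
  assumes "u \<in> carrier A"
  shows "form N w (smul n q c u) = c * form N w u" "form N (smul n q c u) w = c * form N u w"
proof -
  show *: "form N w (smul n q c u) = c * form N w u" for w
    using assms by (simp add: form_eq[OF finite_keys order_refl] coord_smul sum_distrib_left mult_ac)
  show "form N (smul n q c u) w = c * form N u w"
    using *[of w] by (simp only: form_sym[of N _ w])
qed

lemma form_mon:
  assumes "a \<in> mindices n"
  shows "form N (mon n q a) u = Poly_Mapping.lookup (coord n q u) a * N a"
proof -
  have "form N (mon n q a) u = (\<Sum>b\<in>{a}. Poly_Mapping.lookup (coord n q (mon n q a)) b * Poly_Mapping.lookup (coord n q u) b * N b)"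
    using assms by (intro form_eq) (auto simp: in_keys_iff coord_mon split: if_splits)
  then show ?thesis using assms by (simp add: coord_mon)
qed

text \<open>A relation avoids the definite description in \<open>adjoint\<close>; the two are
  connected once existence and uniqueness are known.\<close>

definition adj :: "(mindex \<Rightarrow> complex) \<Rightarrow> (ncpoly set \<Rightarrow> ncpoly set) \<Rightarrow> (ncpoly set \<Rightarrow> ncpoly set) \<Rightarrow> bool" where
  "adj N S T \<longleftrightarrow> (\<forall>w\<in>carrier A. \<forall>u\<in>carrier A. form N (S w) u = form N w (T u))"

lemma adj_sym: "adj N S T \<Longrightarrow> adj N T S"
  unfolding adj_def by (metis form_sym)

lemma adj_add:
  assumes "adj N S S'" "adj N T T'" "S \<in> carrier L" "T \<in> carrier L" "S' \<in> carrier L" "T' \<in> carrier L"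
  shows "adj N (S \<oplus>\<^bsub>L\<^esub> T) (S' \<oplus>\<^bsub>L\<^esub> T')"
  using assms unfolding adj_def by (simp add: L_sel L_closed form_add)

lemma adj_mult:
  assumes "adj N S S'" "adj N T T'" "S \<in> carrier L" "T \<in> carrier L" "S' \<in> carrier L" "T' \<in> carrier L"
  shows "adj N (S \<otimes>\<^bsub>L\<^esub> T) (T' \<otimes>\<^bsub>L\<^esub> S')"
  using assms unfolding adj_def by (simp add: L_sel L_closed compose_def)

lemma adj_scalar_map: "adj N (scalar_map c) (scalar_map c)"
  unfolding adj_def by (simp add: scalar_map_def form_smul)

text \<open>By bilinearity it suffices to compare matrix entries between monomials, where the form
  contributes only the weights.\<close>

lemma adj_rep:
  assumes X: "rep X S" and Y: "rep Y T"
    and N: "\<And>a b. a \<in> mindices n \<Longrightarrow> b \<in> mindices n \<Longrightarrow>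
      N b * app X (delta (embed a)) (embed b) = N a * app Y (delta (embed b)) (embed a)"
  shows "adj N S T"
  unfolding adj_def
proof (intro ballI)
  note c = rep_closed[OF X] rep_closed[OF Y]
  fix w u assume "w \<in> carrier A" "u \<in> carrier A"
  then show "form N (S w) u = form N w (T u)"
  proof (induction w rule: A_induct)
    case (mon a)
    show ?case
      using \<open>u \<in> carrier A\<close>
    proof (induction u rule: A_induct)
      case (mon b)
      have "form N (S (Defs.mon n q a)) (Defs.mon n q b) = N b * expand (S (Defs.mon n q a)) (embed b)"
        using mon c by (simp add: form_sym[of N _ "Defs.mon n q b"] form_mon expand_embed L_closed)
      also have "\<dots> = N a * expand (T (Defs.mon n q b)) (embed a)"
        using N[OF \<open>a \<in> mindices n\<close> mon] mon \<open>a \<in> mindices n\<close> by (simp add: rep_expand[OF X] rep_expand[OF Y] expand_mon)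
      also have "\<dots> = form N (Defs.mon n q a) (T (Defs.mon n q b))"
        using \<open>a \<in> mindices n\<close> c by (simp add: form_mon expand_embed L_closed)
      finally show ?case .
    qed (use c in \<open>simp_all add: L_add L_smul L_closed form_add form_smul\<close>)
  qed (use c in \<open>simp_all add: L_add L_smul L_closed form_add form_smul\<close>)
qed

lemma adj_unique:
  assumes "adj N S T" "adj N S T'" "T \<in> carrier L" "T' \<in> carrier L"
    and N: "\<And>a. a \<in> mindices n \<Longrightarrow> N a \<noteq> 0"
  shows "T = T'"
proof (rule L_eqI[OF assms(3,4)])
  fix u assume u: "u \<in> carrier A"
  have "Poly_Mapping.lookup (coord n q (T u)) a = Poly_Mapping.lookup (coord n q (T' u)) a" for a
  proof (cases "a \<in> mindices n")
    case True
    then have "form N (mon n q a) (T u) = form N (mon n q a) (T' u)"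
      using assms(1,2) u unfolding adj_def by (metis mon_closed)
    then show ?thesis using True N[OF True] by (simp add: form_mon)
  next
    case False
    then have "a \<notin> Poly_Mapping.keys (coord n q (T u))" "a \<notin> Poly_Mapping.keys (coord n q (T' u))"
      using coord_keys L_closed assms(3,4) u by blast+
    then show ?thesis by (simp add: in_keys_iff)
  qed
  then show "T u = T' u"
    using u assms(3,4) coord_lin_comb by (metis L_closed poly_mapping_eqI)
qed

lemma adjoint_eq:
  assumes "adj N S T" "T \<in> carrier L" "\<And>a. a \<in> mindices n \<Longrightarrow> N a \<noteq> 0"
  shows "adjoint n q (form N) S = T"
  unfolding adjoint_def
  by (rule the_equality) (use assms adj_unique in \<open>auto simp: adj_def\<close>)

text \<open>Passing to adjoints is linear and reverses products, so adjoints of the generators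
  inside the algebra produce adjoints of all its elements there.\<close>

lemma op_algebra_adjoint_closed:
  assumes G: "G \<subseteq> carrier L"
    and adj: "\<And>T. T \<in> G \<Longrightarrow> \<exists>T'\<in>op_algebra n q G. adj N T T'"
    and T: "T \<in> op_algebra n q G"
  shows "\<exists>T'\<in>op_algebra n q G. adj N T T'"
  using T G
proof (induction rule: op_algebra_induct)
  case (scalar_map c)
  have "scalar_map c \<in> op_algebra n q G" unfolding op_algebra_scalar_map by (auto intro: generate_ring.incl)
  then show ?case using adj_scalar_map by blast
next
  case (gen T)
  then show ?case by (rule adj)
next
  case (add S T)
  then obtain S' T' where "S' \<in> op_algebra n q G" "adj N S S'" "T' \<in> op_algebra n q G" "adj N T T'" by blast
  moreover from this have "S' \<oplus>\<^bsub>L\<^esub> T' \<in> op_algebra n q G"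
    unfolding op_algebra_scalar_map by (auto intro: generate_ring.eng_add)
  ultimately show ?case
    using add op_algebra_closed[OF G] by (meson adj_add subsetD)
next
  case (mult S T)
  then obtain S' T' where "S' \<in> op_algebra n q G" "adj N S S'" "T' \<in> op_algebra n q G" "adj N T T'" by blast
  moreover from this have "T' \<otimes>\<^bsub>L\<^esub> S' \<in> op_algebra n q G"
    unfolding op_algebra_scalar_map by (auto intro: generate_ring.eng_mult)
  ultimately show ?case
    using mult op_algebra_closed[OF G] by (meson adj_mult subsetD)
qed

section \<open>Weights of the two pairings\<close>

definition weight :: "(nat \<Rightarrow> complex) \<Rightarrow> mindex \<Rightarrow> complex" where
  "weight x a = (-1 / (q - inverse q)) ^ mindex_size n a *
     (\<Prod>i\<in>{1..n}. \<Prod>j\<in>{1..n}. \<Prod>k=1..Poly_Mapping.lookup a (i, j). x k)"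

lemma pairing_form:
  "pairing_L n q = form (weight (qint q))" "pairing_K n q = form (weight (cint q))"
  unfolding pairing_L_def pairing_K_def form_def weight_def qfact_def cfact_def by (rule refl)+

lemma weight_add:
  assumes "i \<in> {1..n}" "j \<in> {1..n}"
  shows "weight x (a + unit_index i j) = -1 / (q - inverse q) * x (Suc (Poly_Mapping.lookup a (i, j))) * weight x a"
proof -
  let ?U = "{1..n} \<times> {1..n}"
  have ij: "(i, j) \<in> ?U" using assms by simp
  have l: "Poly_Mapping.lookup (a + unit_index i j) p = Poly_Mapping.lookup a p + (if p = (i, j) then 1 else 0)" for p
    by (auto simp: lookup_add lookup_single when_def)
  have "mindex_size n b = (\<Sum>p\<in>?U. Poly_Mapping.lookup b p)" for b
    by (simp add: mindex_size_def sum.cartesian_product)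
  then have s: "mindex_size n (a + unit_index i j) = Suc (mindex_size n a)"
    using ij by (simp add: l sum.distrib del: One_nat_def)
  let ?F = "\<lambda>b p. \<Prod>k=1..Poly_Mapping.lookup b p. x k"
  have p: "(\<Prod>i\<in>{1..n}. \<Prod>j\<in>{1..n}. ?F b (i, j)) = (\<Prod>p\<in>?U. ?F b p)" for b
    by (simp add: prod.cartesian_product)
  have r: "(\<Prod>p\<in>?U. ?F b p) = ?F b (i, j) * (\<Prod>p\<in>?U - {(i, j)}. ?F b p)" for b
    using ij by (intro prod.remove) auto
  have "?F (a + unit_index i j) (i, j) = x (Suc (Poly_Mapping.lookup a (i, j))) * ?F a (i, j)"
    unfolding l by (simp add: prod.nat_ivl_Suc' mult.commute)
  moreover have "(\<Prod>p\<in>?U - {(i, j)}. ?F (a + unit_index i j) p) = (\<Prod>p\<in>?U - {(i, j)}. ?F a p)"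
    by (intro prod.cong refl) (simp add: l del: One_nat_def)
  ultimately show ?thesis
    unfolding weight_def s p r[of "a + unit_index i j"] r[of a] by simp
qed

text \<open>The weights at \<open>a + unit_index i j\<close> and \<open>a\<close> differ by the
  factor -x(a_ij + 1)/(q - q^-1). The condition relating \<open>d\<close> to \<open>c\<close>
  supplies x(a_ij + 1), and the scalar in front of \<open>T\<close> supplies the rest.\<close>

lemma adj_raise_lower:
  assumes ij: "i \<in> {1..n}" "j \<in> {1..n}"
    and S: "rep (shift_op (unit_expo (i, j)) c) S" and T: "rep (shift_op (- unit_expo (i, j)) d) T"
    and d: "\<And>a. d (embed (a + unit_index i j)) = c (embed a) * x (Suc (Poly_Mapping.lookup a (i, j)))"
    and z: "\<And>a. a \<in> mindices n \<Longrightarrow> Poly_Mapping.lookup a (i, j) = 0 \<Longrightarrow> d (embed a) = 0"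
  shows "adj (weight x) S (scalar_map (-1 / (q - inverse q)) \<otimes>\<^bsub>L\<^esub> T)"
proof (rule adj_rep[OF S rep_mult[OF rep_scalar_map T]])
  fix a b assume ab: "a \<in> mindices n" "b \<in> mindices n"
  let ?k = "-1 / (q - inverse q)"
  have e: "embed b = embed a + unit_expo (i, j) \<longleftrightarrow> b = a + unit_index i j"
    by (metis embed_add embed_inj)
  have "delta (embed a + unit_expo (i, j)) (embed b) = (if b = a + unit_index i j then 1 else 0)"
    by (simp add: delta_def e)
  moreover have "delta (embed b + - unit_expo (i, j)) (embed a) = (if b = a + unit_index i j then 1 else 0)"
    unfolding delta_def e[symmetric] by (auto simp: algebra_simps)
  ultimately show "weight x b * app (shift_op (unit_expo (i, j)) c) (delta (embed a)) (embed b) =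
      weight x a * app (scalar_op ?k * shift_op (- unit_expo (i, j)) d) (delta (embed b)) (embed a)"
    unfolding app_simps app_scalar_op app_shift_op_delta by (simp add: weight_add[OF ij] d del: One_nat_def)
qed

lemma subalgD:
  assumes "subalg C"
  shows subalg_scalar_op: "scalar_op c \<in> C" and subalg_add: "X \<in> C \<Longrightarrow> Y \<in> C \<Longrightarrow> X + Y \<in> C"
    and subalg_mult: "X \<in> C \<Longrightarrow> Y \<in> C \<Longrightarrow> X * Y \<in> C"
  using assms unfolding subalg_def by auto

lemma subalg_minus: "subalg C \<Longrightarrow> X \<in> C \<Longrightarrow> Y \<in> C \<Longrightarrow> X - Y \<in> C"
proof -
  assume C: "subalg C" and XY: "X \<in> C" "Y \<in> C"
  have "X - Y = X + scalar_op (- 1) * Y"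
    by (rule linop_eqI) (simp add: app_scalar_op fun_eq_iff)
  then show ?thesis using C XY by (simp only: subalgD)
qed

lemma subalg_sum: "subalg C \<Longrightarrow> (\<And>s. s \<in> S \<Longrightarrow> f s \<in> C) \<Longrightarrow> sum f S \<in> C"
proof (induction S rule: infinite_finite_induct)
  case (insert x S)
  then show ?case by (simp add: subalg_add)
qed (use subalg_scalar_op[of C 0] in \<open>simp_all add: shift_op_0\<close>)

lemma subalg_diag_op_sum:
  assumes C: "subalg C" and K: "finite K"
    and h: "\<And>k. k \<in> K \<Longrightarrow> diag_op (\<lambda>a. q powi (c * a (f k))) \<in> C"
  shows "diag_op (\<lambda>a. q powi (c * (\<Sum>k\<in>K. a (f k)))) \<in> C"
  using K h
proof (induction K rule: finite_induct)
  case empty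
  show ?case using subalg_scalar_op[OF C, of 1] by (simp only: sum.empty mult_zero_right power_int_0_right)
next
  case (insert k K)
  have "diag_op (\<lambda>a. q powi (c * a (f k))) \<in> C"
    by (rule insert.prems) (rule insertI1)
  moreover have "diag_op (\<lambda>a. q powi (c * (\<Sum>k\<in>K. a (f k)))) \<in> C"
    by (rule insert.IH) (rule insert.prems, rule insertI2)
  ultimately have "diag_op (\<lambda>a. q powi (c * a (f k))) * diag_op (\<lambda>a. q powi (c * (\<Sum>k\<in>K. a (f k)))) \<in> C"
    by (rule subalg_mult[OF C])
  moreover have "q powi (c * (\<Sum>k\<in>insert k K. a (f k))) = q powi (c * a (f k)) * q powi (c * (\<Sum>k\<in>K. a (f k)))" for a
    using insert(1,2) q0 by (simp add: distrib_left power_int_add)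
  ultimately show ?case
    by (simp only: diag_op_mult)
qed

end

subsection \<open>Generators of the operator algebras\<close>

locale generic_quantum_matrices = quantum_matrices +
  assumes generic: "\<forall>m::nat. m > 0 \<longrightarrow> q ^ m \<noteq> 1"
begin

section \<open>Identities between q-numbers\<close>

lemma qq_neq: "q - inverse q \<noteq> 0"
proof
  assume "q - inverse q = 0"
  then have "q ^ 2 = 1" using q0 by (simp add: power2_eq_square field_simps)
  then show False using generic[rule_format, of 2] by simp
qed

lemma cnum_alt: "cnum m = (q - q * q powi (- 2 * m)) / (q - inverse q)"
proof -
  have "q powi (1 - m) * q powi m = q" "q powi (1 - m) * q powi (- m) = q * q powi (- 2 * m)"
    using q0 power_int_add[of q "1 - m" m] power_int_add[of q "1 - m" "- m"] power_int_add[of q 1 "- 2 * m"]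
    by simp_all
  then show ?thesis
    unfolding cnum_def qnum_def by (simp add: right_diff_distrib)
qed

lemma powi_Suc2: "q powi (- 2 * (m + 1)) = q powi (- 2 * m) * inverse q * inverse q"
proof -
  have "- 2 * (m + 1) = - 2 * m + - 1 + - 1" by simp
  moreover have "q powi (x + y) = q powi x * q powi y" for x y
    using q0 by (simp add: power_int_add)
  ultimately show ?thesis
    by (simp only: power_int_minus1_right)
qed

lemma div_eqI: "x = y * (q - inverse q) \<Longrightarrow> x / (q - inverse q) = y"
  using qq_neq by simp

text \<open>{{m}} is a combination of 1 and q^(-2m); comparing neighbouring values in two ways
  isolates each of these terms.\<close>

lemma cnum_step: "cnum (m + 1) - cnum m = q powi (- 2 * m)" "cnum (m + 1) - inverse q * inverse q * cnum m = 1"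
proof -
  have r: "q * (x * inverse q * inverse q) = x * inverse q" "inverse q * inverse q * (q - q * x) = inverse q - x * inverse q" for x
    using q0 by (simp_all add: field_simps)
  show "cnum (m + 1) - cnum m = q powi (- 2 * m)" "cnum (m + 1) - inverse q * inverse q * cnum m = 1"
    unfolding cnum_alt powi_Suc2 r times_divide_eq_right diff_divide_distrib[symmetric]
    by (rule div_eqI, simp add: algebra_simps)+
qed

lemma cnum_0: "cnum 0 = 0"
  by (simp add: cnum_alt)

lemma cint_cnum: "cint q m = cnum (int m)"
proof (induction m)
  case 0
  then show ?case by (simp add: cint_def cnum_0)
next
  case (Suc m)
  have "q powi (- 2 * int m) = inverse (q powi int (2 * m))"
    by (simp add: power_int_minus)
  also have "\<dots> = inverse q ^ (2 * m)"
    by (simp only: power_int_of_nat power_inverse)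
  finally have "inverse q ^ (2 * m) = q powi (- 2 * int m)" ..
  moreover have "cint q (Suc m) = cint q m + inverse q ^ (2 * m)"
    by (simp add: cint_def)
  ultimately show ?case
    using Suc cnum_step(1)[of "int m"] by (simp add: add.commute algebra_simps)
qed

lemma qnum_0: "qnum 0 = 0"
  by (simp add: qnum_def)

lemma qnum_nonzero: "m \<ge> 1 \<Longrightarrow> qnum (int m) \<noteq> 0"
proof
  assume m: "m \<ge> 1" and "qnum (int m) = 0"
  then have "q ^ m = inverse (q ^ m)" using qq_neq by (simp add: qnum_def power_int_minus)
  then have "q ^ (m + m) = 1" unfolding power_add using q0 by (simp add: field_simps)
  then show False using generic[rule_format, of "m + m"] m by simp
qed

text \<open>[m] is a combination of q^m and q^-m; each is isolated from two neighbouring values,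
  which is how H and its inverse arise from M and D.\<close>

lemma qnum_step: "qnum (m + 1) - q * qnum m = q powi (- m)" "qnum (m + 1) - inverse q * qnum m = q powi m"
proof -
  have e: "q powi (m + 1) = q powi m * q" "q powi (- (m + 1)) = q powi (- m) * inverse q"
    using q0 power_int_add[of q m 1] power_int_diff[of q "- m" 1] by (simp_all add: divide_inverse)
  show "qnum (m + 1) - q * qnum m = q powi (- m)" "qnum (m + 1) - inverse q * qnum m = q powi m"
    unfolding qnum_def e times_divide_eq_right diff_divide_distrib[symmetric]
    by (rule div_eqI, simp add: algebra_simps)+
qed

lemma weight_nonzero:
  shows "weight (qint q) a \<noteq> 0" "weight (cint q) a \<noteq> 0"
proof -
  have "qint q k \<noteq> 0" "cint q k \<noteq> 0" if "1 \<le> k" for k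
    using qnum_nonzero[OF that] q0 by (simp_all add: qint_qnum cint_cnum cnum_def)
  then show "weight (qint q) a \<noteq> 0" "weight (cint q) a \<noteq> 0"
    using qq_neq by (auto simp: weight_def)
qed

section \<open>Diagonal operators in the algebra of V^SE M and V^SE D\<close>

definition se_raise :: "nat \<Rightarrow> nat \<Rightarrow> linop" where
  "se_raise i j = shift_op (unit_expo (i, j)) (\<lambda>a. q powi se_sum i j a)"

definition se_lower :: "nat \<Rightarrow> nat \<Rightarrow> linop" where
  "se_lower i j = shift_op (- unit_expo (i, j)) (\<lambda>a. q powi se_sum i j a * cnum (a (i, j)))"

text \<open>V^SE_ij involves only cells strictly below or to the right of \<open>(i, j)\<close>, so
  it commutes with raising and lowering at \<open>(i, j)\<close>.\<close>

lemma se_sum_shift: "se_sum i j (a + unit_expo (i, j)) = se_sum i j a" "se_sum i j (a + - unit_expo (i, j)) = se_sum i j a"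
  unfolding se_sum_def by (intro arg_cong2[where f = "(+)"] sum.cong refl; simp add: unit_expo_def)+

lemma unit_expo_at: "(a + unit_expo p) p = a p + 1" "(a + - unit_expo p) p = a p - 1"
  by (simp_all add: unit_expo_def)

lemma se_lower_se_raise: "se_lower i j * se_raise i j = diag_op (\<lambda>a. q powi se_sum i j a * q powi se_sum i j a * cnum (a (i, j) + 1))"
  unfolding se_lower_def se_raise_def shift_op_mult se_sum_shift unit_expo_at by (simp add: mult_ac)

lemma se_raise_se_lower: "se_raise i j * se_lower i j = diag_op (\<lambda>a. q powi se_sum i j a * q powi se_sum i j a * cnum (a (i, j)))"
  unfolding se_lower_def se_raise_def shift_op_mult se_sum_shift by (simp add: mult_ac)

lemma powi_double: "q powi (2 * m) = q powi m * q powi m" "q powi (- 2 * m) = inverse (q powi m * q powi m)"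
  "q powi - (2 * m) = inverse (q powi m * q powi m)"
  using q0 power_int_add[of q m m] power_int_minus[of q "2 * m"] by simp_all

lemma scalar_op_diag_op: "scalar_op k * diag_op c = diag_op (\<lambda>a. k * c a)"
  by (simp add: shift_op_mult)

text \<open>Raising and then lowering gives V^2 {{a_ij + 1}}, the opposite order V^2 {{a_ij}}; the
  two differences in \<open>cnum_step\<close> leave V^2 and V^2 H^-2.\<close>

lemma square_in_subalg:
  assumes C: "subalg C" and V: "se_raise i j \<in> C" "se_lower i j \<in> C"
  shows "diag_op (\<lambda>a. q powi (2 * se_sum i j a)) \<in> C"
    and "diag_op (\<lambda>a. q powi (2 * se_sum i j a) * q powi (- 2 * a (i, j))) \<in> C"
proof -
  have "se_lower i j * se_raise i j - scalar_op (inverse q * inverse q) * (se_raise i j * se_lower i j) \<in> C"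
    using V by (intro subalg_minus[OF C] subalg_mult[OF C] subalg_scalar_op[OF C])
  moreover have "se_lower i j * se_raise i j - scalar_op (inverse q * inverse q) * (se_raise i j * se_lower i j) = diag_op (\<lambda>a. q powi (2 * se_sum i j a))"
  proof -
    have "x * cnum (m + 1) - inverse q * inverse q * (x * cnum m) = x" for x m
    proof -
      have "x * cnum (m + 1) - inverse q * inverse q * (x * cnum m) = x * (cnum (m + 1) - inverse q * inverse q * cnum m)"
        by (simp add: algebra_simps)
      then show ?thesis by (simp only: cnum_step(2) mult_1_right)
    qed
    then show ?thesis by (simp only: se_lower_se_raise se_raise_se_lower scalar_op_diag_op shift_op_minus powi_double)
  qed
  ultimately show "diag_op (\<lambda>a. q powi (2 * se_sum i j a)) \<in> C" by (simp only:)
  have "se_lower i j * se_raise i j - se_raise i j * se_lower i j \<in> C"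
    using V by (intro subalg_minus[OF C] subalg_mult[OF C])
  moreover have "se_lower i j * se_raise i j - se_raise i j * se_lower i j = diag_op (\<lambda>a. q powi (2 * se_sum i j a) * q powi (- 2 * a (i, j)))"
    by (simp only: se_lower_se_raise se_raise_se_lower shift_op_minus powi_double(1) cnum_step(1) right_diff_distrib[symmetric])
  ultimately show "diag_op (\<lambda>a. q powi (2 * se_sum i j a) * q powi (- 2 * a (i, j))) \<in> C" by (simp only:)
qed

lemma diag_op_se_sum:
  assumes C: "subalg C"
    and "\<And>k. i < k \<Longrightarrow> k \<le> n \<Longrightarrow> diag_op (\<lambda>a. q powi (c * a (k, j))) \<in> C"
    and "\<And>s. j < s \<Longrightarrow> s \<le> n \<Longrightarrow> diag_op (\<lambda>a. q powi (c * a (i, s))) \<in> C"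
  shows "diag_op (\<lambda>a. q powi (c * se_sum i j a)) \<in> C"
proof -
  have "diag_op (\<lambda>a. q powi (c * (\<Sum>k\<in>{i<..n}. a (k, j)))) * diag_op (\<lambda>a. q powi (c * (\<Sum>s\<in>{j<..n}. a (i, s)))) \<in> C"
    using assms(2,3) by (intro subalg_mult[OF C] subalg_diag_op_sum[OF C]) auto
  moreover have "q powi (c * se_sum i j a) = q powi (c * (\<Sum>k\<in>{i<..n}. a (k, j))) * q powi (c * (\<Sum>s\<in>{j<..n}. a (i, s)))" for a
    using q0 by (simp add: se_sum_def distrib_left power_int_add)
  ultimately show ?thesis by (simp only: diag_op_mult)
qed

text \<open>Induction away from the lower right corner: (V^SE_ij)^-2 is a product of factors H^-2 at
  cells already treated, and it strips V^2 from V^2 H^-2. The bound \<open>m\<close> restricts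
  everything to the columns from \<open>m\<close> on, as needed for a descent over columns.\<close>

lemma inv_square_in_subalg:
  assumes C: "subalg C"
    and V: "\<And>i j. i \<in> {1..n} \<Longrightarrow> j \<in> {m..n} \<Longrightarrow> se_raise i j \<in> C \<and> se_lower i j \<in> C"
  shows "i \<in> {1..n} \<Longrightarrow> j \<in> {m..n} \<Longrightarrow>
    diag_op (\<lambda>a. q powi (- 2 * a (i, j))) \<in> C \<and> diag_op (\<lambda>a. q powi (- 2 * se_sum i j a)) \<in> C"
proof (induction "(n - i) + (n - j)" arbitrary: i j rule: less_induct)
  case less
  have k: "diag_op (\<lambda>a. q powi (- 2 * a (k, j))) \<in> C" if "i < k" "k \<le> n" for k
    using less.hyps[of k j] less.prems that by auto
  have s: "diag_op (\<lambda>a. q powi (- 2 * a (i, s))) \<in> C" if "j < s" "s \<le> n" for s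
    using less.hyps[of i s] less.prems that by auto
  have v: "diag_op (\<lambda>a. q powi (- 2 * se_sum i j a)) \<in> C"
    using k s by (rule diag_op_se_sum[OF C])
  have "diag_op (\<lambda>a. q powi (2 * se_sum i j a) * q powi (- 2 * a (i, j))) * diag_op (\<lambda>a. q powi (- 2 * se_sum i j a)) \<in> C"
    using V[OF less.prems] by (intro subalg_mult[OF C] square_in_subalg(2)[OF C] v) auto
  moreover have "q powi (2 * se_sum i j a) * q powi (- 2 * a (i, j)) * q powi (- 2 * se_sum i j a) = q powi (- 2 * a (i, j))" for a
    using q0 by (simp add: powi_double field_simps)
  ultimately show ?case using v by (simp only: diag_op_mult)
qed

text \<open>H_ij^2 is a factor of (V^SE)^2 at the neighbour above or, in the first row, to the left;
  the other factors are removed by the squares H^-2 already available. The cell (1,1) has no such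
  neighbour.\<close>

lemma square_in_subalg':
  assumes C: "subalg C"
    and V: "\<And>i j. i \<in> {1..n} \<Longrightarrow> j \<in> {1..n} \<Longrightarrow> se_raise i j \<in> C \<and> se_lower i j \<in> C"
    and ij: "i \<in> {1..n}" "j \<in> {1..n}" "(i, j) \<noteq> (1, 1)"
  shows "diag_op (\<lambda>a. q powi (2 * a (i, j))) \<in> C"
proof -
  have h: "diag_op (\<lambda>a. q powi (- 2 * a (k, s))) \<in> C" if "k \<in> {1..n}" "s \<in> {1..n}" for k s
    using inv_square_in_subalg[OF C V, of 1 k s] that by auto
  have sums: "diag_op (\<lambda>a. q powi (- 2 * (\<Sum>k\<in>{i<..n}. a (k, s)))) \<in> C" "diag_op (\<lambda>a. q powi (- 2 * (\<Sum>s\<in>{j<..n}. a (k, s)))) \<in> C"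
    if "k \<in> {1..n}" "s \<in> {1..n}" for k s
    using that ij by (intro subalg_diag_op_sum[OF C] h; auto)+
  show ?thesis
  proof (cases "i > 1")
    case True
    then obtain i' where i': "i = Suc i'" "i' \<in> {1..n}" using ij by (cases i) auto
    have e: "{i'<..n} = insert i {i<..n}" using ij i' by auto
    have "diag_op (\<lambda>a. q powi (2 * se_sum i' j a)) * diag_op (\<lambda>a. q powi (- 2 * (\<Sum>k\<in>{i<..n}. a (k, j))))
        * diag_op (\<lambda>a. q powi (- 2 * (\<Sum>s\<in>{j<..n}. a (i', s)))) \<in> C"
      using V[OF i'(2) ij(2)] i' ij by (intro subalg_mult[OF C] square_in_subalg(1)[OF C] sums) auto
    moreover have "q powi (2 * se_sum i' j a) * q powi (- 2 * (\<Sum>k\<in>{i<..n}. a (k, j))) * q powi (- 2 * (\<Sum>s\<in>{j<..n}. a (i', s)))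
       = q powi (2 * a (i, j))" for a
      using q0 by (simp add: se_sum_def e powi_double power_int_add field_simps)
    ultimately show ?thesis by (simp only: diag_op_mult)
  next
    case False
    then obtain j' where j': "j = Suc j'" "j' \<in> {1..n}" using ij by (cases j) auto
    have e: "{j'<..n} = insert j {j<..n}" using ij j' by auto
    have "diag_op (\<lambda>a. q powi (2 * se_sum i j' a)) * diag_op (\<lambda>a. q powi (- 2 * (\<Sum>k\<in>{i<..n}. a (k, j'))))
        * diag_op (\<lambda>a. q powi (- 2 * (\<Sum>s\<in>{j<..n}. a (i, s)))) \<in> C"
      using V[OF ij(1) j'(2)] j' ij by (intro subalg_mult[OF C] square_in_subalg(1)[OF C] sums) auto
    moreover have "q powi (2 * se_sum i j' a) * q powi (- 2 * (\<Sum>k\<in>{i<..n}. a (k, j'))) * q powi (- 2 * (\<Sum>s\<in>{j<..n}. a (i, s)))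
       = q powi (2 * a (i, j))" for a
      using q0 by (simp add: se_sum_def e powi_double power_int_add field_simps)
    ultimately show ?thesis by (simp only: diag_op_mult)
  qed
qed

text \<open>
  Multiplying \<open>right_op n q t i j\<close> by \<open>H\<^sub>i\<^sub>u\<close> for all \<open>u > t\<close> absorbs the cost of passing unchanged, so that
  the recursion over columns involves only products of the generators \<open>V\<^sup>S\<^sup>E M\<^sup>o\<close> and \<open>V\<^sup>S\<^sup>E \<D>\<^sup>o\<close>, and \<open>(V\<^sup>S\<^sup>E)\<^sup>-\<^sup>2\<close>.
\<close>

definition row_diag :: "nat \<Rightarrow> nat \<Rightarrow> linop" where
  "row_diag i t = diag_op (\<lambda>a. q powi (\<Sum>u\<in>{t<..n}. a (i, u)))"

definition partial_op :: "nat \<Rightarrow> nat \<Rightarrow> nat \<Rightarrow> linop" where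
  "partial_op t i j = row_diag i t * right_op n q t i j"

text \<open>The inverse square turns the factor V^SE_st inside \<open>se_lower\<close> into its
  inverse, which cancels the cells below and to the right of \<open>(s, t)\<close> against V^SE_it
  and the row factor that follows. The constant clears the denominator of {{a}} = (1 - q^(-2a))/(1 -
  q^-2).\<close>

definition jump_op :: "nat \<Rightarrow> nat \<Rightarrow> nat \<Rightarrow> linop" where
  "jump_op i s t = scalar_op (1 - inverse q * inverse q) * (se_raise i t * diag_op (\<lambda>a. q powi (- 2 * se_sum s t a)) * se_lower s t)"

lemma row_diag_col_op_diag:
  assumes "i \<le> n" "Suc t \<le> n"
  shows "row_diag i (Suc t) * col_op n q (Suc t) i i = row_diag i t"
proof -
  have e: "{t<..n} = insert (Suc t) {Suc t<..n}" using assms by auto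
  show ?thesis
    unfolding row_diag_def col_op_def shift_op_mult diff_self add_0_right using assms q0
    by (simp add: col_coeff_def e power_int_add mult.commute)
qed

lemma row_diag_col_op:
  assumes "1 \<le> i" "i < s" "s \<le> n" "Suc t \<le> n"
  shows "row_diag i (Suc t) * col_op n q (Suc t) i s = jump_op i s (Suc t) * row_diag s t"
proof -
  let ?T = "Suc t"
  have e: "{t<..n} = insert ?T {?T<..n}" using assms by auto
  have i: "{i<..n} = {i<..<s} \<union> insert s {s<..n}" using assms by auto
  have svi: "se_sum i ?T a = (\<Sum>k\<in>{i<..<s}. a (k, ?T)) + (a (s, ?T) + (\<Sum>k\<in>{s<..n}. a (k, ?T))) + (\<Sum>u\<in>{?T<..n}. a (i, u))" for a
    unfolding se_sum_def i by (subst sum.union_disjoint) auto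
  have A: "(\<Sum>u\<in>{?T<..n}. (a + (unit_expo (i, ?T) - unit_expo (s, ?T))) (i, u)) = (\<Sum>u\<in>{?T<..n}. a (i, u))" for a
    by (intro sum.cong refl) (simp add: unit_expo_def)
  have B: "(\<Sum>k\<in>{i<..<s}. (a + - unit_expo (s, ?T)) (k, ?T)) = (\<Sum>k\<in>{i<..<s}. a (k, ?T))" for a
    by (intro sum.cong refl) (simp add: unit_expo_def)
  have B': "(\<Sum>k\<in>{s<..n}. (a + - unit_expo (s, ?T)) (k, ?T)) = (\<Sum>k\<in>{s<..n}. a (k, ?T))" for a
    by (intro sum.cong refl) (simp add: unit_expo_def)
  have B'': "(\<Sum>u\<in>{?T<..n}. (a + - unit_expo (s, ?T)) (i, u)) = (\<Sum>u\<in>{?T<..n}. a (i, u))" for a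
    by (intro sum.cong refl) (simp add: unit_expo_def)
  \<comment> \<open>The lowering acts first and removes one factor in row \<open>s\<close>, which
    lies below row \<open>i\<close> in the same column; the resulting q^-1 is the one in
    \<open>lower_coeff\<close>.\<close>
  have sv': "se_sum i ?T (a + - unit_expo (s, ?T)) = se_sum i ?T a - 1" for a
    unfolding svi B B' B'' unit_expo_at by simp
  have "row_diag i ?T * col_op n q ?T i s = shift_op (unit_expo (i, ?T) - unit_expo (s, ?T))
     (\<lambda>a. q powi (\<Sum>u\<in>{?T<..n}. a (i, u)) * col_coeff n q ?T i s a)"
    using assms unfolding row_diag_def col_op_def shift_op_mult by (simp only: row_unit_def A add_0_left less_imp_le if_True)
  also have "\<dots> = shift_op (unit_expo (i, ?T) - unit_expo (s, ?T)) (\<lambda>a. (1 - inverse q * inverse q) *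
     (q powi (se_sum i ?T a - 1) * q powi (- 2 * se_sum s ?T a) * (q powi se_sum s ?T a * cnum (a (s, ?T)))) *
     q powi (\<Sum>u\<in>{t<..n}. a (s, u)))"
  proof (rule arg_cong[of _ _ "shift_op _"], rule ext)
    fix a
    define x where "x = q powi a (s, ?T)"
    have x: "x \<noteq> 0" using q0 by (simp add: x_def)
    have c: "cnum (a (s, ?T)) = (q - q * inverse (x * x)) / (q - inverse q)"
      unfolding cnum_alt x_def powi_double ..
    show "q powi (\<Sum>u\<in>{?T<..n}. a (i, u)) * col_coeff n q ?T i s a = (1 - inverse q * inverse q) *
     (q powi (se_sum i ?T a - 1) * q powi (- 2 * se_sum s ?T a) * (q powi se_sum s ?T a * cnum (a (s, ?T)))) *
     q powi (\<Sum>u\<in>{t<..n}. a (s, u))"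
      unfolding powi_double c using assms q0 qq_neq x
      by (simp add: col_coeff_def lower_coeff_def svi se_sum_def[of s] e power_int_add power_int_diff x_def[symmetric])
        (simp add: field_simps)
  qed
  also have "\<dots> = jump_op i s ?T * row_diag s t"
    unfolding jump_op_def se_raise_def se_lower_def row_diag_def
    unfolding shift_op_mult se_sum_shift sv' by (simp add: se_sum_shift(2)[unfolded add_uminus_conv_diff] sv'[unfolded add_uminus_conv_diff])
  finally show ?thesis .
qed

lemma partial_op_step:
  assumes "1 \<le> i" "i \<le> n" "j \<le> t" "Suc t \<le> n"
  shows "partial_op (Suc t) i j = partial_op t i j + (\<Sum>s\<in>{i<..n}. jump_op i s (Suc t) * partial_op t s j)"
proof -
  have "row_diag i (Suc t) * (col_op n q (Suc t) i s * right_op n q t s j) = jump_op i s (Suc t) * partial_op t s j" if "s \<in> {i<..n}" for s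
    using row_diag_col_op[of i s t] assms that by (simp add: partial_op_def mult.assoc[symmetric])
  moreover have "row_diag i (Suc t) * (col_op n q (Suc t) i i * right_op n q t i j) = partial_op t i j"
    using row_diag_col_op_diag[of i t] assms by (simp add: partial_op_def mult.assoc[symmetric])
  ultimately show ?thesis
    unfolding partial_op_def[of "Suc t"] right_op_step[OF assms(1-3)] distrib_left sum_distrib_left by simp
qed

lemma partial_op_first: "i \<le> n \<Longrightarrow> 1 \<le> j \<Longrightarrow> partial_op j i j = se_raise i j"
proof -
  assume "i \<le> n" "1 \<le> j"
  have "(\<Sum>u\<in>{j<..n}. (a + unit_expo (i, j)) (i, u)) = (\<Sum>u\<in>{j<..n}. a (i, u))" for a
    by (intro sum.cong refl) (simp add: unit_expo_def)
  then show ?thesis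
    unfolding partial_op_def right_op_first[OF \<open>i \<le> n\<close> \<open>1 \<le> j\<close>] row_diag_def se_raise_def shift_op_mult se_sum_def
    using q0 by (simp only: add_0_left power_int_add) (simp add: power_int_add mult.commute)
qed

lemma partial_op_last: "partial_op n i j = right_op n q n i j"
  unfolding partial_op_def row_diag_def by (simp add: scalar_op_1)

lemma jump_op_in_subalg:
  assumes C: "subalg C"
    and V: "\<And>i j. i \<in> {1..n} \<Longrightarrow> j \<in> {m..n} \<Longrightarrow> se_raise i j \<in> C \<and> se_lower i j \<in> C"
    and "i \<in> {1..n}" "s \<in> {1..n}" "t \<in> {m..n}"
  shows "jump_op i s t \<in> C"
  unfolding jump_op_def using inv_square_in_subalg[OF C V, of m s t] V assms(3-)
  by (intro subalg_mult[OF C] subalg_scalar_op[OF C]) auto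

text \<open>The recursion starts at \<open>se_raise i j\<close> in column \<open>j\<close>, uses
  jumps in the later columns, and ends in column \<open>n\<close>, where the row factor is
  trivial.\<close>

lemma right_op_in_subalg:
  assumes C: "subalg C"
    and V: "\<And>i j. i \<in> {1..n} \<Longrightarrow> j \<in> {1..n} \<Longrightarrow> se_raise i j \<in> C \<and> se_lower i j \<in> C"
    and ij: "i \<in> {1..n}" "j \<in> {1..n}"
  shows "right_op n q n i j \<in> C"
proof -
  have Z: "t \<le> n \<Longrightarrow> \<forall>i\<in>{1..n}. partial_op t i j \<in> C" if "j \<le> t" for t
    using that
  proof (induction t rule: dec_induct)
    case base
    then show ?case using V ij by (auto simp: partial_op_first)
  next
    case (step t)
    show ?case
    proof
      fix i assume i: "i \<in> {1..n}"
      have "partial_op t i j + (\<Sum>s\<in>{i<..n}. jump_op i s (Suc t) * partial_op t s j) \<in> C"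
        using i ij step by (intro subalg_add[OF C] subalg_sum[OF C] subalg_mult[OF C] jump_op_in_subalg[OF C V, of 1]) auto
      then show "partial_op (Suc t) i j \<in> C"
        using i step ij by (simp add: partial_op_step)
    qed
  qed
  show ?thesis using Z[of n] ij by (simp add: partial_op_last)
qed

text \<open>The same recursion read backwards, from column \<open>n\<close> to \<open>j\<close>. In
  each column the rows are treated from \<open>n\<close> upwards, since the corrections for row
  \<open>i\<close> involve only rows below it. Only jumps in columns after \<open>j\<close> occur,
  which permits an outer descent over \<open>j\<close>.\<close>

lemma se_raise_in_subalg:
  assumes C: "subalg C" and j: "j \<in> {1..n}"
    and V: "\<And>i t. i \<in> {1..n} \<Longrightarrow> t \<in> {Suc j..n} \<Longrightarrow> se_raise i t \<in> C \<and> se_lower i t \<in> C"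
    and Y: "\<And>i. i \<in> {1..n} \<Longrightarrow> right_op n q n i j \<in> C"
    and i: "i \<in> {1..n}"
  shows "se_raise i j \<in> C"
proof -
  have "j \<le> t \<Longrightarrow> \<forall>i\<in>{1..n}. partial_op t i j \<in> C" if "t \<le> n" for t
    using that
  proof (induction t rule: inc_induct)
    case base
    then show ?case using Y by (simp add: partial_op_last)
  next
    case (step t)
    have "i \<in> {1..n} \<Longrightarrow> partial_op t i j \<in> C" for i
    proof (induction "n - i" arbitrary: i rule: less_induct)
      case less
      have "partial_op (Suc t) i j - (\<Sum>s\<in>{i<..n}. jump_op i s (Suc t) * partial_op t s j) \<in> C"
        using less step j
        by (intro subalg_minus[OF C] subalg_sum[OF C] subalg_mult[OF C] jump_op_in_subalg[OF C V, of "Suc j"]) auto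
      then show ?case using less.prems step by (simp add: partial_op_step)
    qed
    then show ?case ..
  qed
  from this[of j] show ?thesis using i j by (simp add: partial_op_first)
qed


section \<open>Comparison of the generated algebras\<close>

abbreviation kappa :: complex where
  "kappa \<equiv> -1 / (q - inverse q)"

lemma op_algebra_closure:
  shows op_algebra_scalar_map_mem: "scalar_map c \<in> op_algebra n q G"
    and op_algebra_mult: "S \<in> op_algebra n q G \<Longrightarrow> T \<in> op_algebra n q G \<Longrightarrow> S \<otimes>\<^bsub>L\<^esub> T \<in> op_algebra n q G"
  unfolding op_algebra_scalar_map by (auto intro: generate_ring.intros)

lemma scalar_map_mult: "scalar_map c \<otimes>\<^bsub>L\<^esub> scalar_map d = scalar_map (c * d)"
  by (rule rep_unique[OF rep_mult[OF rep_scalar_map rep_scalar_map]]) (simp only: scalar_op_mult[symmetric] rep_scalar_map)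

lemma scalar_map_cancel:
  assumes "T \<in> carrier L"
  shows "scalar_map (inverse kappa) \<otimes>\<^bsub>L\<^esub> (scalar_map kappa \<otimes>\<^bsub>L\<^esub> T) = T"
proof -
  have "scalar_map 1 = \<one>\<^bsub>L\<^esub>" by (rule rep_unique[OF rep_scalar_map]) (simp add: scalar_op_1 rep_one)
  moreover have "inverse kappa * kappa = 1" by (rule left_inverse) (use qq_neq in simp)
  ultimately show ?thesis
    using assms by (simp only: L.m_assoc[symmetric] scalar_map_closed scalar_map_mult L.l_one)
qed

text \<open>Common to both pairings, with raising generators \<open>R\<close> and lowering
  generators \<open>Lw\<close>. Both algebras are closed under adjoints; so \<open>conv\<close>,
  which carries the harder inclusion, may pass from a raising operator to its lowering partner as
  soon as the former has been found.\<close>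

lemma D_alg_eq:
  fixes R Lw :: "nat \<Rightarrow> nat \<Rightarrow> ncpoly set \<Rightarrow> ncpoly set"
  defines "G \<equiv> {Lw i j | i j. i \<in> {1..n} \<and> j \<in> {1..n}} \<union> {R i j | i j. i \<in> {1..n} \<and> j \<in> {1..n}}"
  assumes c: "\<And>i j. \<lbrakk>i \<in> {1..n}; j \<in> {1..n}\<rbrakk> \<Longrightarrow> R i j \<in> carrier L \<and> Lw i j \<in> carrier L"
    and adj: "\<And>i j. \<lbrakk>i \<in> {1..n}; j \<in> {1..n}\<rbrakk> \<Longrightarrow> adj N (R i j) (scalar_map kappa \<otimes>\<^bsub>L\<^esub> Lw i j)"
    and N: "\<And>a. N a \<noteq> 0"
    and Y: "\<And>i j. \<lbrakk>i \<in> {1..n}; j \<in> {1..n}\<rbrakk> \<Longrightarrow> right_op n q n i j \<in> pull (op_algebra n q G)"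
    and conv: "\<And>D i j. \<lbrakk>subalg (pull D); \<And>i j. i \<in> {1..n} \<Longrightarrow> j \<in> {1..n} \<Longrightarrow> right_op n q n i j \<in> pull D;
        \<And>i j. i \<in> {1..n} \<Longrightarrow> j \<in> {1..n} \<Longrightarrow> R i j \<in> D \<Longrightarrow> Lw i j \<in> D; i \<in> {1..n}; j \<in> {1..n}\<rbrakk> \<Longrightarrow> R i j \<in> D"
  shows "D_alg n q (form N) = op_algebra n q G"
proof
  have G: "G \<subseteq> carrier L" using c unfolding G_def by blast
  have GG: "R i j \<in> op_algebra n q G" "Lw i j \<in> op_algebra n q G" if "i \<in> {1..n}" "j \<in> {1..n}" for i j
    using that op_algebra_incl[of G] unfolding G_def by blast+
  have G_adj: "\<exists>T'\<in>op_algebra n q G. adj N T T'" if "T \<in> op_algebra n q G" for T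
  proof (rule op_algebra_adjoint_closed[OF G _ that])
    fix T assume "T \<in> G"
    then obtain i j where ij: "i \<in> {1..n}" "j \<in> {1..n}" "T = Lw i j \<or> T = R i j"
      unfolding G_def by blast
    show "\<exists>T'\<in>op_algebra n q G. adj N T T'"
      using ij(3)
    proof
      assume "T = R i j"
      moreover have "scalar_map kappa \<otimes>\<^bsub>L\<^esub> Lw i j \<in> op_algebra n q G"
        using ij GG by (intro op_algebra_mult op_algebra_scalar_map_mem)
      ultimately show ?thesis using adj ij by blast
    next
      assume "T = Lw i j"
      then have "adj N T (R i j \<otimes>\<^bsub>L\<^esub> scalar_map (inverse kappa))"
        using adj_mult[OF adj_scalar_map adj_sym[OF adj[OF ij(1,2)]] scalar_map_closed, of "inverse kappa"] c[OF ij(1,2)]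
        by (simp only: scalar_map_cancel scalar_map_closed L_ops_closed)
      moreover have "R i j \<otimes>\<^bsub>L\<^esub> scalar_map (inverse kappa) \<in> op_algebra n q G"
        using ij GG by (intro op_algebra_mult op_algebra_scalar_map_mem)
      ultimately show ?thesis by blast
    qed
  qed
  let ?m = "\<lambda>i j. right_mult n q (gen n q i j)"
  let ?GD = "{adjoint n q (form N) (?m i j) | i j. i \<in> {1..n} \<and> j \<in> {1..n}} \<union> {?m i j | i j. i \<in> {1..n} \<and> j \<in> {1..n}}"
  let ?D = "op_algebra n q ?GD"
  have D: "D_alg n q (form N) = ?D" unfolding D_alg_def ..
  have m: "?m i j \<in> op_algebra n q G" if "i \<in> {1..n}" "j \<in> {1..n}" for i j
    using Y[OF that] rep_right_mult[OF that] by (simp add: pull_iff)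
  \<comment> \<open>A right multiplication lies in the algebra of \<open>G\<close>, which is closed
    under adjoints; so its adjoint exists and, by uniqueness, is the operator described by
    \<open>adjoint\<close>.\<close>
  have ad: "adjoint n q (form N) (?m i j) \<in> op_algebra n q G \<and> adj N (?m i j) (adjoint n q (form N) (?m i j))"
    if "i \<in> {1..n}" "j \<in> {1..n}" for i j
  proof -
    have "\<exists>T\<in>op_algebra n q G. adj N (?m i j) T" by (rule G_adj[OF m[OF that]])
    then obtain T where T: "T \<in> op_algebra n q G" "adj N (?m i j) T" by blast
    moreover have "T \<in> carrier L" using T op_algebra_closed[OF G] by blast
    ultimately show ?thesis using adjoint_eq[of N "?m i j" T] N by simp
  qed
  have sub: "?GD \<subseteq> op_algebra n q G" using m ad by blast
  then show "D_alg n q (form N) \<subseteq> op_algebra n q G"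
    unfolding D by (rule op_algebra_least[OF _ G])
  have GD: "?GD \<subseteq> carrier L" using sub op_algebra_closed[OF G] by blast
  have GD_in: "?m i j \<in> ?D" "adjoint n q (form N) (?m i j) \<in> ?D" if "i \<in> {1..n}" "j \<in> {1..n}" for i j
    using that op_algebra_incl[of ?GD] by blast+
  \<comment> \<open>The generators come in adjoint pairs, and the relation \<open>adj\<close> is
    symmetric.\<close>
  have D_adj: "\<exists>T'\<in>?D. adj N T T'" if "T \<in> ?D" for T
  proof (rule op_algebra_adjoint_closed[OF GD _ that])
    fix T assume "T \<in> ?GD"
    then obtain i j where ij: "i \<in> {1..n}" "j \<in> {1..n}" "T = adjoint n q (form N) (?m i j) \<or> T = ?m i j"
      by blast
    then show "\<exists>T'\<in>?D. adj N T T'"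
      using ad[OF ij(1,2)] adj_sym GD_in[OF ij(1,2)] by blast
  qed
  have lower: "Lw i j \<in> ?D" if "i \<in> {1..n}" "j \<in> {1..n}" "R i j \<in> ?D" for i j
  proof -
    have "\<exists>T\<in>?D. adj N (R i j) T" by (rule D_adj[OF that(3)])
    then obtain T where T: "T \<in> ?D" "adj N (R i j) T" by blast
    then have "T \<in> carrier L" using op_algebra_closed[OF GD] by blast
    \<comment> \<open>Uniqueness of adjoints identifies the abstract \<open>T\<close> with the known
      multiple of the lowering operator.\<close>
    then have "T = scalar_map kappa \<otimes>\<^bsub>L\<^esub> Lw i j"
      using T adj[OF that(1,2)] c[OF that(1,2)] N by (intro adj_unique[of N "R i j"] L_ops_closed scalar_map_closed) auto
    then have "Lw i j = scalar_map (inverse kappa) \<otimes>\<^bsub>L\<^esub> T"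
      using c[OF that(1,2)] by (simp only: scalar_map_cancel)
    then show ?thesis
      using T(1) by (simp only: op_algebra_mult op_algebra_scalar_map_mem)
  qed
  have raise: "R i j \<in> ?D" if "i \<in> {1..n}" "j \<in> {1..n}" for i j
  proof (rule conv[OF subalg_pull _ lower that])
    show "right_op n q n i j \<in> pull ?D" if "i \<in> {1..n}" "j \<in> {1..n}" for i j
      using GD_in(1)[OF that] rep_right_mult[OF that] by (simp add: pull_iff)
  qed
  have "G \<subseteq> ?D" unfolding G_def using raise lower by blast
  then show "op_algebra n q G \<subseteq> D_alg n q (form N)"
    unfolding D by (rule op_algebra_least[OF _ GD])
qed

lemma rep_se_raise:
  assumes "i \<in> {1..n}" "j \<in> {1..n}"
  shows "rep (se_raise i j) (VSE n q i j \<otimes>\<^bsub>L\<^esub> Mo n q i j)"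
  using rep_mult[OF rep_VSE[of i j] rep_Mo[OF assms]] unfolding se_raise_def shift_op_mult se_sum_shift by (simp only: add_0_left mult_1_right)

lemma rep_se_lower: "rep (se_lower i j) (VSE n q i j \<otimes>\<^bsub>L\<^esub> calDo n q i j)"
  using rep_mult[OF rep_VSE[of i j] rep_calDo[of i j]] unfolding se_lower_def shift_op_mult se_sum_shift by (simp only: add_0_left)

abbreviation "K_gens \<equiv> {VSE n q i j \<otimes>\<^bsub>L\<^esub> calDo n q i j | i j. i \<in> {1..n} \<and> j \<in> {1..n}} \<union>
  {VSE n q i j \<otimes>\<^bsub>L\<^esub> Mo n q i j | i j. i \<in> {1..n} \<and> j \<in> {1..n}}"

lemma se_raise_se_lower_K_gens:
  assumes "i \<in> {1..n}" "j \<in> {1..n}"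
  shows "se_raise i j \<in> pull (op_algebra n q K_gens) \<and> se_lower i j \<in> pull (op_algebra n q K_gens)"
  unfolding pull_iff[OF rep_se_raise[OF assms]] pull_iff[OF rep_se_lower]
  using op_algebra_incl[of K_gens] assms by blast

lemma adj_K:
  assumes "i \<in> {1..n}" "j \<in> {1..n}"
  shows "adj (weight (cint q)) (VSE n q i j \<otimes>\<^bsub>L\<^esub> Mo n q i j) (scalar_map kappa \<otimes>\<^bsub>L\<^esub> (VSE n q i j \<otimes>\<^bsub>L\<^esub> calDo n q i j))"
proof (rule adj_raise_lower[OF assms rep_se_raise[OF assms, unfolded se_raise_def] rep_se_lower[unfolded se_lower_def]])
  fix a
  show "q powi se_sum i j (embed (a + unit_index i j)) * cnum (embed (a + unit_index i j) (i, j)) =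
      q powi se_sum i j (embed a) * cint q (Suc (Poly_Mapping.lookup a (i, j)))"
    unfolding embed_add se_sum_shift unit_expo_at cint_cnum embed_at by (simp add: add.commute)
qed (simp add: embed_at cnum_0)

lemma D_alg_K: "D_alg n q (pairing_K n q) = op_algebra n q K_gens"
  unfolding pairing_form
proof (rule D_alg_eq)
  fix i j assume ij: "i \<in> {1..n}" "j \<in> {1..n}"
  show "VSE n q i j \<otimes>\<^bsub>L\<^esub> Mo n q i j \<in> carrier L \<and> VSE n q i j \<otimes>\<^bsub>L\<^esub> calDo n q i j \<in> carrier L"
    using rep_closed[OF rep_se_raise[OF ij]] rep_closed[OF rep_se_lower] by blast
  show "right_op n q n i j \<in> pull (op_algebra n q K_gens)"
    by (rule right_op_in_subalg[OF subalg_pull se_raise_se_lower_K_gens ij])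
next
  fix D i j
  assume C: "subalg (pull D)"
    and Y: "\<And>i j. i \<in> {1..n} \<Longrightarrow> j \<in> {1..n} \<Longrightarrow> right_op n q n i j \<in> pull D"
    and lower: "\<And>i j. i \<in> {1..n} \<Longrightarrow> j \<in> {1..n} \<Longrightarrow> VSE n q i j \<otimes>\<^bsub>L\<^esub> Mo n q i j \<in> D \<Longrightarrow> VSE n q i j \<otimes>\<^bsub>L\<^esub> calDo n q i j \<in> D"
    and ij: "i \<in> {1..n}" "j \<in> {1..n}"
  \<comment> \<open>Descent over columns: in the later columns \<open>lower\<close> turns raising
    operators into lowering ones, and together they provide the jumps needed for column
    \<open>j\<close>.\<close>
  have "j \<in> {1..n} \<Longrightarrow> \<forall>i\<in>{1..n}. se_raise i j \<in> pull D" for j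
  proof (induction "n - j" arbitrary: j rule: less_induct)
    case less
    have "se_raise i t \<in> pull D \<and> se_lower i t \<in> pull D" if "i \<in> {1..n}" "t \<in> {Suc j..n}" for i t
    proof -
      have t: "t \<in> {1..n}" using that by simp
      then have "se_raise i t \<in> pull D" using less.hyps[of t] less.prems that by auto
      then show ?thesis
        using lower[OF that(1) t] by (simp add: pull_iff[OF rep_se_raise[OF that(1) t]] pull_iff[OF rep_se_lower])
    qed
    then show ?case using se_raise_in_subalg[OF C less.prems _ Y] less.prems by blast
  qed
  then show "VSE n q i j \<otimes>\<^bsub>L\<^esub> Mo n q i j \<in> D"
    using ij by (simp add: pull_iff[OF rep_se_raise[OF ij], symmetric])
qed (use adj_K weight_nonzero in auto)

section \<open>The pairing L and the quantum Weyl algebra\<close>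

definition raise_op :: "nat \<Rightarrow> nat \<Rightarrow> linop" where
  "raise_op i j = shift_op (unit_expo (i, j)) (\<lambda>a. 1)"

definition lower_op :: "nat \<Rightarrow> nat \<Rightarrow> linop" where
  "lower_op i j = shift_op (- unit_expo (i, j)) (\<lambda>a. qnum (a (i, j)))"

lemma Ho_in_subalg:
  assumes C: "subalg C" and V: "raise_op i j \<in> C" "lower_op i j \<in> C"
  shows "diag_op (\<lambda>a. q powi (1 * a (i, j))) \<in> C" "diag_op (\<lambda>a. q powi (- 1 * a (i, j))) \<in> C"
proof -
  have DM: "lower_op i j * raise_op i j = diag_op (\<lambda>a. qnum (a (i, j) + 1))"
    unfolding lower_op_def raise_op_def shift_op_mult unit_expo_at by simp
  have MD: "raise_op i j * lower_op i j = diag_op (\<lambda>a. qnum (a (i, j)))"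
    unfolding lower_op_def raise_op_def shift_op_mult by simp
  have "lower_op i j * raise_op i j - scalar_op q * (raise_op i j * lower_op i j) \<in> C" "lower_op i j * raise_op i j - scalar_op (inverse q) * (raise_op i j * lower_op i j) \<in> C"
    by (intro subalg_minus[OF C] subalg_mult[OF C] subalg_scalar_op[OF C] V)+
  then show "diag_op (\<lambda>a. q powi (1 * a (i, j))) \<in> C" "diag_op (\<lambda>a. q powi (- 1 * a (i, j))) \<in> C"
    unfolding DM MD scalar_op_diag_op shift_op_minus qnum_step by simp_all
qed

lemma Ho_se_sum_in_subalg:
  assumes C: "subalg C"
    and V: "\<And>i j. i \<in> {1..n} \<Longrightarrow> j \<in> {m..n} \<Longrightarrow> raise_op i j \<in> C \<and> lower_op i j \<in> C"
    and ij: "i \<in> {1..n}" "j \<in> {m..n}"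
  shows "diag_op (\<lambda>a. q powi (1 * se_sum i j a)) \<in> C" "diag_op (\<lambda>a. q powi (- 1 * se_sum i j a)) \<in> C"
  by (rule diag_op_se_sum[OF C]; rule Ho_in_subalg[OF C]; use V ij in simp)+

lemma se_raise_eq: "se_raise i j = diag_op (\<lambda>a. q powi (1 * se_sum i j a)) * raise_op i j"
  unfolding se_raise_def raise_op_def shift_op_mult se_sum_shift by simp

lemma raise_op_eq: "raise_op i j = diag_op (\<lambda>a. q powi (- 1 * se_sum i j a)) * se_raise i j"
  unfolding se_raise_def raise_op_def shift_op_mult se_sum_shift using q0 by (simp add: power_int_minus)

text \<open>Since {{m}} = q [m] q^-m, the inverse of H may act before the lowering, at the cost of
  the scalar q.\<close>

lemma se_lower_eq: "se_lower i j = scalar_op q * (diag_op (\<lambda>a. q powi (1 * se_sum i j a)) * lower_op i j * diag_op (\<lambda>a. q powi (- 1 * a (i, j))))"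
proof -
  have "cnum m = q * (qnum m * q powi (- 1 * m))" for m
    using q0 by (simp add: cnum_def power_int_diff power_int_minus divide_inverse)
  then show ?thesis
    unfolding se_lower_def lower_op_def shift_op_mult se_sum_shift by (simp add: mult_ac)
qed

lemma se_raise_se_lower_in_subalg:
  assumes C: "subalg C"
    and V: "\<And>i j. i \<in> {1..n} \<Longrightarrow> j \<in> {m..n} \<Longrightarrow> raise_op i j \<in> C \<and> lower_op i j \<in> C"
    and ij: "i \<in> {1..n}" "j \<in> {m..n}"
  shows "se_raise i j \<in> C \<and> se_lower i j \<in> C"
proof -
  have MD: "raise_op i j \<in> C" "lower_op i j \<in> C" using V[OF ij] by auto
  show ?thesis
    unfolding se_raise_eq se_lower_eq
    by (intro conjI subalg_mult[OF C] subalg_scalar_op[OF C] Ho_se_sum_in_subalg[OF C V ij] Ho_in_subalg[OF C] MD)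
qed

lemma rep_raise_op: "i \<in> {1..n} \<Longrightarrow> j \<in> {1..n} \<Longrightarrow> rep (raise_op i j) (Mo n q i j)"
  unfolding raise_op_def by (rule rep_Mo)

lemma rep_lower_op: "rep (lower_op i j) (Do n q i j)"
  unfolding lower_op_def by (rule rep_Do)

lemma D_alg_L: "D_alg n q (pairing_L n q) = Weyl n q"
  unfolding pairing_form Weyl_def Un_commute[of "{Mo n q i j |i j. i \<in> {1..n} \<and> j \<in> {1..n}}"]
proof (rule D_alg_eq)
  let ?G = "{Do n q i j | i j. i \<in> {1..n} \<and> j \<in> {1..n}} \<union> {Mo n q i j | i j. i \<in> {1..n} \<and> j \<in> {1..n}}"
  have MD: "raise_op i j \<in> pull (op_algebra n q ?G) \<and> lower_op i j \<in> pull (op_algebra n q ?G)" if "i \<in> {1..n}" "j \<in> {1..n}" for i j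
    unfolding pull_iff[OF rep_raise_op[OF that]] pull_iff[OF rep_lower_op] using op_algebra_incl[of ?G] that by blast
  fix i j assume ij: "i \<in> {1..n}" "j \<in> {1..n}"
  show "Mo n q i j \<in> carrier L \<and> Do n q i j \<in> carrier L"
    using rep_closed[OF rep_raise_op[OF ij]] rep_closed[OF rep_lower_op] by blast
  show "right_op n q n i j \<in> pull (op_algebra n q ?G)"
    by (rule right_op_in_subalg[OF subalg_pull se_raise_se_lower_in_subalg[OF subalg_pull MD] ij])
  show "adj (weight (qint q)) (Mo n q i j) (scalar_map kappa \<otimes>\<^bsub>L\<^esub> Do n q i j)"
  proof (rule adj_raise_lower[OF ij rep_raise_op[OF ij, unfolded raise_op_def] rep_lower_op[unfolded lower_op_def]])
    fix a
    show "qnum (embed (a + unit_index i j) (i, j)) = 1 * qint q (Suc (Poly_Mapping.lookup a (i, j)))"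
      unfolding embed_add unit_expo_at qint_qnum embed_at by (simp add: add.commute)
  qed (simp add: embed_at qnum_0)
next
  fix D i j
  assume C: "subalg (pull D)"
    and Y: "\<And>i j. i \<in> {1..n} \<Longrightarrow> j \<in> {1..n} \<Longrightarrow> right_op n q n i j \<in> pull D"
    and lower: "\<And>i j. i \<in> {1..n} \<Longrightarrow> j \<in> {1..n} \<Longrightarrow> Mo n q i j \<in> D \<Longrightarrow> Do n q i j \<in> D"
    and ij: "i \<in> {1..n}" "j \<in> {1..n}"
  have low: "lower_op i j \<in> pull D" if "i \<in> {1..n}" "j \<in> {1..n}" "raise_op i j \<in> pull D" for i j
    using lower[OF that(1,2)] that(3) by (simp add: pull_iff[OF rep_raise_op[OF that(1,2)]] pull_iff[OF rep_lower_op])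
  have "j \<in> {1..n} \<Longrightarrow> \<forall>i\<in>{1..n}. raise_op i j \<in> pull D" for j
  proof (induction "n - j" arbitrary: j rule: less_induct)
    case less
    have MD: "raise_op i t \<in> pull D \<and> lower_op i t \<in> pull D" if "i \<in> {1..n}" "t \<in> {Suc j..n}" for i t
    proof -
      have "t \<in> {1..n}" using that by simp
      moreover from this have "raise_op i t \<in> pull D" using less.hyps[of t] less.prems that by auto
      ultimately show ?thesis using low that by blast
    qed
    have VV: "se_raise i t \<in> pull D \<and> se_lower i t \<in> pull D" if "i \<in> {1..n}" "t \<in> {Suc j..n}" for i t
      by (rule se_raise_se_lower_in_subalg[OF C MD that])
    have V: "se_raise i j \<in> pull D" if "i \<in> {1..n}" for i
      by (rule se_raise_in_subalg[OF C less.prems VV Y[OF _ less.prems] that])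
    \<comment> \<open>\<open>se_raise i j\<close> still contains V^SE_ij. The inverse of this factor
      involves later columns and the cells below in column \<open>j\<close>; the latter force a
      descent over rows.\<close>
    have "i \<in> {1..n} \<Longrightarrow> raise_op i j \<in> pull D" for i
    proof (induction "n - i" arbitrary: i rule: less_induct)
      case (less i)
      have "diag_op (\<lambda>a. q powi (- 1 * a (k, j))) \<in> pull D" if "i < k" "k \<le> n" for k
      proof -
        have k: "k \<in> {1..n}" using that by simp
        then have "raise_op k j \<in> pull D" using less.hyps[of k] that less.prems by auto
        then show ?thesis using low[OF k \<open>j \<in> {1..n}\<close>] by (intro Ho_in_subalg(2)[OF C])
      qed
      moreover have "diag_op (\<lambda>a. q powi (- 1 * a (i, s))) \<in> pull D" if "j < s" "s \<le> n" for s
        using MD[OF less.prems, of s] that by (intro Ho_in_subalg(2)[OF C]) auto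
      ultimately have "diag_op (\<lambda>a. q powi (- 1 * se_sum i j a)) \<in> pull D"
        by (rule diag_op_se_sum[OF C])
      then show ?case unfolding raise_op_eq using V[OF less.prems] by (rule subalg_mult[OF C])
    qed
    then show ?case by blast
  qed
  then show "Mo n q i j \<in> D"
    using ij by (simp add: pull_iff[OF rep_raise_op[OF ij], symmetric])
qed (use weight_nonzero in auto)

section \<open>Squares of the operators H_ij\<close>

lemma rep_Ho_square:
  shows "rep (diag_op (\<lambda>a. q powi (2 * a (i, j)))) (Ho n q i j [^]\<^bsub>L\<^esub> (2::int))"
    and "rep (diag_op (\<lambda>a. q powi (- 2 * a (i, j)))) (Ho n q i j [^]\<^bsub>L\<^esub> (- 2::int))"
proof -
  have H: "Ho n q i j \<in> carrier L" using rep_Ho by (rule rep_closed)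
  have "Ho n q i j [^]\<^bsub>L\<^esub> (2::nat) = Ho n q i j \<otimes>\<^bsub>L\<^esub> Ho n q i j"
    using H by (simp add: numeral_2_eq_2)
  moreover have "rep (diag_op (\<lambda>a. q powi a (i, j)) * diag_op (\<lambda>a. q powi a (i, j))) (Ho n q i j \<otimes>\<^bsub>L\<^esub> Ho n q i j)"
    by (intro rep_mult rep_Ho)
  ultimately have 2: "rep (diag_op (\<lambda>a. q powi (2 * a (i, j)))) (Ho n q i j [^]\<^bsub>L\<^esub> (2::nat))"
    by (simp only: diag_op_mult powi_double(1))
  then show "rep (diag_op (\<lambda>a. q powi (2 * a (i, j)))) (Ho n q i j [^]\<^bsub>L\<^esub> (2::int))"
    by (simp add: int_pow_def2)
  have "rep (diag_op (\<lambda>a. inverse (q powi (2 * a (i, j))))) (inv\<^bsub>L\<^esub> (Ho n q i j [^]\<^bsub>L\<^esub> (2::nat)))"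
    using q0 by (intro rep_inv_diag_op 2) simp
  then show "rep (diag_op (\<lambda>a. q powi (- 2 * a (i, j)))) (Ho n q i j [^]\<^bsub>L\<^esub> (- 2::int))"
    by (simp add: int_pow_def2 power_int_minus)
qed

lemma Ho_square_mem:
  assumes "i \<in> {1..n}" "j \<in> {1..n}" "(i, j) \<noteq> (1, 1)"
  shows "Ho n q i j [^]\<^bsub>L\<^esub> (2::int) \<in> op_algebra n q K_gens"
  using square_in_subalg'[OF subalg_pull se_raise_se_lower_K_gens assms] by (simp only: pull_iff[OF rep_Ho_square(1)])

lemma Ho_inv_square_mem:
  assumes "i \<in> {1..n}" "j \<in> {1..n}"
  shows "Ho n q i j [^]\<^bsub>L\<^esub> (- 2::int) \<in> op_algebra n q K_gens"
  using inv_square_in_subalg[OF subalg_pull se_raise_se_lower_K_gens, of 1 i j] assms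
  by (simp only: pull_iff[OF rep_Ho_square(2)] atLeastAtMost_iff le_refl simp_thms)

text \<open>
  The functionals that are polynomial in \<open>q\<^sup>-\<^sup>2\<^sup>m\<close> along each ray \<open>a + m e\<^sub>1\<^sub>1\<close> are stable under
  the transposes of the generators, because \<open>H\<^sub>1\<^sub>1\<close> occurs in them only through
  \<open>{{m}}\<close>, a polynomial in \<open>q\<^sup>-\<^sup>2\<^sup>m\<close>.
\<close>

abbreviation shift11 :: "mindex \<Rightarrow> nat \<Rightarrow> mindex" where
  "shift11 a m \<equiv> a + Poly_Mapping.single (1, 1) m"

abbreviation ray_pt :: "nat \<Rightarrow> complex" where
  "ray_pt m \<equiv> (inverse q * inverse q) ^ m"

definition poly_ray :: "(ncpoly set \<Rightarrow> complex) \<Rightarrow> bool" where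
  "poly_ray l \<longleftrightarrow> (\<forall>u\<in>carrier A. \<forall>v\<in>carrier A. l (u \<oplus>\<^bsub>A\<^esub> v) = l u + l v) \<and>
     (\<forall>c. \<forall>u\<in>carrier A. l (smul n q c u) = c * l u) \<and>
     (\<forall>a\<in>mindices n. Poly_Mapping.lookup a (1, 1) = 0 \<longrightarrow> (\<exists>p. \<forall>m. l (mon n q (shift11 a m)) = poly p (ray_pt m)))"

text \<open>The target \<open>b\<close> is arbitrary where the coefficient vanishes; this covers
  lowering at exponent zero, where the difference of indices is truncated.\<close>

lemma mon_image:
  assumes "rep (shift_op d c) T" "a \<in> mindices n" "b \<in> mindices n" "c (embed a) \<noteq> 0 \<Longrightarrow> embed b = embed a + d"
  shows "T (mon n q a) = smul n q (c (embed a)) (mon n q b)"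
proof (rule expand_inj)
  show "T (mon n q a) \<in> carrier A" using rep_closed[OF assms(1)] by (simp add: L_closed)
  show "expand (T (mon n q a)) = expand (smul n q (c (embed a)) (mon n q b))"
    using assms(2-) rep_expand[OF assms(1)] by (cases "c (embed a) = 0") (simp_all add: expand_mon expand_smul app_shift_op_delta)
qed simp

lemma shift11_mindices: "1 \<le> n \<Longrightarrow> a \<in> mindices n \<Longrightarrow> shift11 a m \<in> mindices n"
  unfolding mindices_iff by (auto simp: lookup_add lookup_single when_def)

text \<open>The cell (1,1) is neither below nor to the right of any cell, so moving along the ray
  does not affect V^SE_ij.\<close>

lemma se_sum_shift11: "1 \<le> i \<Longrightarrow> 1 \<le> j \<Longrightarrow> se_sum i j (embed (shift11 a m)) = se_sum i j (embed a)"
  unfolding se_sum_def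
  by (intro arg_cong2[where f = "(+)"] sum.cong refl) (auto simp: embed_at lookup_add lookup_single when_def)

lemma cnum_ray_pt: "cnum (int m) = (q - q * ray_pt m) / (q - inverse q)"
proof -
  have "q powi (- 2 * int m) = inverse (q powi int m * q powi int m)" by (rule powi_double(2))
  also have "\<dots> = ray_pt m" by (simp add: power_mult_distrib power_inverse)
  finally show ?thesis by (simp add: cnum_alt)
qed

lemma poly_ray_se_raise:
  assumes ij: "i \<in> {1..n}" "j \<in> {1..n}" and l: "poly_ray l" and a: "a \<in> mindices n" "Poly_Mapping.lookup a (1, 1) = 0"
  shows "\<exists>p. \<forall>m. l ((VSE n q i j \<otimes>\<^bsub>L\<^esub> Mo n q i j) (mon n q (shift11 a m))) = poly p (ray_pt m)"
proof -
  have n: "1 \<le> n" using ij by simp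
  let ?v = "q powi se_sum i j (embed a)"
  have T: "l ((VSE n q i j \<otimes>\<^bsub>L\<^esub> Mo n q i j) (mon n q (shift11 a m))) = ?v * l (mon n q (shift11 a m + unit_index i j))" for m
    using l ij a n unfolding poly_ray_def
    by (subst mon_image[OF rep_se_raise[OF ij, unfolded se_raise_def], of _ "shift11 a m + unit_index i j"])
      (auto simp: shift11_mindices mindices_add embed_add se_sum_shift11 simp del: One_nat_def)
  show ?thesis
  proof (cases "(i, j) = (1, 1)")
    case True
    obtain p where p: "\<And>m. l (mon n q (shift11 a m)) = poly p (ray_pt m)"
      using l a unfolding poly_ray_def by blast
    have "shift11 a m + unit_index i j = shift11 a (Suc m)" for m
      using True by (simp add: add.assoc single_add[symmetric])
    \<comment> \<open>Raising replaces m by m + 1, which multiplies the point q^(-2m) by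
      q^-2.\<close>
    then have "l ((VSE n q i j \<otimes>\<^bsub>L\<^esub> Mo n q i j) (mon n q (shift11 a m))) =
        poly (smult ?v (pcompose p [:0, inverse q * inverse q:])) (ray_pt m)" for m
      unfolding T by (simp add: p poly_pcompose mult_ac del: One_nat_def)
    then show ?thesis by blast
  next
    case False
    have "a + unit_index i j \<in> mindices n" "Poly_Mapping.lookup (a + unit_index i j) (1, 1) = 0"
      using mindices_add[OF a(1) ij] False a(2) by (auto simp: lookup_add lookup_single when_def)
    then obtain p where "\<And>m. l (mon n q (shift11 (a + unit_index i j) m)) = poly p (ray_pt m)"
      using l unfolding poly_ray_def by blast
    then have "l ((VSE n q i j \<otimes>\<^bsub>L\<^esub> Mo n q i j) (mon n q (shift11 a m))) = poly (smult ?v p) (ray_pt m)" for m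
      unfolding T by (simp add: ac_simps)
    then show ?thesis by blast
  qed
qed

lemma poly_ray_se_lower:
  assumes ij: "i \<in> {1..n}" "j \<in> {1..n}" and l: "poly_ray l" and a: "a \<in> mindices n" "Poly_Mapping.lookup a (1, 1) = 0"
  shows "\<exists>p. \<forall>m. l ((VSE n q i j \<otimes>\<^bsub>L\<^esub> calDo n q i j) (mon n q (shift11 a m))) = poly p (ray_pt m)"
proof -
  have n: "1 \<le> n" using ij by simp
  let ?v = "q powi se_sum i j (embed a)"
  have e: "embed (b - unit_index i j) = embed b + - unit_expo (i, j)" if "Poly_Mapping.lookup b (i, j) \<noteq> 0" for b
  proof -
    have "b - unit_index i j + unit_index i j = b"
      using that by (intro poly_mapping_eqI) (auto simp: lookup_add lookup_minus lookup_single when_def)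
    then show ?thesis using embed_add[of "b - unit_index i j" "(i, j)"] by (simp add: algebra_simps del: One_nat_def)
  qed
  have T: "l ((VSE n q i j \<otimes>\<^bsub>L\<^esub> calDo n q i j) (mon n q (shift11 a m))) =
      ?v * cnum (int (Poly_Mapping.lookup (shift11 a m) (i, j))) * l (mon n q (shift11 a m - unit_index i j))" for m
  proof -
    have "cnum (embed (shift11 a m) (i, j)) \<noteq> 0 \<Longrightarrow> Poly_Mapping.lookup (shift11 a m) (i, j) \<noteq> 0"
      by (metis cnum_0 embed_at of_nat_0)
    then have "(VSE n q i j \<otimes>\<^bsub>L\<^esub> calDo n q i j) (mon n q (shift11 a m)) =
       smul n q (q powi se_sum i j (embed (shift11 a m)) * cnum (embed (shift11 a m) (i, j))) (mon n q (shift11 a m - unit_index i j))"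
      using a n by (intro mon_image[OF rep_se_lower[unfolded se_lower_def]] shift11_mindices mindices_diff e) auto
    then show ?thesis
      using l ij unfolding poly_ray_def by (simp add: se_sum_shift11 embed_at del: One_nat_def)
  qed
  show ?thesis
  proof (cases "(i, j) = (1, 1)")
    case True
    obtain p where p: "\<And>m. l (mon n q (shift11 a m)) = poly p (ray_pt m)"
      using l a unfolding poly_ray_def by blast
    \<comment> \<open>Lowering replaces m by m - 1, which multiplies the point by q^2, and brings in
      {{m}}. At m = 0 the truncated index is harmless because \<open>[:q, - q:]\<close> vanishes at
      the point 1.\<close>
    let ?p = "smult (?v / (q - inverse q)) ([:q, - q:] * pcompose p [:0, q * q:])"
    have "l ((VSE n q i j \<otimes>\<^bsub>L\<^esub> calDo n q i j) (mon n q (shift11 a m))) = poly ?p (ray_pt m)" for m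
    proof (cases m)
      case 0
      then show ?thesis unfolding T using True a(2) by (simp add: cnum_0)
    next
      case (Suc k)
      define y where "y = ray_pt m"
      have s: "shift11 a m - unit_index i j = shift11 a k"
        unfolding Suc using True by (intro poly_mapping_eqI) (auto simp: lookup_add lookup_minus lookup_single when_def)
      have k: "ray_pt k = q * q * y" using q0 by (simp add: y_def Suc field_simps)
      have lk: "Poly_Mapping.lookup (shift11 a m) (i, j) = m" using True a(2) by (simp add: lookup_add)
      show ?thesis
        unfolding T lk s p k cnum_ray_pt y_def[symmetric] by (simp add: poly_pcompose algebra_simps diff_divide_distrib)
    qed
    then show ?thesis by blast
  next
    case False
    have "a - unit_index i j \<in> mindices n" "Poly_Mapping.lookup (a - unit_index i j) (1, 1) = 0"
      using mindices_diff[OF a(1)] a(2) by (simp_all add: lookup_minus)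
    then obtain p where p: "\<And>m. l (mon n q (shift11 (a - unit_index i j) m)) = poly p (ray_pt m)"
      using l unfolding poly_ray_def by blast
    have "shift11 a m - unit_index i j = shift11 (a - unit_index i j) m" for m
      using False by (intro poly_mapping_eqI) (auto simp: lookup_add lookup_minus lookup_single when_def)
    moreover have "Poly_Mapping.lookup (shift11 a m) (i, j) = Poly_Mapping.lookup a (i, j)" for m
      using False by (auto simp: lookup_add lookup_single when_def)
    ultimately have "l ((VSE n q i j \<otimes>\<^bsub>L\<^esub> calDo n q i j) (mon n q (shift11 a m))) =
       poly (smult (?v * cnum (int (Poly_Mapping.lookup a (i, j)))) p) (ray_pt m)" for m
      unfolding T by (simp add: p del: One_nat_def)
    then show ?thesis by blast
  qed
qed

lemma K_gens_closed: "K_gens \<subseteq> carrier L"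
  using rep_closed[OF rep_se_raise] rep_closed[OF rep_se_lower] by blast

text \<open>The functional stays arbitrary in the induction because a product of \<open>S\<close>
  and \<open>T\<close> is treated by transporting \<open>l\<close> along \<open>S\<close> first and
  the result along \<open>T\<close>.\<close>

lemma poly_ray_op_algebra:
  assumes "T \<in> op_algebra n q K_gens" "poly_ray l"
  shows "poly_ray (\<lambda>u. l (T u))"
  using assms(1) K_gens_closed assms(2)
proof (induction arbitrary: l rule: op_algebra_induct)
  case (scalar_map c)
  then have "\<exists>p. \<forall>m. c * l (mon n q (shift11 a m)) = poly p (ray_pt m)"
    if "a \<in> mindices n" "Poly_Mapping.lookup a (1, 1) = 0" for a
    using that unfolding poly_ray_def by (metis poly_smult)
  then show ?case
    using scalar_map unfolding poly_ray_def by (simp add: scalar_map_def distrib_left smul_smul mult_ac)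
next
  case (gen T)
  then have T: "T \<in> carrier L" using K_gens_closed by blast
  have "\<exists>p. \<forall>m. l (T (mon n q (shift11 a m))) = poly p (ray_pt m)"
    if "a \<in> mindices n" "Poly_Mapping.lookup a (1, 1) = 0" for a
    using gen that poly_ray_se_raise poly_ray_se_lower by blast
  then show ?case
    using gen T unfolding poly_ray_def by (simp add: L_add L_smul L_closed)
next
  case (add S T)
  have S: "poly_ray (\<lambda>u. l (S u))" and T: "poly_ray (\<lambda>u. l (T u))"
    using add by blast+
  have "\<exists>p. \<forall>m. l (S (mon n q (shift11 a m))) + l (T (mon n q (shift11 a m))) = poly p (ray_pt m)"
    if "a \<in> mindices n" "Poly_Mapping.lookup a (1, 1) = 0" for a
    using that S T unfolding poly_ray_def by (metis poly_add)
  moreover have "l ((S \<oplus>\<^bsub>L\<^esub> T) u) = l (S u) + l (T u)" if "u \<in> carrier A" for u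
    using that add unfolding poly_ray_def by (simp add: L_sel L_closed)
  ultimately show ?case
    using S T unfolding poly_ray_def by (simp add: distrib_left)
next
  case (mult S T)
  have "poly_ray (\<lambda>u. l (S (T u)))"
    using mult.IH(2)[OF mult.IH(1)[OF mult.prems]] by simp
  then show ?case unfolding poly_ray_def by (simp add: L_sel compose_def)
qed

lemma ray_pt_inj: "ray_pt k = ray_pt m \<Longrightarrow> k = m"
proof (rule ccontr)
  have *: False if "ray_pt k = ray_pt m" "k < m" for k m
  proof -
    have "ray_pt m = ray_pt k * ray_pt (m - k)" using power_add[of "inverse q * inverse q" k "m - k"] that(2) by simp
    then have "ray_pt (m - k) = 1" using that q0 by simp
    then have "inverse (q ^ ((m - k) + (m - k))) = 1" by (simp only: power_add power_mult_distrib inverse_mult_distrib power_inverse)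
    then have "q ^ ((m - k) + (m - k)) = 1" by (simp only: inverse_eq_1_iff)
    then show False using generic[rule_format, of "(m - k) + (m - k)"] that by simp
  qed
  assume "ray_pt k = ray_pt m" "k \<noteq> m"
  then show False using *[of k m] *[of m k] by (metis nat_neq_iff)
qed

lemma Ho11_square_not_mem:
  assumes n: "1 \<le> n"
  shows "Ho n q 1 1 [^]\<^bsub>L\<^esub> (2::int) \<notin> op_algebra n q K_gens"
proof
  let ?T = "Ho n q 1 1 [^]\<^bsub>L\<^esub> (2::int)"
  let ?c = "\<lambda>u. Poly_Mapping.lookup (coord n q u)"
  assume mem: "?T \<in> op_algebra n q K_gens"
  \<comment> \<open>The functional with value 1 at every monomial, hence a constant polynomial on
    each ray.\<close>
  define l where "l u = (\<Sum>a\<in>Poly_Mapping.keys (coord n q u). ?c u a)" for u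
  have l: "l u = (\<Sum>a\<in>S. ?c u a)" if "finite S" "Poly_Mapping.keys (coord n q u) \<subseteq> S" for u S
    unfolding l_def using that by (intro sum.mono_neutral_left) (auto simp: in_keys_iff)
  have l_mon: "l (mon n q a) = 1" if "a \<in> mindices n" for a
    using that by (subst l[of "{a}"]) (auto simp: in_keys_iff coord_mon split: if_splits)
  have l_smul: "l (smul n q c u) = c * l u" if "u \<in> carrier A" for c u
    using that by (subst l[of "Poly_Mapping.keys (coord n q u)"])
      (auto simp: in_keys_iff coord_smul l_def sum_distrib_left)
  have l_add: "l (u \<oplus>\<^bsub>A\<^esub> v) = l u + l v" if "u \<in> carrier A" "v \<in> carrier A" for u v
  proof -
    let ?S = "Poly_Mapping.keys (coord n q u) \<union> Poly_Mapping.keys (coord n q v)"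
    have "finite ?S" by simp
    moreover have "Poly_Mapping.keys (coord n q (u \<oplus>\<^bsub>A\<^esub> v)) \<subseteq> ?S"
      using that by (auto simp: in_keys_iff coord_add)
    ultimately show ?thesis
      using that by (simp add: l[of ?S] coord_add sum.distrib)
  qed
  have "poly_ray l"
    unfolding poly_ray_def using n
    by (auto simp: l_add l_smul l_mon shift11_mindices simp del: One_nat_def intro!: exI[of _ 1])
  then have "poly_ray (\<lambda>u. l (?T u))" by (rule poly_ray_op_algebra[OF mem])
  moreover have "0 \<in> mindices n" by (simp add: mindices_iff)
  ultimately obtain p where p: "\<And>m. l (?T (mon n q (shift11 0 m))) = poly p (ray_pt m)"
    unfolding poly_ray_def by fastforce
  \<comment> \<open>On Z_11^m the operator has eigenvalue q^(2m), the inverse of the point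
    q^(-2m).\<close>
  have "ray_pt m * poly p (ray_pt m) = 1" for m
  proof -
    have s: "shift11 0 m \<in> mindices n" using n \<open>0 \<in> mindices n\<close> by (rule shift11_mindices)
    have "?T (mon n q (shift11 0 m)) = smul n q (q powi (2 * embed (shift11 0 m) (1, 1))) (mon n q (shift11 0 m))"
      by (rule mon_image[OF rep_Ho_square(1) s s]) simp
    then have "poly p (ray_pt m) = q powi (2 * int m)"
      using s by (simp add: p[symmetric] l_smul l_mon embed_at del: One_nat_def)
    then have "poly p (ray_pt m) = q ^ m * q ^ m"
      by (simp only: powi_double(1) power_int_of_nat)
    then show ?thesis
      using q0 by (simp add: power_mult_distrib field_simps)
  qed
  \<comment> \<open>As \<open>q\<close> is not a root of unity, these are infinitely many points, so
    y p(y) = 1 would hold identically; this fails at y = 0.\<close>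
  then have "range ray_pt \<subseteq> {y. poly ([:0, 1:] * p - 1) y = 0}" by auto
  moreover have "infinite (range ray_pt)"
    using ray_pt_inj by (intro range_inj_infinite injI)
  ultimately have "[:0, 1:] * p - 1 = 0"
    using poly_roots_finite finite_subset by metis
  then have "poly ([:0, 1:] * p - 1) 0 = 0" by simp
  then show False by simp
qed

end

theorem proposition8p5p10:
  fixes n :: nat and q :: complex
  assumes "n \<ge> 1"
    and "q \<noteq> 0"
    and "\<forall>m::nat. m > 0 \<longrightarrow> q ^ m \<noteq> 1"
  shows "D_alg n q (pairing_L n q) = Weyl n q
    \<and> D_alg n q (pairing_K n q) = op_algebra n q
        ({VSE n q i j \<otimes>\<^bsub>lin_ops n q\<^esub> calDo n q i j | i j. i \<in> {1..n} \<and> j \<in> {1..n}} \<union>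
         {VSE n q i j \<otimes>\<^bsub>lin_ops n q\<^esub> Mo n q i j | i j. i \<in> {1..n} \<and> j \<in> {1..n}})
    \<and> (\<forall>i\<in>{1..n}. \<forall>j\<in>{1..n}. (i, j) \<noteq> (1, 1) \<longrightarrow>
         Ho n q i j [^]\<^bsub>lin_ops n q\<^esub> (2::int) \<in> D_alg n q (pairing_K n q) \<and>
         Ho n q i j [^]\<^bsub>lin_ops n q\<^esub> (-2::int) \<in> D_alg n q (pairing_K n q))
    \<and> Ho n q 1 1 [^]\<^bsub>lin_ops n q\<^esub> (-2::int) \<in> D_alg n q (pairing_K n q)
    \<and> Ho n q 1 1 [^]\<^bsub>lin_ops n q\<^esub> (2::int) \<notin> D_alg n q (pairing_K n q)"
proof -
  interpret generic_quantum_matrices n q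
    using assms(2,3) by unfold_locales
  have "(1::nat) \<in> {1..n}" using assms(1) by simp
  then show ?thesis
    unfolding D_alg_K
    by (intro conjI ballI impI D_alg_L refl Ho_square_mem Ho_inv_square_mem Ho11_square_not_mem[OF assms(1)])
qed

end
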